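(* Let $K$ be a field, $S=K[t_1,\ldots,t_s]$, $\mathfrak{m}=(t_1,\ldots,t_s)$. Let $I=I(L)$ be the matrix ideal of an $s\times m$ integer matrix $L$ and let $\mathcal{L}\subset\mathbb{Z}^s$ be the lattice spanned by the columns of $L$. Suppose that $I$ is graded and that $V(I,t_i)=\{0\}$ for all $i$. Then: (a) $I$ has a minimal primary decomposition either of the form $I=\mathfrak{q}_1\cap\cdots\cap\mathfrak{q}_c$, if $I$ is unmixed, or else $I=\mathfrak{q}_1\cap\cdots\cap\mathfrak{q}_c\cap\mathfrak{q}$, if $I$ is not unmixed, where the $\mathfrak{q}_i$ are $\mathfrak{p}_i$-primary ideals with ${\rm ht}(\mathfrak{p}_i)=s-1$, and $\mathfrak{q}$ is an $\mathfrak{m}$-primary ideal. (b) For all $g\in\mathfrak{m}\setminus\bigcup_{i=1}^c\mathfrak{p}_i$, $I(\mathcal{L})=(I:(t_1\cdots t_s)^\infty)=(I:g^\infty)=\mathfrak{q}_1\cap\cdots\cap\mathfrak{q}_c={\rm Hull}(I)$. (c) ${\rm rank}(L)=s-1$ and there exists a unique Herzog ideal $\mathfrak{p}_{\mathbf{d}}$ containing $I$. (d) If $I$ is not unmixed and $h=t_1\cdots t_s$, there exists a positive integer $a$ such that $I(\mathcal{L})=(I:h^a)$, $\mathfrak{q}=I+(h^a)$ is an irredundant $\mathfrak{m}$-primary component of $I$, and $I=I(\mathcal{L})\cap\mathfrak{q}$. (e) Either $c\le|T(\mathbb{Z}^s/\mathcal{L})|$, if ${\rm char}(K)=0$, or else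 $c\le|G|$, if ${\rm char}(K)=p$, $p$ a prime, where $G$ is the unique largest subgroup of $T(\mathbb{Z}^s/\mathcal{L})$ whose order is relatively prime to $p$. If $K$ is algebraically closed, then equality holds.
   Context: For $a\in\mathbb{Z}^s$ write $a=a^+-a^-$ with $a^\pm\in\mathbb{N}^s$ of disjoint support, and $t^c=t_1^{c_1}\cdots t_s^{c_s}$. If $L$ is an $s\times m$ integer matrix with columns $a_1,\ldots,a_m$, its matrix ideal is $I(L)=(t^{a_1^+}-t^{a_1^-},\ldots,t^{a_m^+}-t^{a_m^-})\subset S$. For a lattice (subgroup) $\mathcal{L}\subset\mathbb{Z}^s$, the lattice ideal is $I(\mathcal{L})=(t^{a^+}-t^{a^-}\mid a\in\mathcal{L})$. Graded means homogeneous with respect to some grading of $S$ with $\deg t_i=d_i$ a positive integer. $V(\cdot)$ is the set of common zeros in $K^s$ and $V(I,t_i)=V((I,t_i))$. An ideal is unmixed if all its associated primes have the same height. ${\rm Hull}(I)$ is the intersection of the isolated primary components of $I$. For a vector $\mathbf{d}=(d_1,\ldots,d_s)$ of positive integers, the Herzog ideal $\mathfrak{p}_{\mathbf{d}}$ is the kernel of the $K$-algebra map $S\to K[x_1]$, $t_i\mapsto x_1^{d_i}$. $(I:h)=\{f\in S\mid fh\in I\}$ and $(I:h^\infty)=\bigcup_{k\ge1}(I:h^k)$. $T(M)$ is the torsion subgroup of an abelian group $M$. *)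

theory Defs
  imports
    "HOL-Library.Poly_Mapping"
    "HOL-Library.Extended_Nat"
    "HOL-Analysis.Cartesian_Space"
    "HOL-Algebra.Ideal"
    "HOL-Algebra.Coset"
    "HOL-Algebra.Generated_Groups"
    "HOL-Algebra.Algebraic_Closure_Type"
begin

definition ideal_quotient :: "('a, 'b) ring_scheme \<Rightarrow> 'a set \<Rightarrow> 'a \<Rightarrow> 'a set" where
  "ideal_quotient R I h = {f \<in> carrier R. f \<otimes>\<^bsub>R\<^esub> h \<in> I}"

definition saturation :: "('a, 'b) ring_scheme \<Rightarrow> 'a set \<Rightarrow> 'a \<Rightarrow> 'a set" where
  "saturation R I h = (\<Union>k\<in>{1::nat..}. ideal_quotient R I (h [^]\<^bsub>R\<^esub> k))"

definition radical :: "('a, 'b) ring_scheme \<Rightarrow> 'a set \<Rightarrow> 'a set" where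
  "radical R I = {f \<in> carrier R. \<exists>n::nat. f [^]\<^bsub>R\<^esub> n \<in> I}"

definition primary_ideal :: "('a, 'b) ring_scheme \<Rightarrow> 'a set \<Rightarrow> bool" where
  "primary_ideal R Q \<longleftrightarrow> ideal Q R \<and> Q \<noteq> carrier R \<and>
     (\<forall>a\<in>carrier R. \<forall>b\<in>carrier R. a \<otimes>\<^bsub>R\<^esub> b \<in> Q \<longrightarrow> a \<in> Q \<or> b \<in> radical R Q)"

text \<open>A decomposition is given by its set of components. Since the radicals of the components
  of a minimal decomposition are pairwise distinct, no multiplicities are lost.\<close>

definition minimal_primary_decomposition ::
    "('a, 'b) ring_scheme \<Rightarrow> 'a set \<Rightarrow> 'a set set \<Rightarrow> bool" where
  "minimal_primary_decomposition R I \<Q> \<longleftrightarrow>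
     finite \<Q> \<and> (\<forall>Q\<in>\<Q>. primary_ideal R Q) \<and> I = carrier R \<inter> \<Inter>\<Q> \<and>
     inj_on (radical R) \<Q> \<and> (\<forall>Q\<in>\<Q>. carrier R \<inter> \<Inter>(\<Q> - {Q}) \<noteq> I)"

definition isolated_component :: "('a, 'b) ring_scheme \<Rightarrow> 'a set \<Rightarrow> 'a set \<Rightarrow> bool" where
  "isolated_component R I Q \<longleftrightarrow>
     (\<exists>\<Q>. minimal_primary_decomposition R I \<Q> \<and> Q \<in> \<Q> \<and>
          \<not> (\<exists>Q'\<in>\<Q>. radical R Q' \<subset> radical R Q))"

definition Hull :: "('a, 'b) ring_scheme \<Rightarrow> 'a set \<Rightarrow> 'a set" where
  "Hull R I = carrier R \<inter> \<Inter>{Q. isolated_component R I Q}"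

definition prime_height :: "('a, 'b) ring_scheme \<Rightarrow> 'a set \<Rightarrow> enat" where
  "prime_height R P =
     Sup {enat n | n. \<exists>C :: nat \<Rightarrow> 'a set. (\<forall>i\<le>n. primeideal (C i) R) \<and>
                        (\<forall>i<n. C i \<subset> C (Suc i)) \<and> C n = P}"

definition associated_primes :: "('a, 'b) ring_scheme \<Rightarrow> 'a set \<Rightarrow> 'a set set" where
  "associated_primes R I =
     {P. primeideal P R \<and> (\<exists>f\<in>carrier R. P = ideal_quotient R I f)}"

definition unmixed :: "('a, 'b) ring_scheme \<Rightarrow> 'a set \<Rightarrow> bool" where
  "unmixed R I \<longleftrightarrow>
     (\<forall>P\<in>associated_primes R I. \<forall>P'\<in>associated_primes R I. prime_height R P = prime_height R P')"

text \<open>The variables are indexed by a finite type \<open>'s\<close>, so that \<open>s = CARD('s)\<close>.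
  A polynomial is a finitely supported map from exponent vectors to coefficients, and
  its ring multiplication is the convolution product.\<close>

type_synonym ('s, 'k) mpoly = "('s \<Rightarrow>\<^sub>0 nat) \<Rightarrow>\<^sub>0 'k"

abbreviation poly_ring :: "('s::finite, 'k::field) mpoly ring" where
  "poly_ring \<equiv> ring_of_type_algebra"

definition var :: "'s \<Rightarrow> ('s, 'k::field) mpoly" where
  "var i = Poly_Mapping.single (Poly_Mapping.single i 1) 1"

definition max_ideal :: "('s::finite, 'k::field) mpoly set" where
  "max_ideal = Idl\<^bsub>poly_ring\<^esub> (Set.range var)"

definition vars_prod :: "('s::finite, 'k::field) mpoly" where
  "vars_prod = (\<Prod>i\<in>UNIV. var i)"

text \<open>The value of the ring homomorphism that acts on coefficients by \<open>\<phi>\<close> and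
  sends \<open>t\<^sub>i\<close> to \<open>x i\<close>.\<close>

definition poly_subst ::
    "('k::field \<Rightarrow> 'r::comm_ring_1) \<Rightarrow> ('s::finite \<Rightarrow> 'r) \<Rightarrow> ('s, 'k) mpoly \<Rightarrow> 'r" where
  "poly_subst \<phi> x f =
     (\<Sum>e\<in>Poly_Mapping.keys f. \<phi> (Poly_Mapping.lookup f e) * (\<Prod>i\<in>UNIV. x i ^ Poly_Mapping.lookup e i))"

definition zero_set :: "('s::finite, 'k::field) mpoly set \<Rightarrow> ('k ^ 's) set" where
  "zero_set I = {x. \<forall>f\<in>I. poly_subst id (\<lambda>i. x $ i) f = 0}"

definition herzog_ideal :: "('s::finite \<Rightarrow> nat) \<Rightarrow> ('s, 'k::field) mpoly set" where
  "herzog_ideal d = {f. poly_subst (\<lambda>c. [:c:]) (\<lambda>i. [:0, 1:] ^ d i) f = 0}"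

definition homogeneous_component ::
    "('s::finite \<Rightarrow> nat) \<Rightarrow> nat \<Rightarrow> ('s, 'k::field) mpoly \<Rightarrow> ('s, 'k) mpoly" where
  "homogeneous_component d n f =
     (\<Sum>e\<in>{e \<in> Poly_Mapping.keys f. (\<Sum>i\<in>UNIV. d i * Poly_Mapping.lookup e i) = n}.
        Poly_Mapping.single e (Poly_Mapping.lookup f e))"

definition graded :: "('s::finite, 'k::field) mpoly set \<Rightarrow> bool" where
  "graded I \<longleftrightarrow> (\<exists>d. (\<forall>i. d i > 0) \<and> (\<forall>f\<in>I. \<forall>n. homogeneous_component d n f \<in> I))"

definition algebraically_closed_type :: "'k::field itself \<Rightarrow> bool" where
  "algebraically_closed_type _ \<longleftrightarrow>
     (\<forall>f :: 'k Polynomial.poly. Polynomial.degree f > 0 \<longrightarrow> (\<exists>x. Polynomial.poly f x = 0))"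

definition pos_part :: "int ^ 's \<Rightarrow> ('s::finite \<Rightarrow>\<^sub>0 nat)" where
  "pos_part a = Abs_poly_mapping (\<lambda>i. nat (a $ i))"

text \<open>\<open>t\<^bsup>a\<^sup>+\<^esup> - t\<^bsup>a\<^sup>-\<^esup>\<close>, using \<open>a\<^sup>- = (-a)\<^sup>+\<close>.\<close>

definition binomial_of :: "int ^ 's \<Rightarrow> ('s::finite, 'k::field) mpoly" where
  "binomial_of a = Poly_Mapping.single (pos_part a) 1 - Poly_Mapping.single (pos_part (- a)) 1"

definition matrix_ideal :: "int ^ 'm ^ 's \<Rightarrow> ('s::finite, 'k::field) mpoly set" where
  "matrix_ideal L = Idl\<^bsub>poly_ring\<^esub> (Set.range (\<lambda>j. binomial_of (column j L)))"

definition lattice_ideal :: "(int ^ 's) set \<Rightarrow> ('s::finite, 'k::field) mpoly set" where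
  "lattice_ideal \<Lambda> = Idl\<^bsub>poly_ring\<^esub> (binomial_of ` \<Lambda>)"

definition int_vec_group :: "(int ^ 's::finite) monoid" where
  "int_vec_group = \<lparr>carrier = UNIV, monoid.mult = (+), one = 0\<rparr>"

definition column_lattice :: "int ^ 'm ^ 's \<Rightarrow> (int ^ 's::finite) set" where
  "column_lattice L = generate int_vec_group (Set.range (\<lambda>j. column j L))"

definition torsion_subgroup :: "('a, 'b) monoid_scheme \<Rightarrow> 'a set" where
  "torsion_subgroup M = {x \<in> carrier M. \<exists>n::nat. n > 0 \<and> x [^]\<^bsub>M\<^esub> n = \<one>\<^bsub>M\<^esub>}"

definition largest_torsion_subgroup_coprime_to ::
    "nat \<Rightarrow> ('a, 'b) monoid_scheme \<Rightarrow> 'a set \<Rightarrow> bool" where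
  "largest_torsion_subgroup_coprime_to p M G \<longleftrightarrow>
     (let adm = (\<lambda>H. subgroup H M \<and> H \<subseteq> torsion_subgroup M \<and> finite H \<and> coprime (card H) p)
      in adm G \<and> (\<forall>H. adm H \<longrightarrow> H \<subseteq> G))"

text \<open>\<open>\<Q>\<close> is the set \<open>{\<qq>\<^sub>1, \<dots>, \<qq>\<^sub>c}\<close> with \<open>c = card \<Q>\<close>, and the prime belonging
  to \<open>\<qq>\<^sub>i\<close> is its radical; \<open>\<E>\<close> is empty if \<open>I\<close> is unmixed, and otherwise it consists of a
  single \<open>\<mm>\<close>-primary ideal.\<close>

definition curve_decomposition ::
    "('s::finite, 'k::field) mpoly set \<Rightarrow> ('s, 'k) mpoly set set \<Rightarrow> ('s, 'k) mpoly set set \<Rightarrow> bool" where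
  "curve_decomposition I \<Q> \<E> \<longleftrightarrow>
     minimal_primary_decomposition poly_ring I (\<Q> \<union> \<E>) \<and>
     (\<forall>\<qq>\<in>\<Q>. prime_height poly_ring (radical poly_ring \<qq>) = enat (CARD('s) - 1)) \<and>
     (if unmixed poly_ring I then \<E> = {}
      else (\<exists>\<qq>. \<E> = {\<qq>} \<and> primary_ideal poly_ring \<qq> \<and> radical poly_ring \<qq> = max_ideal))"

end

theory Submission
  imports Defs "HOL-Algebra.Sylow" "HOL-Algebra.Multiplicative_Group"
begin

text \<open>
  Since \<open>(1, \<dots>, 1)\<close> is a zero of \<open>I\<close>, gradedness forces the grading \<open>d\<close> to be orthogonal to all
  columns of \<open>L\<close>. A vector orthogonal to the columns but not proportional to \<open>d\<close> would yield, after
  subtracting a multiple of \<open>d\<close>, a zero of \<open>I\<close> with coordinates 0 and 1 that violates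
  \<open>V(I, t\<^sub>i) = {0}\<close>; this gives the rank and the uniqueness of the Herzog ideal.

  A prime containing \<open>I\<close> and a variable is \<open>\<mm>\<close>; a prime \<open>N\<close> containing \<open>I\<close> but no variable contains
  \<open>I(\<L>)\<close>, and the ideal \<open>N*\<close> of polynomials all of whose homogeneous components lie in \<open>N\<close> is again
  such a prime, lies in \<open>\<mm>\<close> and has height \<open>s - 1\<close>. The height is bounded below by refining the
  grading one variable at a time, and above because witnesses of strict inclusions in a chain of primes
  are algebraically independent. Associated primes of the homogeneous ideal \<open>I\<close> are homogeneous, so
  they are \<open>\<mm>\<close> or one of these \<open>N*\<close>. The components \<open>\<qq>\<^sub>i\<close> are the contractions of the localizations
  of \<open>I\<close>, and \<open>I = (I : h\<^sup>a) \<inter> (I + (h\<^sup>a))\<close> as soon as \<open>(I : h\<^sup>a) = (I : h\<^sup>\<infinity>)\<close>.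

  The primes \<open>N*\<close> are separated by homogeneous elements of one common degree. These are linearly
  independent modulo the lattice ideal of \<open>\<L>' = {a. p\<^sup>k a \<in> \<L> for some k}\<close>, whose degree components
  have dimension at most \<open>|\<L>\<^sub>s\<^sub>a\<^sub>t / \<L>'|\<close>, where \<open>\<L>\<^sub>s\<^sub>a\<^sub>t\<close> is the orthogonal complement of \<open>d\<close>; here
  \<open>\<L>\<^sub>s\<^sub>a\<^sub>t / \<L>\<close> is the torsion group and \<open>\<L>\<^sub>s\<^sub>a\<^sub>t / \<L>'\<close> its prime-to-\<open>p\<close> part. Over an algebraically closed
  field every character of \<open>\<L>\<^sub>s\<^sub>a\<^sub>t / \<L>'\<close> gives such a prime, and there are \<open>|\<L>\<^sub>s\<^sub>a\<^sub>t / \<L>'|\<close> characters.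
\<close>

section \<open>Ideals of a commutative ring given by a type class\<close>

text \<open>Heights come from chain counting alone: every prime over \<open>I\<close> without
  variables has s - 1 steps below it, no chain has more than s steps, and \<open>\<mm>\<close> lies
  on top of each \<open>N*\<close>. The same count makes the primes \<open>N*\<close> pairwise
  incomparable and tells them from all other primes over \<open>I\<close>, so the height identifies
  the components \<open>\<qq>\<^sub>i\<close>, and every decomposition as in (a) has the same set of
  them. Hence (b), (d) and (e), claimed for all decompositions, need only be checked for one. The
  passage to \<open>N*\<close> is forced by the maximal ideals over \<open>I\<close> of points such
  as (1, ..., 1). A common degree matters because S modulo these lattice ideals is
  infinite-dimensional, while a single degree has at most one class of monomials per coset. The
  lattice \<open>\<L>'\<close> arises because in characteristic p the p-th power of a binomial is a
  binomial, so that the binomials of \<open>\<L>'\<close> are nilpotent modulo the lattice ideal of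
  \<open>\<L>\<close>; for p = 1 it is \<open>\<L>\<close> itself, and one argument also serves
  characteristic 0.\<close>

abbreviation is_ideal :: "'a::comm_ring_1 set \<Rightarrow> bool" where
  "is_ideal A \<equiv> ideal A ring_of_type_algebra"

abbreviation is_prime :: "'a::comm_ring_1 set \<Rightarrow> bool" where
  "is_prime P \<equiv> primeideal P ring_of_type_algebra"

lemma type_ring_simps [simp]:
  "carrier (ring_of_type_algebra :: 'a::comm_ring_1 ring) = UNIV"
  "x \<otimes>\<^bsub>ring_of_type_algebra\<^esub> y = x * (y :: 'a)"
  "x \<oplus>\<^bsub>ring_of_type_algebra\<^esub> y = x + (y :: 'a)"
  "\<one>\<^bsub>ring_of_type_algebra\<^esub> = (1 :: 'a)"
  "\<zero>\<^bsub>ring_of_type_algebra\<^esub> = (0 :: 'a)"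
  by (auto simp: ring_of_type_algebra_def)

lemma type_ring_pow [simp]:
  fixes x :: "'a::comm_ring_1" and n :: nat
  shows "x [^]\<^bsub>ring_of_type_algebra\<^esub> n = x ^ n"
  by (induction n) (auto simp: nat_pow_def mult.commute)

lemma type_ring_minus [simp]:
  fixes x :: "'a::comm_ring_1"
  shows "\<ominus>\<^bsub>ring_of_type_algebra\<^esub> x = - x"
proof -
  interpret cring "ring_of_type_algebra :: 'a ring" by (rule cring_from_type_algebra)
  show ?thesis by (rule minus_equality) auto
qed

lemma is_ideal_iff:
  fixes A :: "'a::comm_ring_1 set"
  shows "is_ideal A \<longleftrightarrow> 0 \<in> A \<and> (\<forall>a\<in>A. \<forall>b\<in>A. a + b \<in> A) \<and> (\<forall>r. \<forall>a\<in>A. r * a \<in> A)"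
    (is "_ \<longleftrightarrow> ?R")
proof
  assume "is_ideal A"
  then interpret ideal A "ring_of_type_algebra :: 'a ring" .
  show ?R
    using additive_subgroup.zero_closed[OF is_additive_subgroup] additive_subgroup.a_closed[OF is_additive_subgroup] I_l_closed
    by simp
next
  assume R: ?R
  have inv: "\<ominus>\<^bsub>ring_of_type_algebra\<^esub> a \<in> A" if "a \<in> A" for a
    using R that by (metis mult_minus1 type_ring_minus)
  show "is_ideal A"
  proof (rule idealI)
    interpret ring "ring_of_type_algebra :: 'a ring" by (rule ring_from_type_algebra)
    show "ring (ring_of_type_algebra :: 'a ring)" by (rule ring_axioms)
    show "subgroup A (add_monoid (ring_of_type_algebra :: 'a ring))"
      using R inv by (intro group.subgroupI[OF add.is_group]) (auto simp: a_inv_def simp del: type_ring_minus)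
    show "x \<otimes>\<^bsub>ring_of_type_algebra\<^esub> a \<in> A" if "a \<in> A" for a x
      using R that by simp
    show "a \<otimes>\<^bsub>ring_of_type_algebra\<^esub> x \<in> A" if "a \<in> A" for a x
      using R that by (simp add: mult.commute[of a x])
  qed
qed

lemma is_idealI:
  fixes A :: "'a::comm_ring_1 set"
  assumes "0 \<in> A" "\<And>a b. a \<in> A \<Longrightarrow> b \<in> A \<Longrightarrow> a + b \<in> A" "\<And>r a. a \<in> A \<Longrightarrow> r * a \<in> A"
  shows "is_ideal A"
  using assms by (auto simp: is_ideal_iff)

context
  fixes A :: "'a::comm_ring_1 set"
  assumes A: "is_ideal A"
begin

lemma ideal_zero: "0 \<in> A" and ideal_add: "a \<in> A \<Longrightarrow> b \<in> A \<Longrightarrow> a + b \<in> A"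
  and ideal_mult: "a \<in> A \<Longrightarrow> r * a \<in> A"
  using A by (simp_all add: is_ideal_iff)

lemma ideal_mult_right: "a \<in> A \<Longrightarrow> a * r \<in> A"
  using ideal_mult[of a r] by (simp add: mult.commute)

lemma ideal_uminus: "a \<in> A \<Longrightarrow> - a \<in> A"
  using ideal_mult[of a "-1"] by simp

lemma ideal_diff: "a \<in> A \<Longrightarrow> b \<in> A \<Longrightarrow> a - b \<in> A"
  using ideal_add[of a "- b"] ideal_uminus by simp

lemma ideal_sum: "(\<And>x. x \<in> Y \<Longrightarrow> f x \<in> A) \<Longrightarrow> sum f Y \<in> A"
  by (induction Y rule: infinite_finite_induct) (auto intro: ideal_zero ideal_add)

lemma ideal_add_cancel: "b \<in> A \<Longrightarrow> a + b \<in> A \<longleftrightarrow> a \<in> A"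
  using ideal_add ideal_diff by (metis add_diff_cancel)

lemma ideal_power_le: "x ^ m \<in> A \<Longrightarrow> m \<le> n \<Longrightarrow> x ^ n \<in> A"
  by (metis ideal_mult le_add_diff_inverse2 power_add)

lemma ideal_eq_UNIV_iff: "A = UNIV \<longleftrightarrow> 1 \<in> A"
  using ideal_mult[of 1] by auto

end

lemma genideal_facts:
  fixes Y :: "'a::comm_ring_1 set"
  shows ideal_genideal: "is_ideal (Idl\<^bsub>ring_of_type_algebra\<^esub> Y)"
    and genideal_superset: "Y \<subseteq> Idl\<^bsub>ring_of_type_algebra\<^esub> Y"
    and genideal_least: "is_ideal A \<Longrightarrow> Y \<subseteq> A \<Longrightarrow> Idl\<^bsub>ring_of_type_algebra\<^esub> Y \<subseteq> A"
proof -
  interpret ring "ring_of_type_algebra :: 'a ring" by (rule ring_from_type_algebra)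
  show "is_ideal (Idl\<^bsub>ring_of_type_algebra\<^esub> Y)" by (rule genideal_ideal) auto
  show "Y \<subseteq> Idl\<^bsub>ring_of_type_algebra\<^esub> Y" by (rule genideal_self) auto
  show "is_ideal A \<Longrightarrow> Y \<subseteq> A \<Longrightarrow> Idl\<^bsub>ring_of_type_algebra\<^esub> Y \<subseteq> A" by (rule genideal_minimal)
qed

lemma is_prime_iff:
  fixes P :: "'a::comm_ring_1 set"
  shows "is_prime P \<longleftrightarrow> is_ideal P \<and> 1 \<notin> P \<and> (\<forall>a b. a * b \<in> P \<longrightarrow> a \<in> P \<or> b \<in> P)"
proof
  assume "is_prime P"
  then interpret primeideal P "ring_of_type_algebra :: 'a ring" .
  show "is_ideal P \<and> 1 \<notin> P \<and> (\<forall>a b. a * b \<in> P \<longrightarrow> a \<in> P \<or> b \<in> P)"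
    using is_ideal I_notcarr I_prime ideal_eq_UNIV_iff[OF is_ideal] by auto
next
  assume "is_ideal P \<and> 1 \<notin> P \<and> (\<forall>a b. a * b \<in> P \<longrightarrow> a \<in> P \<or> b \<in> P)"
  then show "is_prime P"
    by (intro primeidealI cring_from_type_algebra) auto
qed

context
  fixes P :: "'a::comm_ring_1 set"
  assumes P: "is_prime P"
begin

lemma prime_ideal: "is_ideal P" and prime_one: "1 \<notin> P"
  and prime_mult: "a * b \<in> P \<Longrightarrow> a \<in> P \<or> b \<in> P"
  using P by (auto simp: is_prime_iff)

lemma prime_mult_iff: "a * b \<in> P \<longleftrightarrow> a \<in> P \<or> b \<in> P"
  using prime_mult ideal_mult[OF prime_ideal] ideal_mult_right[OF prime_ideal] by blast

lemma prime_power: "a ^ n \<in> P \<Longrightarrow> a \<in> P"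
  by (induction n) (auto simp: prime_one dest: prime_mult)

lemma prime_prod_iff: "finite Y \<Longrightarrow> prod f Y \<in> P \<longleftrightarrow> (\<exists>x\<in>Y. f x \<in> P)"
  by (induction Y rule: finite_induct) (auto simp: prime_one prime_mult_iff)

text \<open>If every member had an element outside \<open>P\<close>, the product of these elements
  would lie in the intersection but not in \<open>P\<close>.\<close>

lemma prime_contains_of_Inter:
  assumes "finite \<A>" "\<And>A. A \<in> \<A> \<Longrightarrow> is_ideal A" "\<Inter>\<A> \<subseteq> P"
  shows "\<exists>A\<in>\<A>. A \<subseteq> P"
proof (rule ccontr)
  assume "\<not> ?thesis"
  then have "\<forall>A\<in>\<A>. \<exists>x. x \<in> A \<and> x \<notin> P" by blast
  then obtain x where x: "\<And>A. A \<in> \<A> \<Longrightarrow> x A \<in> A \<and> x A \<notin> P" by metis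
  have "prod x \<A> \<in> A" if "A \<in> \<A>" for A
    unfolding prod.remove[OF assms(1) that, of x]
    using ideal_mult_right[OF assms(2)[OF that]] x[OF that] by blast
  then have "prod x \<A> \<in> P" using assms(3) by blast
  then have "\<exists>A\<in>\<A>. x A \<in> P" unfolding prime_prod_iff[OF assms(1)] .
  then show False using x by blast
qed

end

section \<open>Ideal quotients, radicals, saturations and primary ideals\<close>

abbreviation quot :: "'a::comm_ring_1 set \<Rightarrow> 'a \<Rightarrow> 'a set" where
  "quot \<equiv> ideal_quotient ring_of_type_algebra"

abbreviation rad :: "'a::comm_ring_1 set \<Rightarrow> 'a set" where
  "rad \<equiv> radical ring_of_type_algebra"

lemma quot_iff: "f \<in> quot A h \<longleftrightarrow> f * h \<in> A"
  and rad_iff: "f \<in> rad A \<longleftrightarrow> (\<exists>n. f ^ n \<in> A)"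
  and saturation_iff: "f \<in> saturation ring_of_type_algebra A h \<longleftrightarrow> (\<exists>k\<ge>1. f * h ^ k \<in> A)"
  by (auto simp: ideal_quotient_def radical_def saturation_def)

lemma ideal_quot: "is_ideal A \<Longrightarrow> is_ideal (quot A f)"
  by (auto simp: is_ideal_iff quot_iff algebra_simps)

lemma ideal_saturation:
  assumes "is_ideal A" shows "is_ideal (saturation ring_of_type_algebra A h)"
proof (rule is_idealI)
  fix a b
  assume "a \<in> saturation ring_of_type_algebra A h" "b \<in> saturation ring_of_type_algebra A h"
  then obtain k l where "k \<ge> 1" "l \<ge> 1" "a * h ^ k \<in> A" "b * h ^ l \<in> A"
    by (auto simp: saturation_iff)
  then have "(a * h ^ k) * h ^ l + (b * h ^ l) * h ^ k \<in> A"
    using assms by (blast intro: ideal_add ideal_mult_right)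
  then have "(a + b) * h ^ (k + l) \<in> A" by (simp add: algebra_simps power_add)
  then show "a + b \<in> saturation ring_of_type_algebra A h"
    using \<open>k \<ge> 1\<close> by (auto simp: saturation_iff intro!: exI[of _ "k + l"])
qed (use assms in \<open>auto simp: saturation_iff is_ideal_iff mult.assoc\<close>)

lemma subset_saturation:
  assumes "is_ideal A" shows "A \<subseteq> saturation ring_of_type_algebra A h"
  using ideal_mult_right[OF assms] by (auto simp: saturation_iff intro!: exI[of _ 1])

lemma subset_rad: "A \<subseteq> rad A"
  by (auto simp: rad_iff intro!: exI[of _ 1])

lemma rad_subset_prime: "is_prime P \<Longrightarrow> A \<subseteq> P \<Longrightarrow> rad A \<subseteq> P"
  using prime_power by (fastforce simp: rad_iff)

lemma ideal_plus_principal: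
  assumes "is_ideal A"
  shows "Idl\<^bsub>ring_of_type_algebra\<^esub> (A \<union> {y}) = {a + r * y | a r. a \<in> A}" (is "?L = ?R")
proof
  have "is_ideal ?R"
  proof (rule is_idealI)
    show "0 \<in> ?R" using ideal_zero[OF assms] by (intro CollectI exI[of _ 0]) auto
  next
    fix u v assume "u \<in> ?R" "v \<in> ?R"
    then obtain a r b s where "u = a + r * y" "a \<in> A" "v = b + s * y" "b \<in> A" by blast
    then show "u + v \<in> ?R"
      by (intro CollectI exI[of _ "a + b"] exI[of _ "r + s"])
         (auto simp: algebra_simps ideal_add[OF assms])
  next
    fix t u assume "u \<in> ?R"
    then obtain a r where "u = a + r * y" "a \<in> A" by blast
    then show "t * u \<in> ?R"
      by (intro CollectI exI[of _ "t * a"] exI[of _ "t * r"])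
         (simp add: distrib_left mult.assoc ideal_mult[OF assms])
  qed
  moreover have "A \<union> {y} \<subseteq> ?R"
  proof -
    have "\<exists>a' r. x = a' + r * y \<and> a' \<in> A" if "x \<in> A" for x
      using that by (intro exI[of _ x] exI[of _ 0]) auto
    moreover have "\<exists>a' r. y = a' + r * y \<and> a' \<in> A"
      using ideal_zero[OF assms] by (intro exI[of _ 0] exI[of _ 1]) auto
    ultimately show ?thesis by auto
  qed
  ultimately show "?L \<subseteq> ?R" by (rule genideal_least)
next
  have L: "is_ideal ?L" "A \<union> {y} \<subseteq> ?L" by (rule ideal_genideal, rule genideal_superset)
  then show "?R \<subseteq> ?L" using ideal_add[OF L(1)] ideal_mult[OF L(1)] by blast
qed

lemma primary_ideal_iff:
  fixes Q :: "'a::comm_ring_1 set"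
  shows "primary_ideal ring_of_type_algebra Q \<longleftrightarrow> is_ideal Q \<and> 1 \<notin> Q \<and>
    (\<forall>a b. a * b \<in> Q \<longrightarrow> a \<in> Q \<or> b \<in> rad Q)"
  using ideal_eq_UNIV_iff by (auto simp: primary_ideal_def)

lemma ideal_rad:
  assumes "is_ideal A" shows "is_ideal (rad A)"
proof (rule is_idealI)
  fix a b assume "a \<in> rad A" "b \<in> rad A"
  then obtain m n where mn: "a ^ m \<in> A" "b ^ n \<in> A" by (auto simp: rad_iff)
  have "(a + b) ^ (m + n) \<in> A"
    unfolding binomial_ring
  proof (rule ideal_sum[OF assms])
    fix k assume "k \<in> {..m + n}"
    then have "m \<le> k \<or> n \<le> m + n - k" by auto
    then have "a ^ k \<in> A \<or> b ^ (m + n - k) \<in> A"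
      using ideal_power_le[OF assms] mn by blast
    then show "of_nat (m + n choose k) * a ^ k * b ^ (m + n - k) \<in> A"
      using ideal_mult[OF assms] ideal_mult_right[OF assms] by (metis mult.assoc)
  qed
  then show "a + b \<in> rad A" by (auto simp: rad_iff)
next
  show "0 \<in> rad A" using ideal_zero[OF assms] by (auto simp: rad_iff intro!: exI[of _ 1])
next
  fix r a assume "a \<in> rad A"
  then show "r * a \<in> rad A" by (auto simp: rad_iff power_mult_distrib intro: ideal_mult[OF assms])
qed

lemma prime_rad_primary:
  assumes "primary_ideal ring_of_type_algebra Q" shows "is_prime (rad Q)"
  unfolding is_prime_iff
proof (intro conjI allI impI)
  have Q: "is_ideal Q" "1 \<notin> Q" "\<And>a b. a * b \<in> Q \<Longrightarrow> a \<in> Q \<or> b \<in> rad Q"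
    using assms by (auto simp: primary_ideal_iff)
  show "is_ideal (rad Q)" by (rule ideal_rad[OF Q(1)])
  show "1 \<notin> rad Q" using Q(2) by (auto simp: rad_iff)
  fix a b assume "a * b \<in> rad Q"
  then obtain n where n: "a ^ n * b ^ n \<in> Q" by (auto simp: rad_iff power_mult_distrib)
  then consider "a ^ n \<in> Q" | "b ^ n \<in> rad Q" using Q(3) by blast
  then show "a \<in> rad Q \<or> b \<in> rad Q"
    by cases (auto simp: rad_iff simp flip: power_mult)
qed

text \<open>Phrased as well-foundedness of reverse strict inclusion, so that
  \<open>wf_eq_minimal\<close> yields maximal ideals and
  \<open>wf_iff_no_infinite_down_chain\<close> an ascending sequence to refute.\<close>

definition noetherian :: "'a::comm_ring_1 itself \<Rightarrow> bool" where
  "noetherian _ \<longleftrightarrow> wf {(B, A). is_ideal (A::'a set) \<and> is_ideal B \<and> A \<subset> B}"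

section \<open>Consequences of the ascending chain condition\<close>

context
  assumes noeth: "noetherian TYPE('a::comm_ring_1)"
begin

lemma noetherian_maximal:
  fixes \<A> :: "'a set set"
  assumes "\<A> \<noteq> {}" "\<And>A. A \<in> \<A> \<Longrightarrow> is_ideal A"
  shows "\<exists>A\<in>\<A>. \<forall>B\<in>\<A>. A \<subseteq> B \<longrightarrow> B = A"
proof -
  obtain Y where "Y \<in> \<A>" using assms(1) by blast
  then have "\<exists>A\<in>\<A>. \<forall>B. (B, A) \<in> {(B, A). is_ideal A \<and> is_ideal B \<and> A \<subset> B} \<longrightarrow> B \<notin> \<A>"
    using noeth unfolding noetherian_def wf_eq_minimal by blast
  then obtain A where "A \<in> \<A>" and
    "\<forall>B. (B, A) \<in> {(B, A). is_ideal A \<and> is_ideal B \<and> A \<subset> B} \<longrightarrow> B \<notin> \<A>" ..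
  then show ?thesis using assms(2) by blast
qed

text \<open>An ideal \<open>P\<close> maximal among those that contain \<open>A\<close> and miss
  \<open>M\<close> is prime: if two factors are outside \<open>P\<close>, both enlarged ideals meet
  \<open>M\<close>, and the product of the two meeting elements would lie in \<open>M\<close> and in
  \<open>P\<close>.\<close>

lemma prime_avoiding:
  fixes A :: "'a set"
  assumes A: "is_ideal A" and M: "1 \<in> M" "\<And>a b. a \<in> M \<Longrightarrow> b \<in> M \<Longrightarrow> a * b \<in> M" "A \<inter> M = {}"
  obtains P where "is_prime P" "A \<subseteq> P" "P \<inter> M = {}"
proof -
  define \<A> where "\<A> = {B. is_ideal B \<and> A \<subseteq> B \<and> B \<inter> M = {}}"
  have "\<A> \<noteq> {}" "\<And>B. B \<in> \<A> \<Longrightarrow> is_ideal B" using A M by (auto simp: \<A>_def)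
  then have "\<exists>A\<in>\<A>. \<forall>B\<in>\<A>. A \<subseteq> B \<longrightarrow> B = A" by (rule noetherian_maximal)
  then obtain P where P: "P \<in> \<A>" and mx: "\<And>B. B \<in> \<A> \<Longrightarrow> P \<subseteq> B \<Longrightarrow> B = P"
    by blast
  have iP: "is_ideal P" using P by (auto simp: \<A>_def)
  have key: "\<exists>p r. p \<in> P \<and> p + r * a \<in> M" if "a \<notin> P" for a
  proof (rule ccontr)
    let ?B = "Idl\<^bsub>ring_of_type_algebra\<^esub> (P \<union> {a})"
    assume "\<not> ?thesis"
    then have "?B \<inter> M = {}" unfolding ideal_plus_principal[OF iP] by auto
    moreover have "P \<union> {a} \<subseteq> ?B" by (rule genideal_superset)
    ultimately have "?B \<in> \<A>" using ideal_genideal P by (auto simp: \<A>_def)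
    then have "?B = P" using mx \<open>P \<union> {a} \<subseteq> ?B\<close> by auto
    then show False using that \<open>P \<union> {a} \<subseteq> ?B\<close> by auto
  qed
  have "a \<in> P \<or> b \<in> P" if ab: "a * b \<in> P" for a b
  proof (rule ccontr)
    assume "\<not> ?thesis"
    then obtain p r q s where "p \<in> P" "p + r * a \<in> M" "q \<in> P" "q + s * b \<in> M"
      using key by metis
    then have "(p + r * a) * (q + s * b) \<in> M" using M(2) by blast
    moreover have "(p + r * a) * (q + s * b) = p * (q + s * b) + (r * a) * q + (r * s) * (a * b)"
      by (simp add: algebra_simps)
    moreover have "p * (q + s * b) + (r * a) * q + (r * s) * (a * b) \<in> P"
      using \<open>p \<in> P\<close> \<open>q \<in> P\<close> ab
      using ideal_add[OF iP] ideal_mult[OF iP] ideal_mult_right[OF iP] by simp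
    ultimately show False using P by (auto simp: \<A>_def)
  qed
  then have "is_prime P" using P M(1) by (auto simp: is_prime_iff \<A>_def)
  then show ?thesis using that P by (auto simp: \<A>_def)
qed

text \<open>Otherwise \<open>prime_avoiding\<close>, applied to the powers of \<open>f\<close>,
  gives a prime over \<open>A\<close> without \<open>f\<close>.\<close>

lemma mem_rad_if_all_primes:
  fixes A :: "'a set"
  assumes A: "is_ideal A" and "\<And>P. is_prime P \<Longrightarrow> A \<subseteq> P \<Longrightarrow> f \<in> P"
  shows "f \<in> rad A"
proof (rule ccontr)
  assume "f \<notin> rad A"
  then have "A \<inter> Set.range (\<lambda>n. f ^ n) = {}" by (auto simp: rad_iff)
  moreover have "1 \<in> Set.range (\<lambda>n. f ^ n)" by (auto simp: image_iff intro: exI[of _ "0::nat"])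
  moreover have "a * b \<in> Set.range (\<lambda>n. f ^ n)"
    if "a \<in> Set.range (\<lambda>n. f ^ n)" "b \<in> Set.range (\<lambda>n. f ^ n)" for a b
    using that by (auto simp flip: power_add)
  ultimately obtain P where P: "is_prime P" "A \<subseteq> P" "P \<inter> Set.range (\<lambda>n. f ^ n) = {}"
    using prime_avoiding[OF A, of "Set.range (\<lambda>n. f ^ n)"] by blast
  have "f \<in> Set.range (\<lambda>n. f ^ n)" by (auto simp: image_iff intro: exI[of _ "1::nat"])
  then show False using assms(2)[of P] P by auto
qed

text \<open>A maximal proper annihilator is prime. Only multiples of a given \<open>f\<close>
  compete, because the choice of \<open>f\<close> shapes the prime: in \<open>unmixed_iff\<close> an
  \<open>f\<close> in \<open>J\<close> but not in \<open>I\<close> forces \<open>h\<close> into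
  it.\<close>

lemma associated_prime_exists:
  fixes A :: "'a set"
  assumes A: "is_ideal A" and f: "f \<notin> A"
  obtains r where "is_prime (quot A (r * f))"
proof -
  define \<A> where "\<A> = {quot A (r * f) | r. r * f \<notin> A}"
  have "\<A> \<noteq> {}" using f by (auto simp: \<A>_def intro!: exI[of _ 1])
  moreover have "\<And>B. B \<in> \<A> \<Longrightarrow> is_ideal B" using ideal_quot[OF A] by (auto simp: \<A>_def)
  ultimately have "\<exists>A\<in>\<A>. \<forall>B\<in>\<A>. A \<subseteq> B \<longrightarrow> B = A" by (rule noetherian_maximal)
  then obtain N where N: "N \<in> \<A>" and mx: "\<And>B. B \<in> \<A> \<Longrightarrow> N \<subseteq> B \<Longrightarrow> B = N"
    by blast
  from N obtain r where r: "N = quot A (r * f)" "r * f \<notin> A" by (auto simp: \<A>_def)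
  have "is_prime (quot A (r * f))"
    unfolding is_prime_iff
  proof (intro conjI allI impI)
    show "is_ideal (quot A (r * f))" by (rule ideal_quot[OF A])
    show "1 \<notin> quot A (r * f)" using r by (auto simp: quot_iff)
    fix a b assume ab: "a * b \<in> quot A (r * f)"
    show "a \<in> quot A (r * f) \<or> b \<in> quot A (r * f)"
    proof (cases "b \<in> quot A (r * f)")
      case False
      then have "quot A ((b * r) * f) \<in> \<A>"
        by (auto simp: \<A>_def quot_iff mult.assoc intro!: exI[of _ "b * r"])
      moreover have "N \<subseteq> quot A ((b * r) * f)"
        using ideal_mult[OF A] by (fastforce simp: r quot_iff algebra_simps)
      ultimately have "quot A ((b * r) * f) = N" by (rule mx)
      then have "a \<in> N" using ab by (auto simp: quot_iff algebra_simps)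
      then show ?thesis by (simp add: r)
    qed simp
  qed
  then show ?thesis by (rule that)
qed

text \<open>The quotients by powers of \<open>h\<close> increase, so a maximal one absorbs the
  others. Only positive exponents compete because part (d) asks for one.\<close>

lemma saturation_eq_quot:
  fixes A :: "'a set"
  assumes A: "is_ideal A"
  obtains a where "a > 0" "saturation ring_of_type_algebra A h = quot A (h ^ a)"
proof -
  define \<A> where "\<A> = {quot A (h ^ a) | a. a > 0}"
  have "\<A> \<noteq> {}" "\<And>B. B \<in> \<A> \<Longrightarrow> is_ideal B" using ideal_quot[OF A] by (auto simp: \<A>_def)
  then have "\<exists>A\<in>\<A>. \<forall>B\<in>\<A>. A \<subseteq> B \<longrightarrow> B = A" by (rule noetherian_maximal)
  then obtain N where N: "N \<in> \<A>" and mx: "\<And>B. B \<in> \<A> \<Longrightarrow> N \<subseteq> B \<Longrightarrow> B = N"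
    by blast
  from N obtain a where a: "N = quot A (h ^ a)" "a > 0" by (auto simp: \<A>_def)
  have mono: "quot A (h ^ k) \<subseteq> quot A (h ^ l)" if "k \<le> l" for k l
  proof
    fix f assume "f \<in> quot A (h ^ k)"
    then have "f * h ^ k * h ^ (l - k) \<in> A" by (auto simp: quot_iff intro: ideal_mult_right[OF A])
    then show "f \<in> quot A (h ^ l)" using that by (simp add: quot_iff mult.assoc flip: power_add)
  qed
  have "quot A (h ^ k) \<subseteq> N" if "k > 0" for k
  proof -
    have "quot A (h ^ (k + a)) = N"
      using mx[of "quot A (h ^ (k + a))"] mono[of a "k + a"] that by (auto simp: \<A>_def a)
    then show ?thesis using mono[of k "k + a"] by auto
  qed
  then have "saturation ring_of_type_algebra A h = quot A (h ^ a)"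
    using a unfolding saturation_def
    by (intro subset_antisym UN_least) (auto intro!: bexI[of _ a])
  then show ?thesis using that a by blast
qed

end

section \<open>Ideals with one-dimensional primary components and one embedded component\<close>

abbreviation primary_decomposition :: "'a::comm_ring_1 set \<Rightarrow> 'a set set \<Rightarrow> bool" where
  "primary_decomposition \<equiv> minimal_primary_decomposition ring_of_type_algebra"

text \<open>The contraction of the ideal generated by \<open>I\<close> in the localization at
  \<open>P\<close>, expressed by one denominator \<open>g\<close>.\<close>

definition localization_contraction :: "'a::comm_ring_1 set \<Rightarrow> 'a set \<Rightarrow> 'a set" where
  "localization_contraction I P = {f. \<exists>g. g \<notin> P \<and> f * g \<in> I}"

text \<open>The ring-theoretic core of (a), (b) and (d), freed from polynomials: \<open>h\<close>
  stands for the product of the variables, \<open>\<P>\<close> for the primes \<open>N*\<close> and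
  \<open>n\<close> for s - 1. Height enters only as a label that tells \<open>\<P>\<close> from the
  other primes over \<open>I\<close>.\<close>

locale saturated_curve =
  fixes I \<mm> :: "'a::comm_ring_1 set" and h :: 'a and \<P> :: "'a set set" and n :: enat
  assumes noeth: "noetherian TYPE('a)"
    and ideal_I: "is_ideal I"
    and prime_mm: "is_prime \<mm>"
    and maximal_mm: "is_ideal A \<Longrightarrow> \<mm> \<subseteq> A \<Longrightarrow> A = \<mm> \<or> 1 \<in> A"
    and h_mm: "h \<in> \<mm>"
    and finite_P: "finite \<P>" and nonempty_P: "\<P> \<noteq> {}"
    and prime_P: "P \<in> \<P> \<Longrightarrow> is_prime P" and I_subset: "P \<in> \<P> \<Longrightarrow> I \<subseteq> P"
    and h_notin: "P \<in> \<P> \<Longrightarrow> h \<notin> P" and P_subset_mm: "P \<in> \<P> \<Longrightarrow> P \<subseteq> \<mm>"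
    and incomparable: "P \<in> \<P> \<Longrightarrow> P' \<in> \<P> \<Longrightarrow> P \<subseteq> P' \<Longrightarrow> P = P'"
    and prime_with_h: "is_prime N \<Longrightarrow> I \<subseteq> N \<Longrightarrow> h \<in> N \<Longrightarrow> N = \<mm>"
    and prime_without_h: "is_prime N \<Longrightarrow> I \<subseteq> N \<Longrightarrow> h \<notin> N \<Longrightarrow> \<exists>P\<in>\<P>. P \<subseteq> N"
    and associated_without_h: "is_prime (quot I f) \<Longrightarrow> h \<notin> quot I f \<Longrightarrow> quot I f \<in> \<P>"
    and height_P: "is_prime P \<Longrightarrow> I \<subseteq> P \<Longrightarrow> prime_height ring_of_type_algebra P = n \<longleftrightarrow> P \<in> \<P>"
begin

definition J :: "'a set" where "J = saturation ring_of_type_algebra I h"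

abbreviation loc :: "'a set \<Rightarrow> 'a set" where "loc \<equiv> localization_contraction I"

lemma loc_iff: "f \<in> loc P \<longleftrightarrow> (\<exists>g. g \<notin> P \<and> f * g \<in> I)"
  by (simp add: localization_contraction_def)

lemma I_subset_loc: "P \<in> \<P> \<Longrightarrow> I \<subseteq> loc P"
  using prime_one[OF prime_P] by (auto simp: loc_iff intro!: exI[of _ 1])

lemma loc_subset: "P \<in> \<P> \<Longrightarrow> loc P \<subseteq> P"
  using I_subset prime_mult[OF prime_P] by (fastforce simp: loc_iff)

lemma loc_cancel:
  assumes "P \<in> \<P>" "f * g \<in> loc P" "g \<notin> P" shows "f \<in> loc P"
proof -
  obtain g' where "g' \<notin> P" "f * g * g' \<in> I" using assms by (auto simp: loc_iff)
  then show ?thesis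
    using prime_mult[OF prime_P[OF assms(1)], of g g'] assms(3)
    by (auto simp: loc_iff mult.assoc intro!: exI[of _ "g * g'"])
qed

lemma ideal_loc:
  assumes P: "P \<in> \<P>" shows "is_ideal (loc P)"
proof (rule is_idealI)
  show "0 \<in> loc P" using I_subset_loc[OF P] ideal_zero[OF ideal_I] by auto
  fix r a assume "a \<in> loc P"
  then show "r * a \<in> loc P" using ideal_mult[OF ideal_I] by (auto simp: loc_iff mult.assoc)
next
  fix a b assume "a \<in> loc P" "b \<in> loc P"
  then obtain g g' where g: "g \<notin> P" "a * g \<in> I" "g' \<notin> P" "b * g' \<in> I" by (auto simp: loc_iff)
  have "(a * g) * g' + (b * g') * g \<in> I"
    using g ideal_add[OF ideal_I] ideal_mult_right[OF ideal_I] by blast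
  moreover have "g * g' \<notin> P" using g prime_mult[OF prime_P[OF P]] by auto
  ultimately show "a + b \<in> loc P"
    by (auto simp: loc_iff algebra_simps intro!: exI[of _ "g * g'"])
qed

lemma minimal_P:
  assumes "P \<in> \<P>" "is_prime N" "I \<subseteq> N" "N \<subseteq> P" shows "N = P"
proof -
  obtain P' where "P' \<in> \<P>" "P' \<subseteq> N"
    using prime_without_h[of N] assms h_notin[of P] by blast
  then show ?thesis using incomparable[of P' P] assms by auto
qed

lemma mm_notin: "\<mm> \<notin> \<P>"
  using h_notin h_mm by auto

text \<open>If \<open>h\<close> were in \<open>P\<close>, then \<open>P\<close> would be
  \<open>\<mm>\<close>, which strictly contains the members of \<open>\<P>\<close>.\<close>

lemma minimal_prime_mem:
  assumes "is_prime P" "I \<subseteq> P" "\<And>N. is_prime N \<Longrightarrow> I \<subseteq> N \<Longrightarrow> N \<subseteq> P \<Longrightarrow> N = P"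
  shows "P \<in> \<P>"
proof (cases "h \<in> P")
  case True
  then have "P = \<mm>" using assms prime_with_h by auto
  moreover obtain P' where "P' \<in> \<P>" using nonempty_P by auto
  ultimately have "P' = \<mm>" using assms(3)[of P'] prime_P I_subset P_subset_mm by auto
  then show ?thesis using mm_notin \<open>P' \<in> \<P>\<close> by auto
next
  case False
  then obtain P' where "P' \<in> \<P>" "P' \<subseteq> P" using assms prime_without_h by blast
  then show ?thesis using assms(3)[of P'] prime_P I_subset by auto
qed

text \<open>If no power of some \<open>f\<close> in \<open>P\<close> were in \<open>loc P\<close>,
  the multiplicative set generated by \<open>f\<close> and the complement of \<open>P\<close> would
  miss \<open>I\<close>. A prime over \<open>I\<close> missing this set would be strictly smaller
  than \<open>P\<close>, against minimality.\<close>

lemma rad_loc: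
  assumes P: "P \<in> \<P>" shows "rad (loc P) = P"
proof
  show "rad (loc P) \<subseteq> P" by (rule rad_subset_prime[OF prime_P[OF P] loc_subset[OF P]])
  show "P \<subseteq> rad (loc P)"
  proof
    fix f assume f: "f \<in> P"
    show "f \<in> rad (loc P)"
    proof (rule ccontr)
      assume nf: "f \<notin> rad (loc P)"
      define M where "M = {f ^ k * g | k g. g \<notin> P}"
      have "1 \<in> M" using prime_one[OF prime_P[OF P]]
        unfolding M_def by (intro CollectI exI[of _ "0::nat"] exI[of _ "1::'a"]) auto
      moreover have "a * b \<in> M" if ab: "a \<in> M" "b \<in> M" for a b
      proof -
        obtain k g l g' where "a = f ^ k * g" "g \<notin> P" "b = f ^ l * g'" "g' \<notin> P"
          using ab by (auto simp: M_def)
        then show ?thesis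
          using prime_mult[OF prime_P[OF P], of g g']
          by (auto simp: M_def power_add algebra_simps intro!: exI[of _ "k + l"] exI[of _ "g * g'"])
      qed
      moreover have "I \<inter> M = {}" using nf by (auto simp: M_def rad_iff loc_iff)
      ultimately obtain N where N: "is_prime N" "I \<subseteq> N" "N \<inter> M = {}"
        using prime_avoiding[OF noeth ideal_I, of M] by blast
      have "g \<in> M" if "g \<notin> P" for g
        using that by (auto simp: M_def intro!: exI[of _ 0] exI[of _ g])
      then have "N \<subseteq> P" using N by auto
      then have "N = P" by (rule minimal_P[OF P N(1,2)])
      moreover have "f \<in> M" using prime_one[OF prime_P[OF P]]
        unfolding M_def by (intro CollectI exI[of _ "1::nat"] exI[of _ "1::'a"]) auto
      ultimately show False using N f by auto
    qed
  qed
qed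

lemma primary_loc:
  assumes P: "P \<in> \<P>" shows "primary_ideal ring_of_type_algebra (loc P)"
  unfolding primary_ideal_iff rad_loc[OF P]
  using ideal_loc[OF P] loc_subset[OF P] prime_one[OF prime_P[OF P]] loc_cancel[OF P] by blast

lemma J_iff: "f \<in> J \<longleftrightarrow> (\<exists>k. f * h ^ k \<in> I)"
proof
  assume "\<exists>k. f * h ^ k \<in> I"
  then obtain k where "f * h ^ k \<in> I" ..
  then have "f * h ^ k * h \<in> I" by (rule ideal_mult_right[OF ideal_I])
  then show "f \<in> J"
    by (auto simp: J_def saturation_iff algebra_simps intro!: exI[of _ "Suc k"])
qed (auto simp: J_def saturation_iff)

lemma ideal_J: "is_ideal J" and I_subset_J: "I \<subseteq> J"
  unfolding J_def by (rule ideal_saturation[OF ideal_I], rule subset_saturation[OF ideal_I])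

lemma J_subset_loc:
  assumes P: "P \<in> \<P>" shows "J \<subseteq> loc P"
proof
  fix f assume "f \<in> J"
  then obtain k where "f * h ^ k \<in> I" by (auto simp: J_iff)
  moreover have "h ^ k \<notin> P" using h_notin[OF P] prime_power[OF prime_P[OF P]] by blast
  ultimately show "f \<in> loc P" by (auto simp: loc_iff)
qed

lemma J_subset: "P \<in> \<P> \<Longrightarrow> J \<subseteq> P"
  using J_subset_loc loc_subset by blast

text \<open>\<open>J\<close> is a quotient of \<open>I\<close> by a power of \<open>h\<close>, so
  its associated primes are associated to \<open>I\<close>; they miss \<open>h\<close> because
  \<open>h\<close> can be cancelled modulo \<open>J\<close>.\<close>

lemma associated_prime_of_J:
  assumes f: "f \<notin> J"
  obtains r g where "quot J (r * f) = quot I g" "quot I g \<in> \<P>"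
proof -
  obtain a where a: "a > 0" "J = quot I (h ^ a)"
    unfolding J_def by (rule saturation_eq_quot[OF noeth ideal_I])
  obtain r where r: "is_prime (quot J (r * f))"
    by (rule associated_prime_exists[OF noeth ideal_J f])
  have eq: "quot J (r * f) = quot I (r * f * h ^ a)"
    by (auto simp: a quot_iff mult.assoc)
  have "h \<notin> quot J (r * f)"
  proof
    assume "h \<in> quot J (r * f)"
    then obtain k where "h * (r * f) * h ^ k \<in> I" by (auto simp: quot_iff J_iff)
    then have "r * f * h ^ Suc k \<in> I" by (simp add: algebra_simps)
    then have "1 * (r * f) \<in> J" unfolding J_iff mult_1 by blast
    then show False using prime_one[OF r] by (auto simp: quot_iff)
  qed
  then have "quot I (r * f * h ^ a) \<in> \<P>" using associated_without_h r unfolding eq by blast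
  then show ?thesis using that eq by blast
qed

text \<open>For \<open>f\<close> outside \<open>J\<close>, some multiple of \<open>f\<close> has as
  annihilator modulo \<open>J\<close> a member P of \<open>\<P>\<close>; but if \<open>f\<close> is
  in \<open>loc P\<close>, it is also annihilated by an element outside P.\<close>

lemma J_eq_Inter: "J = \<Inter>(loc ` \<P>)"
proof
  show "J \<subseteq> \<Inter>(loc ` \<P>)" using J_subset_loc by blast
  show "\<Inter>(loc ` \<P>) \<subseteq> J"
  proof (rule subsetI, rule ccontr)
    fix f assume f: "f \<in> \<Inter>(loc ` \<P>)" "f \<notin> J"
    obtain r g where N: "quot J (r * f) = quot I g" "quot I g \<in> \<P>"
      by (rule associated_prime_of_J[OF f(2)])
    then obtain g' where g': "g' \<notin> quot J (r * f)" "f * g' \<in> I"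
      using f(1) by (auto simp: loc_iff)
    then have "r * (f * g') \<in> J" using ideal_mult[OF ideal_I] I_subset_J by blast
    then show False using g' by (auto simp: quot_iff algebra_simps)
  qed
qed

section \<open>Minimal primary decompositions and their uniqueness\<close>

lemma primary_decomposition_iff:
  "primary_decomposition I \<D> \<longleftrightarrow>
     finite \<D> \<and> (\<forall>Q\<in>\<D>. primary_ideal ring_of_type_algebra Q) \<and> I = \<Inter>\<D> \<and>
     inj_on rad \<D> \<and> (\<forall>Q\<in>\<D>. \<Inter>(\<D> - {Q}) \<noteq> I)"
  by (simp add: minimal_primary_decomposition_def)

text \<open>The classical uniqueness of isolated components. As \<open>rad q\<close> is minimal over
  \<open>I\<close>, it contains no other component; elements of the other components chosen outside
  \<open>rad q\<close> have a product \<open>g\<close> that carries \<open>q\<close> into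
  \<open>I\<close>.\<close>

lemma component_eq_loc:
  assumes D: "primary_decomposition I \<D>" and q: "q \<in> \<D>" and P: "rad q \<in> \<P>"
  shows "q = loc (rad q)"
proof
  have D': "finite \<D>" "\<And>Q. Q \<in> \<D> \<Longrightarrow> primary_ideal ring_of_type_algebra Q" "I = \<Inter>\<D>"
    "inj_on rad \<D>" using D by (auto simp: primary_decomposition_iff)
  show "loc (rad q) \<subseteq> q"
  proof
    fix f assume "f \<in> loc (rad q)"
    then obtain g where "g \<notin> rad q" "f * g \<in> I" unfolding loc_iff by blast
    then have "g \<notin> rad q" "f * g \<in> q" using D'(3) q by auto
    then show "f \<in> q" using D'(2)[OF q] by (auto simp: primary_ideal_iff)
  qed
  have "\<exists>x. x \<in> Q \<and> x \<notin> rad q" if Q: "Q \<in> \<D>" "Q \<noteq> q" for Q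
  proof (rule ccontr)
    assume "\<not> ?thesis"
    then have "rad Q \<subseteq> rad q" using rad_subset_prime[OF prime_P[OF P]] by auto
    moreover have "I \<subseteq> rad Q" using D'(3) Q subset_rad by blast
    ultimately have "rad Q = rad q"
      using minimal_P[OF P prime_rad_primary[OF D'(2)[OF Q(1)]]] by auto
    then show False using D'(4) Q q by (auto dest: inj_onD)
  qed
  then obtain x where x: "\<And>Q. Q \<in> \<D> \<Longrightarrow> Q \<noteq> q \<Longrightarrow> x Q \<in> Q \<and> x Q \<notin> rad q" by metis
  define g where "g = prod x (\<D> - {q})"
  have "g \<notin> rad q"
    unfolding g_def using prime_prod_iff[OF prime_P[OF P], of "\<D> - {q}" x] D'(1) x by auto
  moreover have "g \<in> Q" if Q: "Q \<in> \<D>" "Q \<noteq> q" for Q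
  proof -
    have "g = x Q * prod x (\<D> - {q} - {Q})"
      unfolding g_def using Q D'(1) by (intro prod.remove) auto
    then show ?thesis
      using x[OF Q] D'(2)[OF Q(1)] ideal_mult_right by (auto simp: primary_ideal_iff)
  qed
  ultimately show "q \<subseteq> loc (rad q)"
  proof -
    assume g: "g \<notin> rad q" "\<And>Q. Q \<in> \<D> \<Longrightarrow> Q \<noteq> q \<Longrightarrow> g \<in> Q"
    have "f * g \<in> Q" if "f \<in> q" "Q \<in> \<D>" for f Q
    proof -
      have Q: "is_ideal Q" using D'(2)[OF that(2)] by (simp add: primary_ideal_iff)
      show ?thesis
        using that g(2)[of Q] ideal_mult[OF Q, of g f] ideal_mult_right[OF Q, of f g] by auto
    qed
    then have "f * g \<in> I" if "f \<in> q" for f using D'(3) that by blast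
    then show ?thesis using g(1) unfolding localization_contraction_def by blast
  qed
qed

lemma component_exists:
  assumes D: "primary_decomposition I \<D>" and P: "P \<in> \<P>"
  shows "loc P \<in> \<D>" and "\<exists>q\<in>\<D>. rad q = P"
proof -
  have D': "finite \<D>" "\<And>Q. Q \<in> \<D> \<Longrightarrow> primary_ideal ring_of_type_algebra Q" "I = \<Inter>\<D>"
    using D by (auto simp: primary_decomposition_iff)
  obtain Q where Q: "Q \<in> \<D>" "Q \<subseteq> P"
    using prime_contains_of_Inter[OF prime_P[OF P] D'(1)] D' I_subset[OF P]
    by (auto simp: primary_ideal_iff)
  have "rad Q = P"
    using rad_subset_prime[OF prime_P[OF P] Q(2)] D'(3) Q subset_rad[of Q]
    by (intro minimal_P[OF P prime_rad_primary[OF D'(2)[OF Q(1)]]]) auto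
  then show "\<exists>q\<in>\<D>. rad q = P" using Q by auto
  show "loc P \<in> \<D>" using component_eq_loc[OF D Q(1)] \<open>rad Q = P\<close> P Q by auto
qed

lemma height_mm: "prime_height ring_of_type_algebra \<mm> \<noteq> n"
  using height_P[OF prime_mm] mm_notin I_subset P_subset_mm nonempty_P by blast

text \<open>An associated prime containing \<open>h\<close> exists exactly if some element outside
  \<open>I\<close> is killed by a power of \<open>h\<close>. That prime is \<open>\<mm>\<close>,
  whose height differs from that of the associated primes coming from \<open>J\<close>.\<close>

lemma unmixed_iff: "unmixed ring_of_type_algebra I \<longleftrightarrow> I = J"
proof
  assume IJ: "I = J"
  have "prime_height ring_of_type_algebra N = n" if N_ass: "N \<in> associated_primes ring_of_type_algebra I" for N
  proof -
    obtain f where N: "is_prime N" "N = quot I f"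
      using N_ass unfolding associated_primes_def by blast
    have "h \<notin> N"
    proof
      assume "h \<in> N"
      then have "f * h ^ 1 \<in> I" using N by (simp add: quot_iff mult.commute)
      then have "f \<in> I" using IJ J_iff by blast
      then show False using prime_one[OF N(1)] N(2) by (simp add: quot_iff)
    qed
    then have "N \<in> \<P>" using associated_without_h N by blast
    then show ?thesis using height_P[OF N(1)] I_subset by blast
  qed
  then show "unmixed ring_of_type_algebra I" by (simp add: unmixed_def)
next
  assume um: "unmixed ring_of_type_algebra I"
  show "I = J"
  proof (rule ccontr)
    assume "I \<noteq> J"
    then obtain f where f: "f \<in> J" "f \<notin> I" using I_subset_J by blast
    obtain r where r: "is_prime (quot I (r * f))"
      by (rule associated_prime_exists[OF noeth ideal_I f(2)])
    obtain k where "f * h ^ k \<in> I" using f(1) J_iff by blast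
    then have "r * (f * h ^ k) \<in> I" by (rule ideal_mult[OF ideal_I])
    then have "h ^ k \<in> quot I (r * f)" by (simp add: quot_iff algebra_simps)
    then have "h \<in> quot I (r * f)" by (rule prime_power[OF r])
    moreover have "I \<subseteq> quot I (r * f)"
      using ideal_mult_right[OF ideal_I] by (auto simp: quot_iff)
    ultimately have "quot I (r * f) = \<mm>" using prime_with_h r by blast
    then have m: "\<mm> \<in> associated_primes ring_of_type_algebra I"
      using prime_mm by (auto simp: associated_primes_def)
    obtain P where P: "P \<in> \<P>" using nonempty_P by blast
    then have "1 \<notin> J" using J_subset prime_one[OF prime_P] by blast
    then obtain g where g: "quot I g \<in> \<P>" by (rule associated_prime_of_J)
    then have "quot I g \<in> associated_primes ring_of_type_algebra I"
      using prime_P by (auto simp: associated_primes_def)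
    then have "prime_height ring_of_type_algebra (quot I g) = prime_height ring_of_type_algebra \<mm>"
      using um m unfolding unmixed_def by blast
    then show False using height_mm height_P[OF prime_P[OF g] I_subset[OF g]] g by simp
  qed
qed

text \<open>Has the shape of \<open>curve_decomposition\<close>, so that
  \<open>curve_decomposition_iff\<close> is a mere unfolding.\<close>

definition decomposes :: "'a set set \<Rightarrow> 'a set set \<Rightarrow> bool" where
  "decomposes \<Q> \<E> \<longleftrightarrow>
     primary_decomposition I (\<Q> \<union> \<E>) \<and>
     (\<forall>\<qq>\<in>\<Q>. prime_height ring_of_type_algebra (rad \<qq>) = n) \<and>
     (if unmixed ring_of_type_algebra I then \<E> = {}
      else (\<exists>\<qq>. \<E> = {\<qq>} \<and> primary_ideal ring_of_type_algebra \<qq> \<and> rad \<qq> = \<mm>))"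

text \<open>Heights force the radicals into \<open>\<P>\<close>, where
  \<open>component_eq_loc\<close> leaves no choice. Conversely every \<open>loc P\<close> has to
  occur, and not in \<open>\<E>\<close>, where the only possible radical is
  \<open>\<mm>\<close>.\<close>

lemma decomposes_unique:
  assumes "decomposes \<Q> \<E>" shows "\<Q> = loc ` \<P>"
proof
  have D: "primary_decomposition I (\<Q> \<union> \<E>)" using assms by (simp add: decomposes_def)
  show "\<Q> \<subseteq> loc ` \<P>"
  proof
    fix q assume q: "q \<in> \<Q>"
    have pq: "primary_ideal ring_of_type_algebra q" "I \<subseteq> rad q"
      using D q subset_rad[of q] by (auto simp: primary_decomposition_iff)
    have "rad q \<in> \<P>"
      using height_P[OF prime_rad_primary[OF pq(1)] pq(2)] assms q by (simp add: decomposes_def)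
    then show "q \<in> loc ` \<P>" using component_eq_loc[OF D] q by blast
  qed
  show "loc ` \<P> \<subseteq> \<Q>"
  proof
    fix q assume "q \<in> loc ` \<P>"
    then obtain P where P: "P \<in> \<P>" "q = loc P" by auto
    have "q \<in> \<Q> \<union> \<E>" using component_exists(1)[OF D] P by simp
    moreover have "q \<notin> \<E>"
      using assms rad_loc[OF P(1)] P mm_notin by (auto simp: decomposes_def split: if_splits)
    ultimately show "q \<in> \<Q>" by auto
  qed
qed

lemma inj_on_loc: "inj_on loc \<P>"
  using rad_loc by (metis inj_onI)

lemma inj_on_rad: "inj_on rad (loc ` \<P>)"
  using rad_loc by (auto intro!: inj_onI)

text \<open>A prime over this intersection contains one of its members, and a \<open>loc P'\<close>
  inside \<open>P\<close> gives \<open>P' \<subseteq> P\<close> by taking radicals. The slot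
  \<open>q\<close> is meant for the embedded component.\<close>

lemma not_redundant:
  assumes P: "P \<in> \<P>" and q: "is_ideal q" "\<not> q \<subseteq> P"
  shows "\<not> \<Inter>(loc ` \<P> - {loc P}) \<inter> q \<subseteq> P"
proof
  assume "\<Inter>(loc ` \<P> - {loc P}) \<inter> q \<subseteq> P"
  then have "\<Inter>(insert q (loc ` \<P> - {loc P})) \<subseteq> P" by auto
  then obtain A where A: "A \<in> insert q (loc ` \<P> - {loc P})" "A \<subseteq> P"
    using prime_contains_of_Inter[OF prime_P[OF P], of "insert q (loc ` \<P> - {loc P})"]
      finite_P q(1) ideal_loc by auto
  then obtain P' where P': "P' \<in> \<P>" "A = loc P'" "loc P' \<noteq> loc P" using q by auto
  then have "P' \<subseteq> P" using rad_subset_prime[OF prime_P[OF P] A(2)] rad_loc by auto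
  then show False using incomparable[of P' P] P P' by auto
qed

lemma decomposes_unmixed:
  assumes "I = J" shows "decomposes (loc ` \<P>) {}"
  unfolding decomposes_def primary_decomposition_iff
proof (intro conjI)
  show "I = \<Inter>(loc ` \<P> \<union> {})" using assms J_eq_Inter by simp
  show "\<forall>Q\<in>loc ` \<P> \<union> {}. \<Inter>(loc ` \<P> \<union> {} - {Q}) \<noteq> I"
  proof
    fix Q assume "Q \<in> loc ` \<P> \<union> {}"
    then obtain P where P: "P \<in> \<P>" "Q = loc P" by auto
    \<comment> \<open>The unit ideal fills the place of the absent embedded component.\<close>
    have "\<not> \<Inter>(loc ` \<P> - {loc P}) \<inter> UNIV \<subseteq> P"
      using prime_one[OF prime_P[OF P(1)]] by (intro not_redundant[OF P(1)]) (auto simp: is_ideal_iff)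
    then show "\<Inter>(loc ` \<P> \<union> {} - {Q}) \<noteq> I" using P I_subset[OF P(1)] by auto
  qed
qed (use finite_P primary_loc inj_on_rad rad_loc height_P prime_P I_subset assms unmixed_iff in auto)

text \<open>The only prime over \<open>I\<close> and \<open>h\<close> is \<open>\<mm>\<close>, and a
  radical is cut out by the primes above the ideal.\<close>

lemma rad_sum_h:
  assumes "a > 0" shows "rad (Idl\<^bsub>ring_of_type_algebra\<^esub> (I \<union> {h ^ a})) = \<mm>"
proof
  let ?q = "Idl\<^bsub>ring_of_type_algebra\<^esub> (I \<union> {h ^ a})"
  have Im: "I \<subseteq> \<mm>" using I_subset P_subset_mm nonempty_P by blast
  have "h ^ a \<in> \<mm>" using h_mm assms ideal_power_le[OF prime_ideal[OF prime_mm], of h 1 a] by simp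
  then have "?q \<subseteq> \<mm>" using Im by (intro genideal_least prime_ideal[OF prime_mm]) auto
  then show "rad ?q \<subseteq> \<mm>" by (rule rad_subset_prime[OF prime_mm])
  show "\<mm> \<subseteq> rad ?q"
  proof
    fix g assume g: "g \<in> \<mm>"
    show "g \<in> rad ?q"
    proof (rule mem_rad_if_all_primes[OF noeth ideal_genideal])
      fix N assume N: "is_prime N" "?q \<subseteq> N"
      then have "I \<subseteq> N" "h ^ a \<in> N" using genideal_superset[of "I \<union> {h ^ a}"] by auto
      then have "N = \<mm>" using prime_with_h N(1) prime_power by blast
      then show "g \<in> N" using g by simp
    qed
  qed
qed

text \<open>An ideal with maximal radical is primary, because every element outside
  \<open>\<mm>\<close> is a unit modulo it.\<close>

lemma primary_sum_h:
  assumes "a > 0"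
  shows "primary_ideal ring_of_type_algebra (Idl\<^bsub>ring_of_type_algebra\<^esub> (I \<union> {h ^ a}))"
proof -
  let ?q = "Idl\<^bsub>ring_of_type_algebra\<^esub> (I \<union> {h ^ a})"
  note r = rad_sum_h[OF assms]
  have q: "is_ideal ?q" by (rule ideal_genideal)
  have "x \<in> ?q" if xy: "x * y \<in> ?q" "y \<notin> \<mm>" for x y
  proof -
    have "Idl\<^bsub>ring_of_type_algebra\<^esub> (\<mm> \<union> {y}) \<noteq> \<mm>" "\<mm> \<subseteq> Idl\<^bsub>ring_of_type_algebra\<^esub> (\<mm> \<union> {y})"
      using genideal_superset[of "\<mm> \<union> {y}"] xy(2) by auto
    then have "1 \<in> Idl\<^bsub>ring_of_type_algebra\<^esub> (\<mm> \<union> {y})" using maximal_mm[OF ideal_genideal] by blast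
    then obtain u t where u: "u \<in> \<mm>" "1 = u + t * y"
      unfolding ideal_plus_principal[OF prime_ideal[OF prime_mm]] by blast
    from u(1) obtain k where k: "u ^ k \<in> ?q" unfolding r[symmetric] rad_iff by blast
    \<comment> \<open>The identity 1 = u + t y survives replacing \<open>u\<close> by its powers; at
      j = k the power of \<open>u\<close> falls into the ideal.\<close>
    have "\<exists>s. 1 = u ^ j + s * y" for j
    proof (induction j)
      case (Suc j)
      then obtain s where "1 = u ^ j + s * y" ..
      then have "u = u ^ Suc j + u * s * y" by (metis (no_types) distrib_left mult.assoc mult_1_right power_Suc)
      then have "1 = u ^ Suc j + (u * s + t) * y" using u(2) by (simp add: algebra_simps)
      then show ?case ..
    qed (auto intro: exI[of _ 0])
    then obtain s where "1 = u ^ k + s * y" by blast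
    then have "x = x * u ^ k + s * (x * y)" by (metis distrib_left mult.left_commute mult_1_right)
    then show ?thesis
      using ideal_add[OF q] ideal_mult[OF q k, of x] ideal_mult[OF q xy(1), of s] by metis
  qed
  moreover have "1 \<notin> ?q" using r prime_one[OF prime_mm] subset_rad by blast
  ultimately show ?thesis unfolding primary_ideal_iff r using q by blast
qed

lemma decomposes_mixed:
  assumes IJ: "I \<noteq> J" and a: "a > 0" "J = quot I (h ^ a)"
  defines "\<qq> \<equiv> Idl\<^bsub>ring_of_type_algebra\<^esub> (I \<union> {h ^ a})"
  shows "I = J \<inter> \<qq>" "decomposes (loc ` \<P>) {\<qq>}"
proof -
  show I: "I = J \<inter> \<qq>"
  proof
    show "I \<subseteq> J \<inter> \<qq>" using I_subset_J genideal_superset[of "I \<union> {h ^ a}"] by (auto simp: \<qq>_def)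
    show "J \<inter> \<qq> \<subseteq> I"
    proof
      fix x assume x: "x \<in> J \<inter> \<qq>"
      then obtain i r where i: "i \<in> I" "x = i + r * h ^ a"
        unfolding \<qq>_def ideal_plus_principal[OF ideal_I] by blast
      \<comment> \<open>For x = i + r h^a in \<open>J\<close> this puts r h^(2a) into
        \<open>I\<close>, so \<open>r\<close> is in \<open>J\<close>; as the exponent
        \<open>a\<close> already reaches the whole saturation, r h^a is in \<open>I\<close>.\<close>
      have "x * h ^ a \<in> I" using x a by (auto simp: quot_iff)
      moreover have "i * h ^ a \<in> I" using i ideal_mult_right[OF ideal_I] by auto
      ultimately have "x * h ^ a - i * h ^ a \<in> I" by (rule ideal_diff[OF ideal_I])
      then have "r * h ^ (a + a) \<in> I" using i(2) by (simp add: algebra_simps power_add)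
      then have "r \<in> J" unfolding J_iff by blast
      then have "r * h ^ a \<in> I" using a by (simp add: quot_iff)
      then show "x \<in> I" using i ideal_add[OF ideal_I] by auto
    qed
  qed
  have rq: "rad \<qq> = \<mm>" "primary_ideal ring_of_type_algebra \<qq>"
    unfolding \<qq>_def using rad_sum_h[OF a(1)] primary_sum_h[OF a(1)] by auto
  have q: "is_ideal \<qq>" unfolding \<qq>_def by (rule ideal_genideal)
  have qP: "\<not> \<qq> \<subseteq> P" if P: "P \<in> \<P>" for P
    using rad_subset_prime[OF prime_P[OF P], of \<qq>] rq(1) h_mm h_notin[OF P] by auto
  have q_notin: "\<qq> \<notin> loc ` \<P>" using rad_loc rq(1) mm_notin by auto
  show "decomposes (loc ` \<P>) {\<qq>}"
    unfolding decomposes_def primary_decomposition_iff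
  proof (intro conjI)
    show "I = \<Inter>(loc ` \<P> \<union> {\<qq>})" using I J_eq_Inter by auto
    have "\<Inter>(loc ` \<P> \<union> {\<qq>} - {Q}) \<noteq> I" if Q: "Q \<in> loc ` \<P> \<union> {\<qq>}" for Q
    proof (cases "Q = \<qq>")
      case True
      then have "loc ` \<P> \<union> {\<qq>} - {Q} = loc ` \<P>" using q_notin by auto
      then show ?thesis using IJ J_eq_Inter by simp
    next
      case False
      then obtain P where P: "P \<in> \<P>" "Q = loc P" using Q by auto
      then have "\<Inter>(loc ` \<P> \<union> {\<qq>} - {Q}) = \<Inter>(loc ` \<P> - {loc P}) \<inter> \<qq>"
        using False by auto
      then show ?thesis using not_redundant[OF P(1) q qP[OF P(1)]] I_subset[OF P(1)] by auto
    qed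
    then show "\<forall>Q\<in>loc ` \<P> \<union> {\<qq>}. \<Inter>(loc ` \<P> \<union> {\<qq>} - {Q}) \<noteq> I" by blast
    show "inj_on rad (loc ` \<P> \<union> {\<qq>})"
      using inj_on_rad rad_loc rq(1) mm_notin by (auto simp: inj_on_def)
    show "\<forall>\<qq>\<in>loc ` \<P>. prime_height ring_of_type_algebra (rad \<qq>) = n"
      using rad_loc height_P prime_P I_subset by auto
  qed (use finite_P primary_loc rq unmixed_iff IJ in auto)
qed

lemma decomposes_exists: "\<exists>\<E>. decomposes (loc ` \<P>) \<E>"
proof (cases "I = J")
  case True
  then show ?thesis using decomposes_unmixed by blast
next
  case False
  obtain a where "a > 0" "J = quot I (h ^ a)"
    unfolding J_def by (rule saturation_eq_quot[OF noeth ideal_I])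
  then show ?thesis using decomposes_mixed(2)[OF False] by blast
qed

text \<open>One inclusion cancels \<open>g\<close> at each member of \<open>\<P>\<close>. For the
  other, a power of \<open>g\<close> lies in I + (h^a), so it multiplies \<open>J\<close> into
  \<open>I\<close> just as h^a does.\<close>

lemma saturation_eq_J:
  assumes g: "g \<in> \<mm>" "\<And>P. P \<in> \<P> \<Longrightarrow> g \<notin> P"
  shows "saturation ring_of_type_algebra I g = J"
proof
  have "f \<in> loc P" if "f * g ^ k \<in> I" "P \<in> \<P>" for f k P
    using that g(2)[of P] prime_power[OF prime_P[OF that(2)], of g k] by (auto simp: loc_iff)
  then show "saturation ring_of_type_algebra I g \<subseteq> J"
    unfolding J_eq_Inter by (auto simp: saturation_iff)
  show "J \<subseteq> saturation ring_of_type_algebra I g"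
  proof
    fix f assume f: "f \<in> J"
    obtain a where a: "a > 0" "J = quot I (h ^ a)"
      unfolding J_def by (rule saturation_eq_quot[OF noeth ideal_I])
    have "g \<in> rad (Idl\<^bsub>ring_of_type_algebra\<^esub> (I \<union> {h ^ a}))"
      using rad_sum_h[OF a(1)] g(1) by simp
    then obtain k i r where k: "g ^ k = i + r * h ^ a" "i \<in> I"
      unfolding rad_iff ideal_plus_principal[OF ideal_I] by blast
    have "f * i + r * (f * h ^ a) \<in> I"
      using f a k(2) by (auto simp: quot_iff intro!: ideal_add[OF ideal_I] ideal_mult[OF ideal_I])
    then have "f * g ^ k \<in> I" by (simp add: k algebra_simps)
    then have "f * g ^ k * g \<in> I" by (rule ideal_mult_right[OF ideal_I])
    then show "f \<in> saturation ring_of_type_algebra I g"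
      by (auto simp: saturation_iff algebra_simps intro!: exI[of _ "Suc k"])
  qed
qed

text \<open>\<open>isolated_component\<close> ranges over all minimal decompositions. A radical that
  is minimal within one of them is a minimal prime of \<open>I\<close>, and the component there does
  not depend on the decomposition.\<close>

lemma Hull_eq_J: "Hull ring_of_type_algebra I = J"
proof -
  have "isolated_component ring_of_type_algebra I q \<longleftrightarrow> q \<in> loc ` \<P>" for q
  proof
    assume "isolated_component ring_of_type_algebra I q"
    then obtain \<D> where D: "primary_decomposition I \<D>" "q \<in> \<D>" "\<And>Q. Q \<in> \<D> \<Longrightarrow> \<not> rad Q \<subset> rad q"
      by (auto simp: isolated_component_def)
    have D': "finite \<D>" "\<And>Q. Q \<in> \<D> \<Longrightarrow> primary_ideal ring_of_type_algebra Q" "I = \<Inter>\<D>"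
      using D by (auto simp: primary_decomposition_iff)
    have "rad q \<in> \<P>"
    proof (rule minimal_prime_mem)
      show "is_prime (rad q)" using D' D prime_rad_primary by blast
      show "I \<subseteq> rad q" using D' D subset_rad by blast
      fix N assume N: "is_prime N" "I \<subseteq> N" "N \<subseteq> rad q"
      then obtain Q where Q: "Q \<in> \<D>" "Q \<subseteq> N"
        using prime_contains_of_Inter[OF N(1) D'(1)] D' by (auto simp: primary_ideal_iff)
      then have "rad Q \<subseteq> N" by (intro rad_subset_prime[OF N(1)])
      then show "N = rad q" using D(3)[OF Q(1)] N(3) by auto
    qed
    then show "q \<in> loc ` \<P>" using component_eq_loc[OF D(1,2)] by blast
  next
    assume "q \<in> loc ` \<P>"
    then obtain P where P: "P \<in> \<P>" "q = loc P" by auto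
    obtain \<E> where "decomposes (loc ` \<P>) \<E>" using decomposes_exists by blast
    then have D: "primary_decomposition I (loc ` \<P> \<union> \<E>)" by (simp add: decomposes_def)
    have "\<not> rad Q \<subset> rad q" if "Q \<in> loc ` \<P> \<union> \<E>" for Q
    proof -
      have "primary_ideal ring_of_type_algebra Q" "I \<subseteq> rad Q"
        using D that subset_rad[of Q] unfolding primary_decomposition_iff by blast+
      then show ?thesis using minimal_P[OF P(1) prime_rad_primary] rad_loc[OF P(1)] P(2) by blast
    qed
    then show "isolated_component ring_of_type_algebra I q"
      unfolding isolated_component_def using D P by blast
  qed
  then have "{Q. isolated_component ring_of_type_algebra I Q} = loc ` \<P>" by blast
  then show ?thesis unfolding Hull_def J_eq_Inter by simp
qed

end

section \<open>Graded ideals of the polynomial ring\<close>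

abbreviation cf :: "('s, 'k::zero) mpoly \<Rightarrow> ('s \<Rightarrow>\<^sub>0 nat) \<Rightarrow> 'k" where
  "cf \<equiv> Poly_Mapping.lookup"

abbreviation ex :: "('s \<Rightarrow>\<^sub>0 nat) \<Rightarrow> 's \<Rightarrow> nat" where
  "ex \<equiv> Poly_Mapping.lookup"

abbreviation mon :: "('s \<Rightarrow>\<^sub>0 nat) \<Rightarrow> 'k::zero \<Rightarrow> ('s, 'k) mpoly" where
  "mon \<equiv> Poly_Mapping.single"

lemma mpoly_expand: "f = (\<Sum>e\<in>Poly_Mapping.keys f. mon e (cf f e))"
proof (rule poly_mapping_eqI)
  fix e
  show "cf f e = cf (\<Sum>e\<in>Poly_Mapping.keys f. mon e (cf f e)) e"
    by (auto simp: lookup_sum lookup_single when_def in_keys_iff)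
qed

lemma mpoly_induct [case_names monomial add]:
  fixes f :: "('s, 'k::comm_monoid_add) mpoly"
  assumes "\<And>e c. P (mon e c)" "\<And>f g. P f \<Longrightarrow> P g \<Longrightarrow> P (f + g)"
  shows "P f"
proof -
  have "P (\<Sum>e\<in>E. mon e (cf f e))" if "finite E" for E
    using that
    by (induction E rule: finite_induct) (use assms assms(1)[of 0 0] in auto)
  then have "P (\<Sum>e\<in>Poly_Mapping.keys f. mon e (cf f e))" by simp
  then show ?thesis unfolding mpoly_expand[symmetric] .
qed

text \<open>Coefficient maps for which \<open>poly_subst\<close> is a ring homomorphism:
  \<open>id\<close> serves evaluation at points, the embedding as constant polynomials serves Herzog
  ideals.\<close>

locale coeff_hom =
  fixes \<phi> :: "'k::field \<Rightarrow> 'r::comm_ring_1"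
  assumes hom_add: "\<phi> (a + b) = \<phi> a + \<phi> b" and hom_mult: "\<phi> (a * b) = \<phi> a * \<phi> b"
    and hom_one: "\<phi> 1 = 1"
begin

lemma hom_zero: "\<phi> 0 = 0"
  using hom_add[of 0 0] by simp

lemma poly_subst_mon:
  "poly_subst \<phi> x (mon e c) = \<phi> c * (\<Prod>i\<in>UNIV. x i ^ ex e i)"
  by (auto simp: poly_subst_def hom_zero)

lemma poly_subst_add: "poly_subst \<phi> x (f + g) = poly_subst \<phi> x f + poly_subst \<phi> x g"
  unfolding poly_subst_def
  by (rule setsum_keys_plus_distrib) (auto simp: hom_zero hom_add algebra_simps)

lemma poly_subst_mult: "poly_subst \<phi> x (f * g) = poly_subst \<phi> x f * poly_subst \<phi> x g"
proof (induction f rule: mpoly_induct)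
  case (monomial e c)
  show ?case
    by (induction g rule: mpoly_induct)
       (auto simp: mult_single poly_subst_mon poly_subst_add hom_mult lookup_add power_add
                   prod.distrib algebra_simps)
qed (auto simp: poly_subst_add algebra_simps)

lemma poly_subst_one: "poly_subst \<phi> x 1 = 1"
  using poly_subst_mon[of x 0 1] by (simp add: hom_one)

lemma poly_subst_uminus: "poly_subst \<phi> x (- f) = - poly_subst \<phi> x f"
proof -
  have "poly_subst \<phi> x (- f) + poly_subst \<phi> x f = poly_subst \<phi> x 0"
    by (simp flip: poly_subst_add)
  also have "\<dots> = 0" by (simp add: poly_subst_def)
  finally show ?thesis by (simp add: eq_neg_iff_add_eq_0)
qed

lemma poly_subst_diff: "poly_subst \<phi> x (f - g) = poly_subst \<phi> x f - poly_subst \<phi> x g"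
  using poly_subst_add[of x f "- g"] by (simp add: poly_subst_uminus)

lemma poly_subst_zero: "poly_subst \<phi> x 0 = 0"
  by (simp add: poly_subst_def)

lemma ideal_kernel: "is_ideal {f. poly_subst \<phi> x f = 0}"
  by (rule is_idealI) (auto simp: poly_subst_zero poly_subst_add poly_subst_mult)

end

interpretation eval: coeff_hom "id :: 'k::field \<Rightarrow> 'k"
  by unfold_locales auto

lemma prime_eval_kernel: "is_prime {f. poly_subst id (x :: 's::finite \<Rightarrow> 'k::field) f = 0}"
  unfolding is_prime_iff
  using eval.ideal_kernel[of x] by (auto simp: eval.poly_subst_one eval.poly_subst_mult)

section \<open>Weighted degrees, homogeneous components and homogeneous primes\<close>

definition wt :: "('s::finite \<Rightarrow> nat) \<Rightarrow> ('s \<Rightarrow>\<^sub>0 nat) \<Rightarrow> nat" where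
  "wt d e = (\<Sum>i\<in>UNIV. d i * ex e i)"

lemma wt_add: "wt d (e + e') = wt d e + wt d e'"
  by (simp add: wt_def lookup_add algebra_simps sum.distrib)

lemma wt_zero [simp]: "wt d 0 = 0"
  by (simp add: wt_def)

abbreviation hc :: "('s::finite \<Rightarrow> nat) \<Rightarrow> nat \<Rightarrow> ('s, 'k::field) mpoly \<Rightarrow> ('s, 'k) mpoly" where
  "hc \<equiv> homogeneous_component"

lemma lookup_hc: "cf (hc d n f) e = (if wt d e = n then cf f e else 0)"
  by (auto simp: homogeneous_component_def lookup_sum lookup_single when_def wt_def in_keys_iff)

lemma hc_add: "hc d n (f + g) = hc d n f + hc d n g"
  by (rule poly_mapping_eqI) (simp add: lookup_hc lookup_add)

lemma hc_zero [simp]: "hc d n 0 = 0"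
  by (rule poly_mapping_eqI) (simp add: lookup_hc)

lemma hc_diff: "hc d n (f - g) = hc d n f - hc d n g"
  by (rule poly_mapping_eqI) (simp add: lookup_hc lookup_minus)

lemma hc_sum: "hc d n (sum f A) = (\<Sum>x\<in>A. hc d n (f x))"
  by (induction A rule: infinite_finite_induct) (auto simp: hc_add)

lemma hc_mon: "hc d n (mon e c) = (if wt d e = n then mon e c else 0)"
  by (rule poly_mapping_eqI) (auto simp: lookup_hc lookup_single when_def)

lemma hc_hc: "hc d k (hc d n f) = (if k = n then hc d n f else 0)"
  by (rule poly_mapping_eqI) (auto simp: lookup_hc)

lemma hc_one: "hc d n 1 = (if n = 0 then 1 else 0)"
  using hc_mon[of d n 0 1] by auto

lemma hc_mult: "hc d n (f * g) = (\<Sum>k\<le>n. hc d k f * hc d (n - k) g)"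
proof (induction f rule: mpoly_induct)
  case (monomial e c)
  show ?case
  proof (induction g rule: mpoly_induct)
    case (monomial e' c')
    have "(\<Sum>k\<le>n. hc d k (mon e c) * hc d (n - k) (mon e' c')) =
      (\<Sum>k\<le>n. if k = wt d e then mon e c * hc d (n - wt d e) (mon e' c') else 0)"
      by (rule sum.cong) (auto simp: hc_mon)
    then show ?case by (auto simp: hc_mon mult_single wt_add)
  qed (simp add: hc_add algebra_simps sum.distrib)
qed (simp add: hc_add algebra_simps sum.distrib)

lemma hc_bounded:
  obtains N where "\<And>n. n > N \<Longrightarrow> hc d n f = 0" "f = (\<Sum>n\<le>N. hc d n f)"
proof -
  define N where "N = Max (insert 0 (wt d ` Poly_Mapping.keys f))"
  have le: "wt d e \<le> N" if "cf f e \<noteq> 0" for e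
    using that by (auto simp: N_def in_keys_iff intro!: Max_ge)
  show ?thesis
  proof
    show "hc d n f = 0" if "n > N" for n
      by (rule poly_mapping_eqI) (use le that in \<open>fastforce simp: lookup_hc\<close>)
    show "f = (\<Sum>n\<le>N. hc d n f)"
      by (rule poly_mapping_eqI) (use le in \<open>auto simp: lookup_hc lookup_sum\<close>)
  qed
qed

definition homog_by :: "('s::finite \<Rightarrow> nat) \<Rightarrow> ('s, 'k::field) mpoly set \<Rightarrow> bool" where
  "homog_by d A \<longleftrightarrow> (\<forall>f\<in>A. \<forall>n. hc d n f \<in> A)"

text \<open>The largest homogeneous ideal contained in an ideal.\<close>

definition star :: "('s::finite \<Rightarrow> nat) \<Rightarrow> ('s, 'k::field) mpoly set \<Rightarrow> ('s, 'k) mpoly set" where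
  "star d A = {f. \<forall>n. hc d n f \<in> A}"

lemma star_subset:
  assumes "is_ideal A" shows "star d A \<subseteq> A"
proof
  fix f assume f: "f \<in> star d A"
  obtain N where N: "f = (\<Sum>n\<le>N. hc d n f)" by (rule hc_bounded)
  have "(\<Sum>n\<le>N. hc d n f) \<in> A" using f by (intro ideal_sum[OF assms]) (auto simp: star_def)
  with N show "f \<in> A" by simp
qed

lemma star_greatest: "homog_by d B \<Longrightarrow> B \<subseteq> A \<Longrightarrow> B \<subseteq> star d A"
  by (auto simp: homog_by_def star_def)

lemma homog_star: "is_ideal A \<Longrightarrow> homog_by d (star d A)"
  by (auto simp: homog_by_def star_def hc_hc ideal_zero)

lemma ideal_star:
  assumes A: "is_ideal A" shows "is_ideal (star d A)"
  by (rule is_idealI)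
     (auto simp: star_def hc_add hc_mult ideal_zero[OF A] intro!: ideal_add[OF A] ideal_sum[OF A] ideal_mult[OF A])

text \<open>If both factors have components outside \<open>P\<close>, take the lowest ones, in
  degrees a and b: in degree a + b the product agrees modulo \<open>P\<close> with the product of
  these two components.\<close>

lemma prime_star:
  assumes P: "is_prime P" shows "is_prime (star d P)"
  unfolding is_prime_iff
proof (intro conjI allI impI)
  note iP = prime_ideal[OF P]
  show "is_ideal (star d P)" by (rule ideal_star[OF iP])
  show "1 \<notin> star d P" using prime_one[OF P] star_subset[OF iP] by blast
  fix f g assume fg: "f * g \<in> star d P"
  show "f \<in> star d P \<or> g \<in> star d P"
  proof (rule ccontr)
    assume "\<not> ?thesis"
    then have ex: "\<exists>a. hc d a f \<notin> P" "\<exists>b. hc d b g \<notin> P" by (auto simp: star_def)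
    obtain a where a: "hc d a f \<notin> P" "\<And>k. k < a \<Longrightarrow> hc d k f \<in> P"
      using ex(1) unfolding exists_least_iff[of "\<lambda>a. hc d a f \<notin> P"] by blast
    obtain b where b: "hc d b g \<notin> P" "\<And>k. k < b \<Longrightarrow> hc d k g \<in> P"
      using ex(2) unfolding exists_least_iff[of "\<lambda>b. hc d b g \<notin> P"] by blast
    have "(\<Sum>k\<in>{..a + b} - {a}. hc d k f * hc d (a + b - k) g) \<in> P"
    proof (rule ideal_sum[OF iP])
      fix k assume k: "k \<in> {..a + b} - {a}"
      show "hc d k f * hc d (a + b - k) g \<in> P"
      proof (cases "k < a")
        case False
        then have "a + b - k < b" using k by auto
        then show ?thesis using b ideal_mult[OF iP] by blast
      qed (use a ideal_mult_right[OF iP] in blast)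
    qed
    moreover have "hc d (a + b) (f * g) =
      hc d a f * hc d b g + (\<Sum>k\<in>{..a + b} - {a}. hc d k f * hc d (a + b - k) g)"
      unfolding hc_mult by (subst sum.remove[of _ a]) auto
    moreover have "hc d (a + b) (f * g) \<in> P" using fg by (auto simp: star_def)
    ultimately have "hc d a f * hc d b g \<in> P" by (simp add: ideal_add_cancel[OF iP])
    then show False using prime_mult[OF P] a(1) b(1) by blast
  qed
qed

text \<open>Let \<open>y\<close> be the lowest component of an element of (A : f) that is not itself
  in (A : f). Increasing powers of \<open>y\<close> kill the successive components of
  \<open>f\<close>, so some power kills \<open>f\<close>, and primeness contradicts the choice of
  \<open>y\<close>.\<close>

lemma homog_associated_prime:
  fixes A :: "('s::finite, 'k::field) mpoly set"
  assumes A: "is_ideal A" "homog_by d A" and P: "is_prime (quot A f)"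
  shows "homog_by d (quot A f)"
proof (rule ccontr)
  note iP = prime_ideal[OF P]
  assume "\<not> ?thesis"
  then obtain x0 where x0: "x0 \<in> quot A f" "\<exists>n. hc d n x0 \<notin> quot A f" by (auto simp: homog_by_def)
  obtain a where a: "hc d a x0 \<notin> quot A f" "\<And>k. k < a \<Longrightarrow> hc d k x0 \<in> quot A f"
    using x0(2) unfolding exists_least_iff[of "\<lambda>n. hc d n x0 \<notin> quot A f"] by blast
  define x where "x = x0 - (\<Sum>k<a. hc d k x0)"
  have x: "x \<in> quot A f"
    unfolding x_def using a by (intro ideal_diff[OF iP] x0 ideal_sum[OF iP]) auto
  have hcx: "hc d k x = (if k < a then 0 else hc d k x0)" for k
    unfolding x_def hc_diff hc_sum by (auto simp: hc_hc)
  define y where "y = hc d a x0"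
  \<comment> \<open>In degree a + j of x f, every nonzero term other than y f_j involves a component
    of \<open>f\<close> of degree below j, which y^j kills by induction.\<close>
  have key: "y ^ Suc j * hc d j f \<in> A" for j
  proof (induction j rule: less_induct)
    case (less j)
    have "hc d (a + j) (x * f) \<in> A" using x A(2) by (auto simp: homog_by_def quot_iff)
    also have "hc d (a + j) (x * f) = (\<Sum>k\<in>{..a + j}. hc d k x * hc d (a + j - k) f)"
      by (rule hc_mult)
    also have "\<dots> = y * hc d j f + (\<Sum>k\<in>{..a + j} - {a}. hc d k x * hc d (a + j - k) f)"
      by (subst sum.remove[of _ a]) (auto simp: hcx y_def)
    finally have "y ^ j * (y * hc d j f + (\<Sum>k\<in>{..a + j} - {a}. hc d k x * hc d (a + j - k) f)) \<in> A"
      by (rule ideal_mult[OF A(1)])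
    then have "y ^ Suc j * hc d j f + (\<Sum>k\<in>{..a + j} - {a}. y ^ j * (hc d k x * hc d (a + j - k) f)) \<in> A"
      by (simp add: algebra_simps sum_distrib_left)
    moreover have "(\<Sum>k\<in>{..a + j} - {a}. y ^ j * (hc d k x * hc d (a + j - k) f)) \<in> A"
    proof (rule ideal_sum[OF A(1)])
      fix k assume k: "k \<in> {..a + j} - {a}"
      show "y ^ j * (hc d k x * hc d (a + j - k) f) \<in> A"
      proof (cases "k < a")
        case False
        then have l: "a + j - k < j" using k by auto
        then have "y ^ j = y ^ (j - Suc (a + j - k)) * y ^ Suc (a + j - k)"
          using l power_add[of y "j - Suc (a + j - k)" "Suc (a + j - k)"] by (simp del: power_Suc)
        then have "y ^ j * (hc d k x * hc d (a + j - k) f) =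
          (y ^ (j - Suc (a + j - k)) * hc d k x) * (y ^ Suc (a + j - k) * hc d (a + j - k) f)"
          by (simp add: algebra_simps)
        then show ?thesis by (simp only: ideal_mult[OF A(1) less[OF l]])
      qed (simp add: hcx ideal_zero[OF A(1)])
    qed
    ultimately show ?case using ideal_add_cancel[OF A(1)] by blast
  qed
  obtain N where N: "f = (\<Sum>n\<le>N. hc d n f)" by (rule hc_bounded)
  have "y ^ Suc N * hc d j f \<in> A" if "j \<le> N" for j
  proof -
    have "y ^ Suc N = y ^ (N - j) * y ^ Suc j" using that power_add[of y "N - j" "Suc j"] by (simp del: power_Suc)
    then show ?thesis using ideal_mult[OF A(1) key[of j], of "y ^ (N - j)"] by (simp add: mult.assoc)
  qed
  then have "(\<Sum>n\<le>N. y ^ Suc N * hc d n f) \<in> A" by (intro ideal_sum[OF A(1)]) auto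
  then have "y ^ Suc N \<in> quot A f"
    unfolding quot_iff by (subst N) (simp only: sum_distrib_left)
  then have "y \<in> quot A f" by (rule prime_power[OF P])
  then show False using a unfolding y_def by simp
qed

section \<open>Noetherianity and lengths of chains of primes\<close>

lemma mono_subsequence_nat:
  fixes s :: "nat \<Rightarrow> nat"
  obtains r :: "nat \<Rightarrow> nat" where "strict_mono r" "mono (s \<circ> r)"
proof -
  obtain f :: "nat \<Rightarrow> nat" where f: "strict_mono f" "monoseq (\<lambda>n. s (f n))" using seq_monosub[of s] by blast
  show ?thesis
  proof (cases "\<forall>m. \<forall>n\<ge>m. s (f m) \<le> s (f n)")
    case True
    then show ?thesis using that[of f] f by (auto simp: mono_def)
  next
    case False
    then have dec: "\<And>m n. m \<le> n \<Longrightarrow> s (f n) \<le> s (f m)" using f(2) by (auto simp: monoseq_def)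
    obtain N where N: "\<And>n. s (f N) \<le> s (f n)"
      using ex_has_least_nat[of "\<lambda>_. True" 0 "\<lambda>n. s (f n)"] by auto
    have "s (f (n + N)) = s (f N)" for n using N[of "n + N"] dec[of N "n + N"] by simp
    then show ?thesis using that[of "\<lambda>n. f (n + N)"] f(1) by (auto simp: strict_mono_def mono_def)
  qed
qed

text \<open>The induction adds one coordinate at a time, thinning the sequence so that this
  coordinate becomes monotone as well.\<close>

lemma dickson:
  fixes u :: "nat \<Rightarrow> 's::finite \<Rightarrow>\<^sub>0 nat"
  shows "\<exists>i j. i < j \<and> (\<forall>x. ex (u i) x \<le> ex (u j) x)"
proof -
  have "\<exists>r :: nat \<Rightarrow> nat. strict_mono r \<and> (\<forall>x\<in>A. mono (\<lambda>n. ex (u (r n)) x))" for A :: "'s set"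
    using finite[of A]
  proof (induction A rule: finite_induct)
    case empty
    then show ?case by (auto intro: exI[of _ id] simp: strict_mono_def)
  next
    case (insert a A)
    then obtain r :: "nat \<Rightarrow> nat" where r: "strict_mono r" "\<And>x. x \<in> A \<Longrightarrow> mono (\<lambda>n. ex (u (r n)) x)" by blast
    obtain t :: "nat \<Rightarrow> nat" where t: "strict_mono t" "mono ((\<lambda>n. ex (u (r n)) a) \<circ> t)"
      by (rule mono_subsequence_nat[of "\<lambda>n. ex (u (r n)) a"])
    have "strict_mono (r \<circ> t)" using r(1) t(1) by (rule strict_mono_o)
    moreover have "mono (\<lambda>n. ex (u (r (t n))) x)" if "x \<in> insert a A" for x
      using that t r(2)[of x] strict_mono_mono[OF t(1)] by (auto simp: mono_def)
    ultimately show ?case by (intro exI[of _ "r \<circ> t"]) (auto simp: o_def)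
  qed
  from this[of UNIV] obtain r :: "nat \<Rightarrow> nat" where "strict_mono r" "\<And>x. mono (\<lambda>n. ex (u (r n)) x)" by blast
  then have "r 0 < r 1 \<and> (\<forall>x. ex (u (r 0)) x \<le> ex (u (r 1)) x)" by (auto simp: strict_mono_def mono_def)
  then show ?thesis by blast
qed

text \<open>The lexicographic monomial order, with the variables ranked by
  \<open>to_nat\<close>.\<close>

definition mlt :: "('s::finite \<Rightarrow>\<^sub>0 nat) \<Rightarrow> ('s \<Rightarrow>\<^sub>0 nat) \<Rightarrow> bool" where
  "mlt e e' \<longleftrightarrow> (\<exists>i. ex e i < ex e' i \<and> (\<forall>j. to_nat j < to_nat i \<longrightarrow> ex e j = ex e' j))"

lemma mlt_add: "mlt (u + e) (u + e') \<longleftrightarrow> mlt e e'"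
  by (simp add: mlt_def lookup_add)

lemma mlt_trans:
  assumes "mlt a b" "mlt b c" shows "mlt a c"
proof -
  obtain i j where i: "ex a i < ex b i" "\<And>k. to_nat k < to_nat i \<Longrightarrow> ex a k = ex b k"
    and j: "ex b j < ex c j" "\<And>k. to_nat k < to_nat j \<Longrightarrow> ex b k = ex c k"
    using assms by (auto simp: mlt_def)
  consider "to_nat i < to_nat j" | "i = j" | "to_nat j < to_nat i"
    using inj_to_nat by (metis injD linorder_neqE_nat)
  then show ?thesis
  proof cases
    case 1 then show ?thesis unfolding mlt_def using i j by (intro exI[of _ i]) (auto dest: less_trans)
  next
    case 2 then show ?thesis unfolding mlt_def using i j by (intro exI[of _ i]) auto
  next
    case 3 then show ?thesis unfolding mlt_def using i j by (intro exI[of _ j]) (auto dest: less_trans)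
  qed
qed

lemma mlt_total:
  assumes "e \<noteq> e'" shows "mlt e e' \<or> mlt e' e"
proof -
  have "\<exists>i. ex e i \<noteq> ex e' i" using assms by (auto intro: poly_mapping_eqI)
  then obtain i where i: "ex e i \<noteq> ex e' i" "\<And>j. to_nat j < to_nat i \<Longrightarrow> ex e j = ex e' j"
    using ex_has_least_nat[of "\<lambda>i. ex e i \<noteq> ex e' i" _ to_nat] by (metis leD)
  then show ?thesis unfolding mlt_def by (metis linorder_neqE_nat)
qed

lemma mlt_not_le: "mlt e e' \<Longrightarrow> \<exists>x. \<not> ex e' x \<le> ex e x"
  by (auto simp: mlt_def not_le)

text \<open>By \<open>dickson\<close> an infinite descent has a later exponent that dominates an
  earlier one in every variable, which a strict lexicographic decrease excludes.\<close>

lemma wf_mlt: "wf {(e :: 's::finite \<Rightarrow>\<^sub>0 nat, e'). mlt e e'}"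
  unfolding wf_iff_no_infinite_down_chain
proof
  assume "\<exists>f. \<forall>i. (f (Suc i), f i) \<in> {(e :: 's \<Rightarrow>\<^sub>0 nat, e'). mlt e e'}"
  then obtain f :: "nat \<Rightarrow> 's \<Rightarrow>\<^sub>0 nat" where "\<forall>i. (f (Suc i), f i) \<in> {(e, e'). mlt e e'}" ..
  then have f: "mlt (f (Suc i)) (f i)" for i by auto
  obtain i j where ij: "i < j" "\<And>x. ex (f i) x \<le> ex (f j) x" using dickson[of f] by blast
  have "mlt (f (i + Suc k)) (f i)" for k
    by (induction k) (use f mlt_trans in \<open>auto intro: f\<close>)
  from this[of "j - Suc i"] have "mlt (f j) (f i)" using ij(1) by simp
  then show False using mlt_not_le[of "f j" "f i"] ij(2) by blast
qed

definition lead :: "('s::finite, 'k::zero) mpoly \<Rightarrow> ('s \<Rightarrow>\<^sub>0 nat) \<Rightarrow> bool" where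
  "lead f e \<longleftrightarrow> cf f e \<noteq> 0 \<and> (\<forall>e'. cf f e' \<noteq> 0 \<longrightarrow> e' = e \<or> mlt e' e)"

lemma lead_exists:
  assumes "f \<noteq> 0" shows "\<exists>e. lead f e"
proof -
  have "\<exists>e\<in>A. \<forall>e'\<in>A. e' = e \<or> mlt e' e" if "finite A" "A \<noteq> {}" for A :: "('a \<Rightarrow>\<^sub>0 nat) set"
    using that
  proof (induction A rule: finite_ne_induct)
    case (insert x A)
    then obtain e where e: "e \<in> A" "\<And>e'. e' \<in> A \<Longrightarrow> e' = e \<or> mlt e' e" by blast
    show ?case
    proof (cases "mlt x e")
      case False
      then have "mlt e x \<or> e = x" using mlt_total by blast
      then have "\<forall>e'\<in>insert x A. e' = x \<or> mlt e' x" using e mlt_trans by blast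
      then show ?thesis by blast
    qed (use e in blast)
  qed auto
  from this[of "Poly_Mapping.keys f"] assms show ?thesis
    by (simp add: lead_def in_keys_iff Bex_def Ball_def)
qed

lemma lookup_mon_mult: "cf (mon u c * p) (u + e) = (c :: 'k::field) * cf p e"
proof (induction p rule: mpoly_induct)
  case (monomial e' c')
  then show ?case by (auto simp: mult_single lookup_single when_def)
qed (simp add: lookup_add algebra_simps)

lemma keys_mon_mult:
  assumes "cf (mon u (c :: 'k::field) * p) e \<noteq> 0"
  obtains e' where "e = u + e'" "cf p e' \<noteq> 0"
proof -
  have "e \<in> Poly_Mapping.keys (mon u c * p)" using assms by (simp add: in_keys_iff)
  then obtain a b where ab: "e = a + b" "a \<in> Poly_Mapping.keys (mon u c)" "b \<in> Poly_Mapping.keys p"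
    using keys_mult[of "mon u c" p] by blast
  then have "a = u" by (auto split: if_splits)
  then show ?thesis using that[of b] ab by (simp add: in_keys_iff)
qed

text \<open>Hilbert's basis theorem by leading exponents. At each step of a strictly ascending chain
  take a new element whose leading exponent is \<open>mlt\<close>-minimal. By \<open>dickson\<close>
  one of these exponents divides a later one, and reducing the later element gives one that is still
  new but has a smaller leading exponent.\<close>

theorem noetherian_mpoly: "noetherian TYPE(('s::finite, 'k::field) mpoly)"
  unfolding noetherian_def wf_iff_no_infinite_down_chain
proof
  assume "\<exists>f. \<forall>i. (f (Suc i), f i) \<in> {(B, A :: ('s, 'k) mpoly set). is_ideal A \<and> is_ideal B \<and> A \<subset> B}"
  then obtain A :: "nat \<Rightarrow> ('s, 'k) mpoly set"
    where "\<forall>i. (A (Suc i), A i) \<in> {(B, A). is_ideal A \<and> is_ideal B \<and> A \<subset> B}" ..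
  then have A: "is_ideal (A i)" "A i \<subset> A (Suc i)" for i by auto
  have mono: "A i \<subseteq> A j" if "i \<le> j" for i j
    by (rule lift_Suc_mono_le[of A, OF psubset_imp_subset[OF A(2)] that])
  define Q where "Q = (\<lambda>n (p, e). p \<in> A (Suc n) - A n \<and> lead p e \<and>
    (\<forall>q e'. q \<in> A (Suc n) - A n \<longrightarrow> lead q e' \<longrightarrow> \<not> mlt e' e))"
  have "\<exists>z. Q n z" for n
  proof -
    define E where "E = {e. \<exists>p. p \<in> A (Suc n) - A n \<and> lead p e}"
    obtain p where p: "p \<in> A (Suc n)" "p \<notin> A n" using A(2)[of n] by blast
    then have "p \<noteq> 0" using ideal_zero[OF A(1)] by auto
    then obtain e where "e \<in> E" using p lead_exists[of p] by (auto simp: E_def)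
    then have "\<exists>z\<in>E. \<forall>y. (y, z) \<in> {(e, e'). mlt e e'} \<longrightarrow> y \<notin> E"
      using wf_mlt[unfolded wf_eq_minimal, THEN spec, of E] by metis
    then obtain z where z: "z \<in> E" "\<And>y. y \<in> E \<Longrightarrow> \<not> mlt y z" by auto
    then obtain r where "r \<in> A (Suc n) - A n" "lead r z" by (auto simp: E_def)
    then have "Q n (r, z)" using z(2) by (auto simp: Q_def E_def)
    then show ?thesis ..
  qed
  then obtain pe where pe: "\<And>n. Q n (pe n)" using choice[of Q] by blast
  define p where "p = fst \<circ> pe"
  define e where "e = snd \<circ> pe"
  have Q: "Q n (p n, e n)" for n using pe[of n] by (simp add: p_def e_def)
  have p: "p n \<in> A (Suc n) - A n" "lead (p n) (e n)" for n using Q[of n] by (auto simp: Q_def)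
  have mn: "\<not> mlt e' (e n)" if "q \<in> A (Suc n) - A n" "lead q e'" for n q e'
    using Q[of n] that by (auto simp: Q_def)
  obtain i j where ij: "i < j" "\<And>x. ex (e i) x \<le> ex (e j) x" using dickson[of e] by blast
  define u where "u = e j - e i"
  have ej: "e j = u + e i"
    by (rule poly_mapping_eqI) (use ij(2) in \<open>simp add: u_def lookup_add lookup_minus\<close>)
  define c where "c = cf (p j) (e j) / cf (p i) (e i)"
  define q where "q = p j - mon u c * p i"
  have "p i \<in> A j" using p(1)[of i] mono[of "Suc i" j] ij(1) by auto
  then have "mon u c * p i \<in> A j" by (rule ideal_mult[OF A(1)])
  moreover from this have "mon u c * p i \<in> A (Suc j)" using mono[of j "Suc j"] by auto
  ultimately have q: "q \<in> A (Suc j) - A j"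
    using p(1)[of j] ideal_diff[OF A(1), of "p j" "Suc j" "mon u c * p i"]
      ideal_add[OF A(1), of q j "mon u c * p i"] by (auto simp: q_def)
  then have "q \<noteq> 0" using ideal_zero[OF A(1)] by auto
  then obtain e' where e': "lead q e'" using lead_exists by blast
  have "cf q (e j) = 0"
    using p(2)[of i] unfolding q_def ej lookup_minus lookup_mon_mult by (simp add: c_def ej lead_def)
  then have ne: "e' \<noteq> e j" using e' by (auto simp: lead_def)
  have "mlt e' (e j)"
  proof (cases "cf (p j) e' = 0")
    case True
    then have "cf (mon u c * p i) e' \<noteq> 0" using e' by (auto simp: lead_def q_def lookup_minus)
    then obtain e'' where "e' = u + e''" "cf (p i) e'' \<noteq> 0" by (rule keys_mon_mult)
    then show ?thesis using p(2)[of i] ne unfolding ej by (auto simp: lead_def mlt_add)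
  qed (use p(2)[of j] ne in \<open>auto simp: lead_def\<close>)
  then show False using mn[OF q e'] by blast
qed

section \<open>Counting linearly independent polynomials in a box of exponents\<close>

interpretation mp: vector_space "\<lambda>c (f :: ('s::finite, 'k::field) mpoly). mon 0 c * f"
  by unfold_locales (auto simp: algebra_simps single_add mult_single simp flip: mult.assoc)

text \<open>It is the index set that is counted, so repeated members must be excluded: coefficients
  1 and -1 at two equal members would be a nontrivial relation.\<close>

lemma (in vector_space) card_le_of_independent_family:
  assumes "finite I" "finite B" "\<And>i. i \<in> I \<Longrightarrow> x i \<in> span B"
    and indep: "\<And>c i. (\<Sum>i\<in>I. scale (c i) (x i)) = 0 \<Longrightarrow> i \<in> I \<Longrightarrow> c i = 0"
  shows "card I \<le> card B"
proof -
  have inj: "inj_on x I"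
  proof (rule inj_onI, rule ccontr)
    fix i j assume ij: "i \<in> I" "j \<in> I" "x i = x j" "i \<noteq> j"
    define c where "c = (\<lambda>k. if k = i then 1 else if k = j then - 1 else 0 :: 'a)"
    have "(\<Sum>k\<in>I. scale (c k) (x k)) = (\<Sum>k\<in>{i, j}. scale (c k) (x k))"
      using assms(1) ij by (intro sum.mono_neutral_right) (auto simp: c_def)
    also have "\<dots> = 0" using ij by (auto simp: c_def)
    finally have "c i = 0" using indep ij(1) by blast
    then show False by (simp add: c_def)
  qed
  have "independent (x ` I)"
  proof (rule independent_if_scalars_zero)
    fix f v assume "(\<Sum>v\<in>x ` I. scale (f v) v) = 0" "v \<in> x ` I"
    then show "f v = 0"
      using indep[of "\<lambda>i. f (x i)"] by (auto simp: sum.reindex[OF inj])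
  qed (use assms(1) in auto)
  then have "card (x ` I) \<le> card B"
    using independent_span_bound[OF assms(2), of "x ` I"] assms(3) by auto
  then show ?thesis by (simp add: card_image[OF inj])
qed

text \<open>Bounding each exponent separately makes the number of monomials a power and lets the
  bounds add up under products.\<close>

definition box :: "nat \<Rightarrow> ('s::finite \<Rightarrow>\<^sub>0 nat) set" where
  "box M = {e. \<forall>i. ex e i \<le> M}"

lemma box: "finite (box M :: ('s::finite \<Rightarrow>\<^sub>0 nat) set)" (is "finite ?B")
  "card (box M :: ('s::finite \<Rightarrow>\<^sub>0 nat) set) \<le> (M + 1) ^ CARD('s)"
proof -
  have inj: "inj_on ex ?B" by (auto intro!: inj_onI poly_mapping_eqI)
  have sub: "ex ` ?B \<subseteq> PiE UNIV (\<lambda>_. {..M})" by (auto simp: box_def)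
  have fin: "finite (PiE (UNIV :: 's set) (\<lambda>_. {..M}))" by (auto intro: finite_PiE)
  show "finite ?B" using inj sub fin by (metis finite_imageD finite_subset)
  have "card ?B = card (ex ` ?B)" using card_image[OF inj] by simp
  also have "\<dots> \<le> card (PiE (UNIV :: 's set) (\<lambda>_. {..M}))" by (rule card_mono[OF fin sub])
  also have "\<dots> = (M + 1) ^ CARD('s)" by (simp add: card_PiE)
  finally show "card ?B \<le> (M + 1) ^ CARD('s)" .
qed

abbreviation boxed :: "nat \<Rightarrow> ('s::finite, 'k::field) mpoly \<Rightarrow> bool" where
  "boxed M f \<equiv> Poly_Mapping.keys f \<subseteq> box M"

lemma boxed_mult: "boxed a f \<Longrightarrow> boxed b g \<Longrightarrow> boxed (a + b) (f * g)"
  using keys_mult[of f g] by (fastforce simp: box_def lookup_add intro: add_mono)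

lemma boxed_one: "boxed 0 1"
  by (auto simp: box_def)

lemma box_mono: "a \<le> b \<Longrightarrow> box a \<subseteq> box b"
  by (auto simp: box_def intro: order_trans)

lemma boxed_mono: "boxed a f \<Longrightarrow> a \<le> b \<Longrightarrow> boxed b f"
  using box_mono by blast

lemma boxed_power:
  assumes "boxed a f" shows "boxed (n * a) (f ^ n)"
proof (induction n)
  case (Suc n)
  then show ?case using boxed_mult[OF assms Suc] by simp
qed (simp add: box_def)

lemma boxed_exists: "\<exists>M. boxed M f"
proof -
  have "finite ((\<lambda>(e, i). ex e i) ` (Poly_Mapping.keys f \<times> UNIV))" by simp
  then obtain M where "\<And>x. x \<in> (\<lambda>(e, i). ex e i) ` (Poly_Mapping.keys f \<times> UNIV) \<Longrightarrow> x \<le> M"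
    using finite_nat_set_iff_bounded_le by metis
  then have "boxed M f" by (force simp: box_def)
  then show ?thesis ..
qed

lemma boxed_prod_list:
  assumes "\<And>f. f \<in> set fs \<Longrightarrow> boxed D f" "set u \<subseteq> {..N}"
  shows "boxed (length fs * (N * D)) (prod_list (map2 (^) fs u))"
  using assms
proof (induction fs arbitrary: u)
  case (Cons f fs)
  show ?case
  proof (cases u)
    case Nil
    then show ?thesis using boxed_mono[OF boxed_one] by auto
  next
    case (Cons k v)
    have "boxed (k * D) (f ^ k)" using Cons.prems by (intro boxed_power) auto
    moreover have "k * D \<le> N * D" using Cons.prems Cons by auto
    ultimately have "boxed (N * D) (f ^ k)" by (rule boxed_mono)
    moreover have "boxed (length fs * (N * D)) (prod_list (map2 (^) fs v))"
      using Cons.prems Cons by (intro Cons.IH) auto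
    ultimately show ?thesis using Cons boxed_mult by fastforce
  qed
qed (use boxed_one in auto)

lemma mpoly_in_span:
  assumes "Poly_Mapping.keys f \<subseteq> B" shows "f \<in> mp.span ((\<lambda>e. mon e 1) ` B)"
proof -
  have "mon e c \<in> mp.span ((\<lambda>e. mon e 1) ` B)" if "e \<in> B" for e c
  proof -
    have "mon e c = mon 0 c * mon e 1" by (simp add: mult_single)
    then show ?thesis
      using mp.span_scale[OF mp.span_base[OF imageI[OF that]], of c "\<lambda>e. mon e 1"] by simp
  qed
  then have "(\<Sum>e\<in>Poly_Mapping.keys f. mon e (cf f e)) \<in> mp.span ((\<lambda>e. mon e 1) ` B)"
    using assms by (intro mp.span_sum) auto
  then show ?thesis unfolding mpoly_expand[symmetric] .
qed

text \<open>Elements witnessing the strictness of a chain of primes are algebraically independent modulo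
  its first member: peel off the lowest power of the first element and pass to the next prime.\<close>

lemma chain_algebraically_independent:
  fixes fs :: "('s::finite, 'k::field) mpoly list"
  assumes "\<And>i. i \<le> length fs \<Longrightarrow> is_prime (C i)"
    and "\<And>i. i < length fs \<Longrightarrow> C i \<subseteq> C (Suc i) \<and> fs ! i \<in> C (Suc i) \<and> fs ! i \<notin> C i"
    and "finite U" "\<And>u. u \<in> U \<Longrightarrow> length u = length fs"
    and "(\<Sum>u\<in>U. mon 0 (c u) * prod_list (map2 (^) fs u)) \<in> C 0"
    and "u \<in> U"
  shows "c u = 0"
  using assms
proof (induction fs arbitrary: C U c u)
  case Nil
  then have U: "U = {[]}" "u = []" by auto
  have C0: "is_prime (C 0)" using Nil.prems(1)[of 0] by simp
  have "mon 0 (c []) \<in> C 0" using Nil.prems(5) by (simp add: U)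
  then have "mon 0 (inverse (c [])) * mon 0 (c []) \<in> C 0" by (rule ideal_mult[OF prime_ideal[OF C0]])
  then show ?case using prime_one[OF C0] by (cases "c [] = 0") (auto simp: mult_single U)
next
  case (Cons f fs)
  have C0: "is_prime (C 0)" and C1: "is_prime (C 1)" using Cons.prems(1)[of 0] Cons.prems(1)[of 1] by auto
  have f: "C 0 \<subseteq> C 1" "f \<in> C 1" "f \<notin> C 0" using Cons.prems(2)[of 0] by auto
  show ?case
  proof (rule ccontr)
    assume cu: "c u \<noteq> 0"
    define W where "W = {u \<in> U. c u \<noteq> 0}"
    have W: "finite W" "W \<noteq> {}" "u \<in> W" using Cons.prems cu by (auto simp: W_def)
    have nonempty: "w \<noteq> []" if "w \<in> W" for w using Cons.prems(4)[of w] that by (auto simp: W_def)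
    define m where "m = Min (hd ` W)"
    have m: "m \<le> hd w" if "w \<in> W" for w using that W by (simp add: m_def)
    have "m \<in> hd ` W" unfolding m_def using W by (intro Min_in) auto
    then obtain w0 where w0: "w0 \<in> W" "hd w0 = m" by (metis imageE)
    define T where "T = (\<lambda>w. mon 0 (c w) * (f ^ (hd w - m) * prod_list (map2 (^) fs (tl w))))"
    have "(\<Sum>u\<in>U. mon 0 (c u) * prod_list (map2 (^) (f # fs) u)) = (\<Sum>w\<in>W. f ^ m * T w)"
    proof (rule sum.mono_neutral_cong_right)
      fix w assume w: "w \<in> W"
      then have "prod_list (map2 (^) (f # fs) w) = f ^ hd w * prod_list (map2 (^) fs (tl w))"
        using nonempty[OF w] by (cases w) auto
      also have "f ^ hd w = f ^ m * f ^ (hd w - m)" using m[OF w] by (simp flip: power_add)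
      finally show "mon 0 (c w) * prod_list (map2 (^) (f # fs) w) = f ^ m * T w"
        by (simp add: T_def algebra_simps)
    qed (use Cons.prems in \<open>auto simp: W_def\<close>)
    then have "f ^ m * (\<Sum>w\<in>W. T w) \<in> C 0" using Cons.prems(5) by (simp add: sum_distrib_left)
    moreover have "f ^ m \<notin> C 0" using prime_power[OF C0] f(3) by blast
    ultimately have "(\<Sum>w\<in>W. T w) \<in> C 1" using prime_mult[OF C0] f(1) by blast
    moreover have "(\<Sum>w\<in>W. T w) = (\<Sum>w\<in>{w \<in> W. hd w = m}. T w) + (\<Sum>w\<in>{w \<in> W. hd w \<noteq> m}. T w)"
      using W by (subst sum.union_disjoint[symmetric]) (auto intro!: sum.cong)
    moreover have "(\<Sum>w\<in>{w \<in> W. hd w \<noteq> m}. T w) \<in> C 1"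
    proof (rule ideal_sum[OF prime_ideal[OF C1]])
      fix w assume "w \<in> {w \<in> W. hd w \<noteq> m}"
      then have "hd w - m \<noteq> 0" using m[of w] by auto
      then obtain k where "hd w - m = Suc k" using not0_implies_Suc by blast
      then have "f ^ (hd w - m) \<in> C 1" using ideal_mult_right[OF prime_ideal[OF C1] f(2)] by simp
      then show "T w \<in> C 1"
        unfolding T_def using ideal_mult[OF prime_ideal[OF C1]] ideal_mult_right[OF prime_ideal[OF C1]] by blast
    qed
    ultimately have "(\<Sum>w\<in>{w \<in> W. hd w = m}. T w) \<in> C 1"
      by (simp add: ideal_add_cancel[OF prime_ideal[OF C1]] del: One_nat_def)
    moreover have "(\<Sum>w\<in>{w \<in> W. hd w = m}. T w) =
      (\<Sum>v\<in>tl ` {w \<in> W. hd w = m}. mon 0 (c (m # v)) * prod_list (map2 (^) fs v))"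
    proof (subst sum.reindex)
      show "inj_on tl {w \<in> W. hd w = m}"
        using nonempty by (auto intro!: inj_onI simp: list.expand)
      show "(\<Sum>w\<in>{w \<in> W. hd w = m}. T w) = sum ((\<lambda>v. mon 0 (c (m # v)) * prod_list (map2 (^) fs v)) \<circ> tl) {w \<in> W. hd w = m}"
        using nonempty by (intro sum.cong) (auto simp: T_def)
    qed
    ultimately have "(\<Sum>v\<in>tl ` {w \<in> W. hd w = m}. mon 0 (c (m # v)) * prod_list (map2 (^) fs v)) \<in> (C \<circ> Suc) 0"
      by simp
    then have "c (m # tl w0) = 0"
    proof (rule Cons.IH[where c = "\<lambda>v. c (m # v)", rotated 4])
      fix i assume "i < length fs"
      then show "(C \<circ> Suc) i \<subseteq> (C \<circ> Suc) (Suc i) \<and> fs ! i \<in> (C \<circ> Suc) (Suc i) \<and> fs ! i \<notin> (C \<circ> Suc) i"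
        using Cons.prems(2)[of "Suc i"] by auto
    qed (use Cons.prems w0 W nonempty in \<open>auto simp: W_def\<close>)
    moreover have "w0 = m # tl w0" using w0 nonempty by (metis list.collapse)
    ultimately show False using w0(1) by (simp add: W_def)
  qed
qed

text \<open>Growth: the monomials in the n witnesses with exponents at most N are (N + 1)^n
  independent elements, but they lie in a box of side linear in N, of dimension at most a constant
  times (N + 1)^s. For large N this excludes n > s.\<close>

theorem prime_chain_length:
  fixes C :: "nat \<Rightarrow> ('s::finite, 'k::field) mpoly set"
  assumes prime: "\<And>i. i \<le> n \<Longrightarrow> is_prime (C i)" and strict: "\<And>i. i < n \<Longrightarrow> C i \<subset> C (Suc i)"
  shows "n \<le> CARD('s)"
proof (rule ccontr)
  assume n: "\<not> ?thesis"
  have "\<exists>x. x \<in> C (Suc i) \<and> x \<notin> C i" if "i < n" for i using strict[OF that] by blast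
  then obtain x where x: "\<And>i. i < n \<Longrightarrow> x i \<in> C (Suc i) \<and> x i \<notin> C i" by metis
  define fs where "fs = map x [0..<n]"
  have len: "length fs = n" by (simp add: fs_def)
  define b :: "('s, 'k) mpoly \<Rightarrow> nat" where "b = (\<lambda>f. SOME M. boxed M f)"
  have b: "boxed (b f) f" for f unfolding b_def by (rule someI_ex[OF boxed_exists])
  define D where "D = Max (b ` set fs)"
  have D: "boxed D f" if "f \<in> set fs" for f
    using boxed_mono[OF b[of f]] that by (auto simp: D_def)
  \<comment> \<open>\<open>D\<close> bounds the exponents in the witnesses, so their monomials lie
    in a box of side M with M + 1 \<le> E (N + 1). The choice N = E^s reduces the final comparison
    to N < N + 1.\<close>
  define E where "E = n * D + 1"
  define N where "N = E ^ CARD('s)"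
  define U where "U = {u. set u \<subseteq> {..N} \<and> length u = n}"
  define M where "M = n * (N * D)"
  have U: "finite U" "card U = (N + 1) ^ n"
    using finite_lists_length_eq[of "{..N}" n] card_lists_length_eq[of "{..N}" n] by (auto simp: U_def)
  have "card U \<le> card ((\<lambda>e. mon e (1::'k)) ` (box M :: ('s \<Rightarrow>\<^sub>0 nat) set))"
  proof (rule mp.card_le_of_independent_family[where x = "\<lambda>u. prod_list (map2 (^) fs u)"])
    show "prod_list (map2 (^) fs u) \<in> mp.span ((\<lambda>e. mon e 1) ` box M)" if "u \<in> U" for u
      using boxed_prod_list[of fs D u N] D that len
      by (intro mpoly_in_span) (auto simp: U_def M_def)
    fix c u assume sum0: "(\<Sum>u\<in>U. mon 0 (c u) * prod_list (map2 (^) fs u)) = 0" and u: "u \<in> U"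
    show "c u = 0"
    proof (rule chain_algebraically_independent[where C = C and fs = fs and U = U])
      show "(\<Sum>u\<in>U. mon 0 (c u) * prod_list (map2 (^) fs u)) \<in> C 0"
        unfolding sum0 using prime[of 0] by (intro ideal_zero prime_ideal) auto
      show "C i \<subseteq> C (Suc i) \<and> fs ! i \<in> C (Suc i) \<and> fs ! i \<notin> C i" if "i < length fs" for i
        using that x[of i] strict[of i] by (auto simp: fs_def)
    qed (use prime len U u in \<open>auto simp: U_def\<close>)
  qed (use U box in auto)
  also have "\<dots> \<le> card (box M :: ('s \<Rightarrow>\<^sub>0 nat) set)" by (rule card_image_le[OF box(1)])
  also have "\<dots> \<le> (M + 1) ^ CARD('s)" by (rule box(2))
  also have "\<dots> \<le> (E * (N + 1)) ^ CARD('s)"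
    by (intro power_mono) (auto simp: M_def E_def algebra_simps)
  also have "\<dots> = N * (N + 1) ^ CARD('s)" by (simp only: power_mult_distrib N_def)
  also have "\<dots> < (N + 1) * (N + 1) ^ CARD('s)" by simp
  also have "\<dots> = (N + 1) ^ Suc CARD('s)" by simp
  also have "\<dots> \<le> (N + 1) ^ n" using n by (intro power_increasing) auto
  finally show False using U(2) by simp
qed

section \<open>Lattice ideals\<close>

definition evec :: "('s::finite \<Rightarrow>\<^sub>0 nat) \<Rightarrow> int ^ 's" where
  "evec e = (\<chi> i. int (ex e i))"

lemma evec_nth [simp]: "evec e $ i = int (ex e i)"
  by (simp add: evec_def)

lemma evec_add: "evec (e + e') = evec e + evec e'"
  by (simp add: vec_eq_iff lookup_add)

lemma evec_zero [simp]: "evec 0 = 0"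
  by (simp add: vec_eq_iff)

lemma lookup_pos_part [simp]: "ex (pos_part a) i = nat (a $ i)"
  by (simp add: pos_part_def)

lemma evec_pos_part: "evec (pos_part a) - evec (pos_part (- a)) = a"
  by (auto simp: vec_eq_iff)

lemma evec_diff_pos_part:
  assumes "evec e - evec e' = a"
  obtains u where "e = u + pos_part a" "e' = u + pos_part (- a)"
proof
  have a: "a $ i = int (ex e i) - int (ex e' i)" for i by (simp flip: assms)
  show "e = (e - pos_part a) + pos_part a" "e' = (e - pos_part a) + pos_part (- a)"
    by (auto simp: lookup_add lookup_minus a intro!: poly_mapping_eqI)
qed

lemma mon_mult_binomial:
  "mon u (1 :: 'k::field) * binomial_of a = mon (u + pos_part a) 1 - mon (u + pos_part (- a)) 1"
  by (simp add: binomial_of_def algebra_simps mult_single)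

definition is_lattice :: "(int ^ 's::finite) set \<Rightarrow> bool" where
  "is_lattice M \<longleftrightarrow> 0 \<in> M \<and> (\<forall>a\<in>M. \<forall>b\<in>M. a + b \<in> M) \<and> (\<forall>a\<in>M. - a \<in> M)"

context
  fixes M :: "(int ^ 's::finite) set" assumes M: "is_lattice M"
begin

lemma lattice_zero: "0 \<in> M" and lattice_add: "a \<in> M \<Longrightarrow> b \<in> M \<Longrightarrow> a + b \<in> M"
  and lattice_uminus: "a \<in> M \<Longrightarrow> - a \<in> M"
  using M by (simp_all add: is_lattice_def)

lemma lattice_diff: "a \<in> M \<Longrightarrow> b \<in> M \<Longrightarrow> a - b \<in> M"
  using lattice_add[of a "- b"] lattice_uminus by simp

lemma lattice_diff_commute: "a - b \<in> M \<longleftrightarrow> b - a \<in> M"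
  using lattice_uminus[of "a - b"] lattice_uminus[of "b - a"] by auto

lemma lattice_sum: "(\<And>x. x \<in> Y \<Longrightarrow> f x \<in> M) \<Longrightarrow> sum f Y \<in> M"
  by (induction Y rule: infinite_finite_induct) (auto intro: lattice_zero lattice_add)

lemma lattice_scale: "a \<in> M \<Longrightarrow> k *s a \<in> M"
proof -
  assume a: "a \<in> M"
  have nat: "int n *s a \<in> M" for n
  proof (induction n)
    case (Suc n)
    have "int (Suc n) *s a = a + int n *s a" by (simp add: vec_eq_iff algebra_simps)
    then show ?case using lattice_add[OF a Suc] by simp
  qed (simp add: lattice_zero)
  show ?thesis
  proof (cases "k \<ge> 0")
    case True
    then show ?thesis using nat[of "nat k"] by simp
  next
    case False
    then have "k *s a = - (int (nat (- k)) *s a)" by (simp add: vec_eq_iff)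
    then show ?thesis using lattice_uminus[OF nat] by metis
  qed
qed

end

lemma int_vec_group_simps [simp]:
  "carrier int_vec_group = UNIV" "x \<otimes>\<^bsub>int_vec_group\<^esub> y = x + y" "\<one>\<^bsub>int_vec_group\<^esub> = 0"
  by (simp_all add: int_vec_group_def)

lemma comm_group_int_vec_group: "comm_group (int_vec_group :: (int ^ 's::finite) monoid)"
proof (rule comm_groupI)
  fix x :: "int ^ 's"
  show "\<exists>y\<in>carrier int_vec_group. y \<otimes>\<^bsub>int_vec_group\<^esub> x = \<one>\<^bsub>int_vec_group\<^esub>"
    by (auto intro: exI[of _ "- x"])
qed (auto simp: algebra_simps)

lemma inv_int_vec_group [simp]: "inv\<^bsub>int_vec_group\<^esub> (x :: int ^ 's::finite) = - x"
proof -
  interpret comm_group "int_vec_group :: (int ^ 's) monoid" by (rule comm_group_int_vec_group)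
  show ?thesis by (rule inv_equality) auto
qed

lemma lattice_column_lattice: "is_lattice (column_lattice L)"
  and column_in_lattice: "column j L \<in> column_lattice L"
  and column_lattice_least: "is_lattice M \<Longrightarrow> (\<And>j. column j L \<in> M) \<Longrightarrow> column_lattice L \<subseteq> M"
proof -
  let ?G = "int_vec_group :: (int ^ 's::finite) monoid"
  interpret comm_group ?G by (rule comm_group_int_vec_group)
  have sg: "subgroup (column_lattice L) ?G"
    unfolding column_lattice_def by (rule generate_is_subgroup) auto
  show "is_lattice (column_lattice L)"
    using subgroup.one_closed[OF sg] subgroup.m_closed[OF sg] subgroup.m_inv_closed[OF sg]
    by (auto simp: is_lattice_def)
  show "column j L \<in> column_lattice L"
    unfolding column_lattice_def by (rule generate.incl) auto
  assume M: "is_lattice M" "\<And>j. column j L \<in> M"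
  show "column_lattice L \<subseteq> M"
  proof
    fix x assume "x \<in> column_lattice L"
    then show "x \<in> M" unfolding column_lattice_def
      by (induction rule: generate.induct)
         (use M in \<open>auto intro: lattice_zero lattice_uminus lattice_add\<close>)
  qed
qed

section \<open>Membership in a lattice ideal by coefficient sums over congruence classes\<close>

definition csum :: "('s \<Rightarrow>\<^sub>0 nat) set \<Rightarrow> ('s, 'k::field) mpoly \<Rightarrow> 'k" where
  "csum C f = (\<Sum>e\<in>Poly_Mapping.keys f. if e \<in> C then cf f e else 0)"

lemma csum_add: "csum C (f + g) = csum C f + csum C g"
  unfolding csum_def by (rule setsum_keys_plus_distrib) auto

lemma csum_mon: "csum C (mon e c) = (if e \<in> C then c else 0)"
  by (simp add: csum_def)

lemma csum_zero [simp]: "csum C 0 = 0"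
  by (simp add: csum_def)

lemma csum_diff: "csum C (f - g) = csum C f - csum C g"
  using csum_add[of C "f - g" g] by simp

lemma csum_mon_mult: "csum C (mon u c * f) = c * csum {e. u + e \<in> C} f"
  by (induction f rule: mpoly_induct) (auto simp: csum_mon mult_single csum_add algebra_simps)

lemma csum_empty [simp]: "csum {} f = 0"
  by (simp add: csum_def)

definition lclass :: "(int ^ 's::finite) set \<Rightarrow> ('s \<Rightarrow>\<^sub>0 nat) \<Rightarrow> ('s \<Rightarrow>\<^sub>0 nat) set" where
  "lclass M e0 = {e. evec e - evec e0 \<in> M}"

context
  fixes M :: "(int ^ 's::finite) set" assumes M: "is_lattice M"
begin

lemma lclass_refl: "e \<in> lclass M e"
  by (simp add: lclass_def lattice_zero[OF M])

lemma lclass_eq: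
  assumes "e \<in> lclass M e0" shows "lclass M e = lclass M e0"
proof -
  have "evec x - evec e \<in> M \<longleftrightarrow> evec x - evec e0 \<in> M" for x
    using assms lattice_add[OF M, of "evec x - evec e" "evec e - evec e0"]
      lattice_diff[OF M, of "evec x - evec e0" "evec e - evec e0"]
    by (auto simp: lclass_def)
  then show ?thesis by (simp add: lclass_def)
qed

lemma lclass_mem_iff: "e \<in> lclass M e0 \<longleftrightarrow> lclass M e = lclass M e0"
  using lclass_eq lclass_refl by blast

lemma lclass_shift: "{e. u + e \<in> lclass M (u + e0)} = lclass M e0"
  by (simp add: lclass_def evec_add)

lemma binomial_mem_lattice_ideal:
  assumes "evec e - evec e' \<in> M"
  shows "mon e (1 :: 'k::field) - mon e' 1 \<in> lattice_ideal M"
proof -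
  obtain u where u: "e = u + pos_part (evec e - evec e')" "e' = u + pos_part (- (evec e - evec e'))"
    by (rule evec_diff_pos_part[OF refl])
  have "binomial_of (evec e - evec e') \<in> (lattice_ideal M :: ('s, 'k) mpoly set)"
    unfolding lattice_ideal_def by (rule subsetD[OF genideal_superset imageI[OF assms]])
  then have "mon u 1 * binomial_of (evec e - evec e') \<in> (lattice_ideal M :: ('s, 'k) mpoly set)"
    unfolding lattice_ideal_def by (rule ideal_mult[OF ideal_genideal])
  then show ?thesis unfolding mon_mult_binomial by (simp only: u[symmetric])
qed

text \<open>Multiplication by a monomial pulls a congruence class back to a congruence class or to
  the empty set.\<close>

lemma ideal_csum_zero: "is_ideal {f :: ('s, 'k::field) mpoly. \<forall>e0. csum (lclass M e0) f = 0}"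
proof (rule is_idealI)
  fix r f :: "('s, 'k) mpoly" assume f: "f \<in> {f. \<forall>e0. csum (lclass M e0) f = 0}"
  have "\<forall>e0. csum (lclass M e0) (r * f) = 0"
  proof (induction r rule: mpoly_induct)
    case (monomial u c)
    have "csum {e. u + e \<in> lclass M e0} f = 0" for e0
    proof (cases "\<exists>e1. u + e1 \<in> lclass M e0")
      case True
      then obtain e1 where "lclass M (u + e1) = lclass M e0" using lclass_eq by blast
      then have "{e. u + e \<in> lclass M e0} = lclass M e1" by (simp flip: lclass_shift[of u e1])
      then show ?thesis using f by simp
    qed simp
    then show ?case by (simp add: csum_mon_mult)
  qed (simp add: distrib_right csum_add)
  then show "r * f \<in> {f. \<forall>e0. csum (lclass M e0) f = 0}" by simp
qed (auto simp: csum_add)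

text \<open>The choice is made from the class as a set, so congruent exponents get the same
  representative.\<close>

definition lrep :: "('s \<Rightarrow>\<^sub>0 nat) \<Rightarrow> 's \<Rightarrow>\<^sub>0 nat" where
  "lrep e = (SOME e'. e' \<in> lclass M e)"

lemma lrep_mem: "lrep e \<in> lclass M e"
  unfolding lrep_def by (rule someI[of _ e]) (rule lclass_refl)

lemma lrep_eq_iff: "lrep e = lrep e' \<longleftrightarrow> e \<in> lclass M e'"
proof
  assume "lrep e = lrep e'"
  then show "e \<in> lclass M e'"
    using lclass_eq[OF lrep_mem[of e]] lclass_eq[OF lrep_mem[of e']] by (auto simp: lclass_mem_iff)
next
  assume "e \<in> lclass M e'"
  then show "lrep e = lrep e'" unfolding lrep_def by (simp only: lclass_eq)
qed

lemma diff_lrep_mem_lattice_ideal: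
  fixes f :: "('s, 'k::field) mpoly"
  shows "f - (\<Sum>e\<in>Poly_Mapping.keys f. mon (lrep e) (cf f e)) \<in> lattice_ideal M"
proof -
  have iJ: "is_ideal (lattice_ideal M :: ('s, 'k) mpoly set)"
    unfolding lattice_ideal_def by (rule ideal_genideal)
  let ?K = "Poly_Mapping.keys f"
  have "f - (\<Sum>e\<in>?K. mon (lrep e) (cf f e)) = (\<Sum>e\<in>?K. mon e (cf f e)) - (\<Sum>e\<in>?K. mon (lrep e) (cf f e))"
    by (simp flip: mpoly_expand)
  also have "\<dots> = (\<Sum>e\<in>?K. mon 0 (cf f e) * (mon e 1 - mon (lrep e) 1))"
    by (simp add: algebra_simps mult_single sum_subtractf)
  also have "\<dots> \<in> lattice_ideal M"
  proof (intro ideal_sum[OF iJ] ideal_mult[OF iJ] binomial_mem_lattice_ideal)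
    fix e
    show "evec e - evec (lrep e) \<in> M"
      using lrep_mem[of e] lattice_diff_commute[OF M] by (simp add: lclass_def)
  qed
  finally show ?thesis .
qed

text \<open>Moving every monomial to the representative of its class changes \<open>f\<close> only
  by an element of the lattice ideal, and leaves the class sums as coefficients.\<close>

lemma lattice_ideal_iff:
  "f \<in> lattice_ideal M \<longleftrightarrow> (\<forall>e0. csum (lclass M e0) (f :: ('s, 'k::field) mpoly) = 0)"
proof
  have "binomial_of ` M \<subseteq> {f :: ('s, 'k) mpoly. \<forall>e0. csum (lclass M e0) f = 0}"
  proof (intro subsetI CollectI allI)
    fix f :: "('s, 'k) mpoly" and e0 assume "f \<in> binomial_of ` M"
    then obtain a where a: "a \<in> M" "f = binomial_of a" by auto
    have "pos_part a \<in> lclass M (pos_part (- a))" using a by (simp add: lclass_def evec_pos_part)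
    then have "lclass M (pos_part a) = lclass M (pos_part (- a))" by (rule lclass_eq)
    then have "pos_part a \<in> lclass M e0 \<longleftrightarrow> pos_part (- a) \<in> lclass M e0"
      by (simp add: lclass_mem_iff)
    then show "csum (lclass M e0) f = 0" by (simp add: a binomial_of_def csum_diff csum_mon)
  qed
  then show "f \<in> lattice_ideal M \<Longrightarrow> \<forall>e0. csum (lclass M e0) f = 0"
    unfolding lattice_ideal_def using genideal_least[OF ideal_csum_zero] by blast
next
  assume f: "\<forall>e0. csum (lclass M e0) f = 0"
  let ?K = "Poly_Mapping.keys f"
  have "(\<Sum>e\<in>?K. mon (lrep e) (cf f e)) = 0"
  proof (rule poly_mapping_eqI)
    fix r
    have "cf (\<Sum>e\<in>?K. mon (lrep e) (cf f e)) r = (\<Sum>e\<in>?K. if lrep e = r then cf f e else 0)"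
      by (simp add: lookup_sum lookup_single when_def)
    also have "\<dots> = 0"
    proof (cases "\<exists>e1. r = lrep e1")
      case True
      then obtain e1 where r: "r = lrep e1" ..
      have "(\<Sum>e\<in>?K. if lrep e = r then cf f e else 0) = csum (lclass M e1) f"
        unfolding csum_def r by (simp add: lrep_eq_iff)
      then show ?thesis using f by simp
    next
      case False
      then show ?thesis by (intro sum.neutral) auto
    qed
    finally show "cf (\<Sum>e\<in>?K. mon (lrep e) (cf f e)) r = cf 0 r" by simp
  qed
  then show "f \<in> lattice_ideal M" using diff_lrep_mem_lattice_ideal[of f] by simp
qed

lemma lattice_ideal_cancel_mon:
  assumes "mon u (1 :: 'k::field) * f \<in> lattice_ideal M" shows "f \<in> lattice_ideal M"
  unfolding lattice_ideal_iff
proof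
  fix e0
  have "csum (lclass M (u + e0)) (mon u 1 * f) = 0" using assms by (simp add: lattice_ideal_iff)
  then show "csum (lclass M e0) f = 0" by (simp add: csum_mon_mult lclass_shift)
qed

end

section \<open>Monomials, powers of the product of the variables, and saturation\<close>

lemma var_power: "var i ^ n = mon (Poly_Mapping.single i n) (1 :: 'k::field)"
  by (induction n) (auto simp: var_def mult_single simp flip: single_add)

lemma mon_eq_prod: "mon u (1 :: 'k::field) = (\<Prod>i\<in>UNIV. var i ^ ex u i)"
  for u :: "'s::finite \<Rightarrow>\<^sub>0 nat"
proof -
  have "(\<Prod>i\<in>A. mon (Poly_Mapping.single i (ex u i)) (1 :: 'k)) =
    mon (\<Sum>i\<in>A. Poly_Mapping.single i (ex u i)) 1" if "finite A" for A :: "'s set"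
    using that by (induction A rule: finite_induct) (auto simp: mult_single)
  moreover have "(\<Sum>i\<in>UNIV. Poly_Mapping.single i (ex u i)) = u"
    by (rule poly_mapping_eqI) (simp add: lookup_sum lookup_single when_def)
  ultimately show ?thesis by (simp add: var_power)
qed

lemma vars_prod_power_mon:
  obtains u where "(vars_prod :: ('s::finite, 'k::field) mpoly) ^ k = mon u 1"
proof
  show "(vars_prod :: ('s::finite, 'k::field) mpoly) ^ k = mon (pos_part (\<chi> i. int k)) 1"
    by (simp add: mon_eq_prod vars_prod_def prod_power_distrib)
qed

lemma mon_dvd_vars_prod_power:
  "\<exists>k w. (vars_prod :: ('s::finite, 'k::field) mpoly) ^ k = w * mon u 1"
proof -
  obtain k where k: "\<And>i. ex u i \<le> k"
    using finite_nat_set_iff_bounded_le[of "Set.range (ex u)"] by auto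
  have "(vars_prod :: ('s, 'k) mpoly) ^ k = (\<Prod>i\<in>UNIV. var i ^ (k - ex u i)) * mon u 1"
  proof -
    have "var i ^ k = var i ^ (k - ex u i) * (var i :: ('s, 'k) mpoly) ^ ex u i" for i
      using k[of i] by (simp flip: power_add)
    then have "(\<Prod>i\<in>UNIV. (var i :: ('s, 'k) mpoly) ^ k) =
        (\<Prod>i\<in>UNIV. var i ^ (k - ex u i)) * (\<Prod>i\<in>UNIV. var i ^ ex u i)"
      by (simp only: prod.distrib)
    then show ?thesis by (simp only: mon_eq_prod vars_prod_def prod_power_distrib)
  qed
  then show ?thesis by blast
qed

lemma ideal_matrix_ideal: "is_ideal (matrix_ideal L)"
  and binomial_column_mem: "binomial_of (column j L) \<in> matrix_ideal L"
  and matrix_ideal_least: "is_ideal A \<Longrightarrow> (\<And>j. binomial_of (column j L) \<in> A) \<Longrightarrow> matrix_ideal L \<subseteq> A"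
proof -
  show "is_ideal (matrix_ideal L)" unfolding matrix_ideal_def by (rule ideal_genideal)
  show "binomial_of (column j L) \<in> matrix_ideal L"
    unfolding matrix_ideal_def by (rule subsetD[OF genideal_superset rangeI])
  assume A: "is_ideal A" "\<And>j. binomial_of (column j L) \<in> A"
  have "Set.range (\<lambda>j. binomial_of (column j L)) \<subseteq> A" using A(2) by auto
  with A(1) show "matrix_ideal L \<subseteq> A" unfolding matrix_ideal_def by (rule genideal_least)
qed

text \<open>The differences e - e' for which t^e - t^e' is in \<open>I\<close> form a lattice, and
  it contains the columns. So each binomial of the lattice enters \<open>I\<close> after
  multiplication by a monomial. Conversely, monomials can be cancelled modulo the lattice
  ideal.\<close>

theorem lattice_ideal_eq_saturation:
  "lattice_ideal (column_lattice L) =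
   saturation ring_of_type_algebra (matrix_ideal L) (vars_prod :: ('s::finite, 'k::field) mpoly)"
  (is "?J = ?S")
proof
  let ?I = "matrix_ideal L :: ('s, 'k) mpoly set"
  note lat = lattice_column_lattice[of L] and iI = ideal_matrix_ideal[of L, where ?'b = 'k]
  define R where "R = {a. \<exists>e e'. evec e - evec e' = a \<and> mon e 1 - mon e' 1 \<in> ?I}"
  have "is_lattice R"
    unfolding is_lattice_def
  proof (intro conjI ballI)
    show "0 \<in> R" using ideal_zero[OF iI] by (auto simp: R_def intro!: exI[of _ 0])
  next
    fix a b assume "a \<in> R" "b \<in> R"
    then obtain e e' f f' where e: "evec e - evec e' = a" "mon e 1 - mon e' 1 \<in> ?I"
      and f: "evec f - evec f' = b" "mon f 1 - mon f' 1 \<in> ?I" unfolding R_def by blast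
    \<comment> \<open>This multiplies the congruences of t^e with t^e' and of t^f with t^f' modulo
      \<open>I\<close>.\<close>
    have "mon f 1 * (mon e 1 - mon e' 1) + mon e' 1 * (mon f 1 - mon f' 1) \<in> ?I"
      using e f ideal_add[OF iI] ideal_mult[OF iI] by blast
    then have "mon (e + f) 1 - mon (e' + f') 1 \<in> ?I" by (simp add: algebra_simps mult_single)
    moreover have "evec (e + f) - evec (e' + f') = a + b" using e f by (auto simp: evec_add)
    ultimately show "a + b \<in> R" unfolding R_def by blast
  next
    fix a assume "a \<in> R"
    then obtain e e' where e: "evec e - evec e' = a" "mon e 1 - mon e' 1 \<in> ?I" unfolding R_def by blast
    then have "evec e' - evec e = - a" "mon e' 1 - mon e 1 \<in> ?I"
      using ideal_uminus[OF iI e(2)] by auto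
    then show "- a \<in> R" unfolding R_def by blast
  qed
  moreover have "column j L \<in> R" for j
    unfolding R_def using evec_pos_part[of "column j L"] binomial_column_mem[of j L]
    by (auto simp: binomial_of_def)
  ultimately have sub: "column_lattice L \<subseteq> R" by (rule column_lattice_least)
  have "binomial_of ` column_lattice L \<subseteq> ?S"
  proof
    fix g :: "('s, 'k) mpoly" assume "g \<in> binomial_of ` column_lattice L"
    then obtain a where a: "a \<in> column_lattice L" "g = binomial_of a" by auto
    then obtain e e' where e: "evec e - evec e' = a" "mon e 1 - mon e' 1 \<in> ?I"
      using sub unfolding R_def by blast
    obtain u where "e = u + pos_part a" "e' = u + pos_part (- a)"
      by (rule evec_diff_pos_part[OF e(1)])
    then have "mon u 1 * g \<in> ?I" using e unfolding a mon_mult_binomial by simp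
    moreover obtain k w where kw: "(vars_prod :: ('s, 'k) mpoly) ^ k = w * mon u 1"
      using mon_dvd_vars_prod_power by blast
    ultimately have "(vars_prod * w) * (mon u 1 * g) \<in> ?I" using ideal_mult[OF iI] by blast
    also have "(vars_prod * w) * (mon u 1 * g) = g * vars_prod ^ Suc k" by (simp add: kw mult_ac)
    finally have "g * vars_prod ^ Suc k \<in> ?I" .
    then show "g \<in> ?S" unfolding saturation_iff by (intro exI[of _ "Suc k"]) auto
  qed
  then show "?J \<subseteq> ?S" unfolding lattice_ideal_def by (intro genideal_least ideal_saturation[OF iI])
  show "?S \<subseteq> ?J"
  proof
    have IJ: "?I \<subseteq> ?J"
    proof (rule matrix_ideal_least)
      show "binomial_of (column j L) \<in> ?J" for j
        unfolding lattice_ideal_def by (rule subsetD[OF genideal_superset imageI[OF column_in_lattice]])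
    qed (simp add: lattice_ideal_def ideal_genideal)
    fix f assume "f \<in> ?S"
    then obtain k where k: "f * vars_prod ^ k \<in> ?I" by (auto simp: saturation_iff)
    obtain u where "(vars_prod :: ('s, 'k) mpoly) ^ k = mon u 1" by (rule vars_prod_power_mon)
    then have "mon u 1 * f \<in> ?J" using k IJ by (auto simp: mult.commute)
    then show "f \<in> ?J" by (rule lattice_ideal_cancel_mon[OF lat])
  qed
qed

section \<open>Heights of primes\<close>

text \<open>Evaluation at the origin reads off the constant coefficient, so the right-hand side is a
  kernel.\<close>

lemma max_ideal_eq: "(max_ideal :: ('s::finite, 'k::field) mpoly set) = {f. cf f 0 = 0}"
proof
  have z: "poly_subst id (\<lambda>_. 0) f = cf f 0" for f :: "('s, 'k) mpoly"
  proof (induction f rule: mpoly_induct)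
    case (monomial e c)
    have "(\<Prod>i\<in>UNIV. (0 :: 'k) ^ ex e i) = (if e = 0 then 1 else 0)"
    proof (cases "e = 0")
      case False
      then obtain i where "ex e i \<noteq> 0" by (metis lookup_zero poly_mapping_eqI)
      then have "(\<Prod>i\<in>UNIV. (0 :: 'k) ^ ex e i) = 0" by (intro prod_zero) (auto intro: exI[of _ i])
      then show ?thesis using False by simp
    qed simp
    then show ?case unfolding eval.poly_subst_mon by (simp add: lookup_single when_def)
  qed (simp only: eval.poly_subst_add lookup_add)
  have "is_ideal {f :: ('s, 'k) mpoly. cf f 0 = 0}"
    using eval.ideal_kernel[of "\<lambda>_ :: 's. 0 :: 'k"] by (simp only: z)
  moreover have "Set.range var \<subseteq> {f :: ('s, 'k) mpoly. cf f 0 = 0}"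
  proof (intro image_subsetI CollectI)
    fix i :: 's
    have "Poly_Mapping.single i (1 :: nat) \<noteq> 0" by (metis lookup_single_eq lookup_zero zero_neq_one)
    then show "cf (var i :: ('s, 'k) mpoly) 0 = 0" by (simp add: var_def lookup_single when_def)
  qed
  ultimately show "(max_ideal :: ('s, 'k) mpoly set) \<subseteq> {f. cf f 0 = 0}"
    unfolding max_ideal_def by (rule genideal_least)
next
  have i: "is_ideal (max_ideal :: ('s, 'k) mpoly set)" unfolding max_ideal_def by (rule ideal_genideal)
  have v: "var i \<in> (max_ideal :: ('s, 'k) mpoly set)" for i
    unfolding max_ideal_def by (rule subsetD[OF genideal_superset rangeI])
  show "{f. cf f 0 = 0} \<subseteq> (max_ideal :: ('s, 'k) mpoly set)"
  proof
    fix f :: "('s, 'k) mpoly" assume f: "f \<in> {f. cf f 0 = 0}"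
    have "(\<Sum>e\<in>Poly_Mapping.keys f. mon e (cf f e)) \<in> max_ideal"
    proof (rule ideal_sum[OF i])
      fix e assume "e \<in> Poly_Mapping.keys f"
      then have "e \<noteq> 0" using f by (auto simp: in_keys_iff)
      then obtain x where x: "ex e x \<noteq> 0" by (metis lookup_zero poly_mapping_eqI)
      have "e = Poly_Mapping.single x 1 + (e - Poly_Mapping.single x 1)"
        by (rule poly_mapping_eqI) (use x in \<open>auto simp: lookup_add lookup_minus lookup_single when_def\<close>)
      then have "mon e (cf f e) = mon (e - Poly_Mapping.single x 1) (cf f e) * var x"
        by (simp add: var_def mult_single add.commute)
      then show "mon e (cf f e) \<in> max_ideal" using ideal_mult[OF i v] by simp
    qed
    then show "f \<in> max_ideal" by (simp flip: mpoly_expand)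
  qed
qed

lemma prime_max_ideal: "is_prime (max_ideal :: ('s::finite, 'k::field) mpoly set)"
proof -
  have "cf (1 :: ('s, 'k) mpoly) 0 = 1" by simp
  have c: "cf (f * g) 0 = cf f 0 * cf g 0" for f g :: "('s, 'k) mpoly"
  proof (induction f rule: mpoly_induct)
    case (monomial e c)
    show ?case
    proof (induction g rule: mpoly_induct)
      case (monomial e' c')
      have "e + e' = 0 \<longleftrightarrow> e = 0 \<and> e' = 0"
        by (auto simp: poly_mapping_eq_iff lookup_add fun_eq_iff)
      then show ?case by (auto simp: mult_single lookup_single when_def)
    qed (simp add: lookup_add distrib_left)
  qed (simp add: lookup_add distrib_right)
  have "is_ideal (max_ideal :: ('s, 'k) mpoly set)" unfolding max_ideal_def by (rule ideal_genideal)
  then show ?thesis unfolding is_prime_iff by (auto simp: max_ideal_eq c)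
qed

lemma maximal_max_ideal:
  fixes A :: "('s::finite, 'k::field) mpoly set"
  assumes A: "is_ideal A" "max_ideal \<subseteq> A" shows "A = max_ideal \<or> 1 \<in> A"
proof (rule disjCI)
  assume "1 \<notin> A"
  have "f \<in> max_ideal" if f: "f \<in> A" for f
  proof (rule ccontr)
    assume "f \<notin> max_ideal"
    then have c: "cf f 0 \<noteq> 0" by (simp add: max_ideal_eq)
    have "f - mon 0 (cf f 0) \<in> A" using A(2) by (auto simp: max_ideal_eq lookup_minus)
    with f have "f - (f - mon 0 (cf f 0)) \<in> A" by (rule ideal_diff[OF A(1)])
    then have "mon 0 (inverse (cf f 0)) * mon 0 (cf f 0) \<in> A" by (intro ideal_mult[OF A(1)]) simp
    then show False using c \<open>1 \<notin> A\<close> by (simp add: mult_single)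
  qed
  then show "A = max_ideal" using A(2) by auto
qed

lemma prime_mon_iff:
  fixes e :: "'s::finite \<Rightarrow>\<^sub>0 nat"
  assumes "is_prime P"
  shows "mon e (1 :: 'k::field) \<in> P \<longleftrightarrow> (\<exists>i. ex e i \<noteq> 0 \<and> var i \<in> P)"
proof -
  have "(var i :: ('s, 'k) mpoly) ^ n \<in> P \<longleftrightarrow> n \<noteq> 0 \<and> var i \<in> P" for i n
    using prime_power[OF assms, of "var i" n] prime_one[OF assms]
    by (cases n) (simp_all add: prime_mult_iff[OF assms], blast)
  then show ?thesis unfolding mon_eq_prod by (simp add: prime_prod_iff[OF assms])
qed

lemma vars_prod_prime_iff:
  assumes "is_prime P"
  shows "vars_prod \<in> P \<longleftrightarrow> (\<exists>i. var i \<in> P)"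
  unfolding vars_prod_def using prime_prod_iff[OF assms, of UNIV var] by simp

text \<open>In contrast to the chains of \<open>prime_height\<close> the bottom is recorded too, so
  that a chain can be prolonged at either end.\<close>

definition prime_chain :: "nat \<Rightarrow> ('a::comm_ring_1 set) \<Rightarrow> 'a set \<Rightarrow> bool" where
  "prime_chain n Q P \<longleftrightarrow> (\<exists>C. (\<forall>i\<le>n. is_prime (C i)) \<and> (\<forall>i<n. C i \<subset> C (Suc i)) \<and> C 0 = Q \<and> C n = P)"

lemma prime_chain_bottom:
  assumes "prime_chain n Q P" "is_prime Q'" "Q' \<subset> Q"
  shows "prime_chain (Suc n) Q' P"
proof -
  obtain C where C: "\<forall>i\<le>n. is_prime (C i)" "\<forall>i<n. C i \<subset> C (Suc i)" "C 0 = Q" "C n = P"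
    using assms(1) unfolding prime_chain_def by blast
  show ?thesis unfolding prime_chain_def
    by (rule exI[of _ "case_nat Q' C"]) (use C assms in \<open>auto split: nat.splits\<close>)
qed

lemma prime_chain_top:
  assumes "prime_chain n Q P" "is_prime P'" "P \<subset> P'"
  shows "prime_chain (Suc n) Q P'"
proof -
  obtain C where C: "\<forall>i\<le>n. is_prime (C i)" "\<forall>i<n. C i \<subset> C (Suc i)" "C 0 = Q" "C n = P"
    using assms(1) unfolding prime_chain_def by blast
  have "(\<forall>i\<le>Suc n. is_prime ((C(Suc n := P')) i)) \<and>
    (\<forall>i<Suc n. (C(Suc n := P')) i \<subset> (C(Suc n := P')) (Suc i)) \<and>
    (C(Suc n := P')) 0 = Q \<and> (C(Suc n := P')) (Suc n) = P'"
    using C assms by (auto simp: le_Suc_eq less_Suc_eq)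
  then show ?thesis unfolding prime_chain_def by blast
qed

lemma prime_height_eq_Sup:
  "prime_height ring_of_type_algebra P = Sup {enat n | n. \<exists>Q. prime_chain n Q P}"
  unfolding prime_height_def prime_chain_def by (rule arg_cong[where f = Sup]) auto

lemma prime_height_ge: "prime_chain n Q P \<Longrightarrow> enat n \<le> prime_height ring_of_type_algebra P"
  unfolding prime_height_eq_Sup by (rule Sup_upper) auto

lemma prime_height_le:
  "(\<And>k Q. prime_chain k Q P \<Longrightarrow> k \<le> n) \<Longrightarrow> prime_height ring_of_type_algebra P \<le> enat n"
  unfolding prime_height_eq_Sup by (rule Sup_least) auto

lemma prime_chain_le_card:
  "prime_chain n Q (P :: ('s::finite, 'k::field) mpoly set) \<Longrightarrow> n \<le> CARD('s)"
  unfolding prime_chain_def using prime_chain_length by blast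

text \<open>Refining the grading by one variable at a time produces a descending chain of primes: the
  binomial relating that variable to the variable \<open>i0\<close> is lost at exactly that step.\<close>

lemma long_prime_chain:
  fixes P :: "('s::finite, 'k::field) mpoly set"
  assumes P: "is_prime P" "\<And>i. var i \<notin> P"
    and rel: "\<And>i. i \<noteq> i0 \<Longrightarrow> \<exists>a b. b > 0 \<and> mon (Poly_Mapping.single i0 a) 1 - mon (Poly_Mapping.single i b) 1 \<in> P"
  shows "\<exists>Q. prime_chain (CARD('s) - 1) Q P"
proof -
  have "\<exists>a b. \<forall>i. i \<noteq> i0 \<longrightarrow> b i > 0 \<and> mon (Poly_Mapping.single i0 (a i)) 1 - mon (Poly_Mapping.single i (b i)) 1 \<in> P"
    using rel by metis
  then obtain a b where ab: "\<And>i. i \<noteq> i0 \<Longrightarrow> b i > 0 \<and>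
      mon (Poly_Mapping.single i0 (a i)) 1 - mon (Poly_Mapping.single i (b i)) 1 \<in> P" by blast
  let ?r = "\<lambda>i. mon (Poly_Mapping.single i0 (a i)) 1 - mon (Poly_Mapping.single i (b i)) 1 :: ('s, 'k) mpoly"
  have pw: "mon (Poly_Mapping.single i n) 1 \<notin> Q" if "is_prime Q" "Q \<subseteq> P" for i n Q
    using P(2) that by (simp only: var_power[symmetric]) (blast dest: prime_power)
  have "\<exists>Q. prime_chain (card A) Q P \<and> Q \<subseteq> P \<and> (\<forall>i. i \<noteq> i0 \<longrightarrow> i \<notin> A \<longrightarrow> ?r i \<in> Q)"
    if "finite A" "i0 \<notin> A" for A
    using that
  proof (induction A rule: finite_induct)
    case empty
    have "prime_chain 0 P P" unfolding prime_chain_def by (rule exI[of _ "\<lambda>_. P"]) (use P in auto)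
    then show ?case using ab by auto
  next
    case (insert k A)
    then obtain Q where Q: "prime_chain (card A) Q P" "Q \<subseteq> P" "\<And>i. i \<noteq> i0 \<Longrightarrow> i \<notin> A \<Longrightarrow> ?r i \<in> Q"
      by auto
    then have pQ: "is_prime Q" by (auto simp: prime_chain_def)
    \<comment> \<open>Grading by the degree in the variable \<open>k\<close> alone: the binomial of
      \<open>k\<close> splits, with a bare power of that variable as one component, while the
      binomials of the variables outside \<open>insert k A\<close> are homogeneous of degree
      0.\<close>
    define \<delta> where "\<delta> = (\<lambda>i. if i = k then 1 else 0 :: nat)"
    have wt: "wt \<delta> e = ex e k" for e
    proof -
      have "wt \<delta> e = (\<Sum>i\<in>UNIV. if i = k then ex e i else 0)"
        unfolding wt_def \<delta>_def by (rule sum.cong) auto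
      then show ?thesis by simp
    qed
    have k0: "k \<noteq> i0" using insert by auto
    have sub: "star \<delta> Q \<subseteq> Q" by (rule star_subset[OF prime_ideal[OF pQ]])
    have "?r k \<notin> star \<delta> Q"
    proof
      assume "?r k \<in> star \<delta> Q"
      then have "hc \<delta> (b k) (?r k) \<in> Q" by (simp add: star_def)
      moreover have "hc \<delta> (b k) (?r k) = - mon (Poly_Mapping.single k (b k)) 1"
        using k0 ab[of k] by (simp add: hc_diff hc_mon wt lookup_single)
      ultimately have "mon (Poly_Mapping.single k (b k)) 1 \<in> Q"
        using ideal_uminus[OF prime_ideal[OF pQ]] by fastforce
      then show False using pw[OF pQ Q(2)] by blast
    qed
    moreover have "?r k \<in> Q" using Q(3)[of k] insert k0 by auto
    ultimately have "prime_chain (Suc (card A)) (star \<delta> Q) P"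
      using sub by (intro prime_chain_bottom[OF Q(1)] prime_star pQ) auto
    moreover have "?r i \<in> star \<delta> Q" if "i \<noteq> i0" "i \<notin> insert k A" for i
      using Q(3)[of i] that k0 ideal_zero[OF prime_ideal[OF pQ]]
      by (auto simp: star_def hc_diff hc_mon wt lookup_single)
    ultimately show ?case using insert sub Q(2) by (intro exI[of _ "star \<delta> Q"]) auto
  qed
  from this[of "UNIV - {i0}"] show ?thesis by (auto simp: card_Diff_singleton)
qed

section \<open>Graded matrix ideals\<close>

definition dotp :: "('s::finite \<Rightarrow> rat) \<Rightarrow> int ^ 's \<Rightarrow> rat" where
  "dotp w a = (\<Sum>i\<in>UNIV. w i * of_int (a $ i))"

lemma dotp_zero [simp]: "dotp w 0 = 0"
  by (simp add: dotp_def)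

lemma dotp_add: "dotp w (a + b) = dotp w a + dotp w b"
  by (simp add: dotp_def distrib_left sum.distrib)

lemma dotp_uminus: "dotp w (- a) = - dotp w a"
  by (simp add: dotp_def sum_negf)

lemma dotp_diff: "dotp w (a - b) = dotp w a - dotp w b"
  using dotp_add[of w a "- b"] by (simp add: dotp_uminus)

lemma dotp_scale: "dotp w (k *s a) = of_int k * dotp w a"
  by (simp add: dotp_def sum_distrib_left mult.left_commute)

lemma dotp_pos_part: "dotp w a = dotp w (evec (pos_part a)) - dotp w (evec (pos_part (- a)))"
  by (simp only: dotp_diff[symmetric] evec_pos_part)

lemma dotp_evec_wt: "dotp (\<lambda>i. of_nat (d i)) (evec e) = of_nat (wt d e)"
  by (simp add: dotp_def wt_def)

lemma eval_mon_one: "poly_subst id (\<lambda>_ :: 's::finite. 1 :: 'k::field) (mon e c) = c"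
  unfolding eval.poly_subst_mon by simp

lemma eval_binomial: "poly_subst id x (binomial_of a :: ('s::finite, 'k::field) mpoly) =
  (\<Prod>i\<in>UNIV. x i ^ ex (pos_part a) i) - (\<Prod>i\<in>UNIV. x i ^ ex (pos_part (- a)) i)"
  unfolding binomial_of_def eval.poly_subst_diff eval.poly_subst_mon by simp

lemma matrix_ideal_eval_zero:
  assumes "\<And>j. poly_subst id x (binomial_of (column j L)) = 0" "f \<in> matrix_ideal L"
  shows "poly_subst id x f = 0"
proof -
  have "matrix_ideal L \<subseteq> {f. poly_subst id x f = 0}"
    by (rule matrix_ideal_least[OF eval.ideal_kernel]) (simp add: assms(1)[unfolded id_def] id_def)
  then show ?thesis using assms(2) by blast
qed

locale graded_matrix_ideal =
  fixes L :: "int ^ 'm::finite ^ 's::finite" and I :: "('s, 'k::field) mpoly set" and d :: "'s \<Rightarrow> nat"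
  assumes I_eq: "I = matrix_ideal L" and d_pos: "\<And>i. d i > 0" and homog: "homog_by d I"
    and zeros: "\<And>i. zero_set (Idl\<^bsub>ring_of_type_algebra\<^esub> (I \<union> {var i})) = {0}"
begin

abbreviation \<Lambda> :: "(int ^ 's) set" where "\<Lambda> \<equiv> column_lattice L"

abbreviation dd :: "'s \<Rightarrow> rat" where "dd \<equiv> \<lambda>i. of_nat (d i)"

text \<open>The name anticipates \<open>Sat_multiple\<close>: these are the vectors with a positive
  multiple in \<open>\<Lambda>\<close>.\<close>

definition Sat :: "(int ^ 's) set" where "Sat = {a. dotp dd a = 0}"

lemma ideal_I: "is_ideal I"
  unfolding I_eq by (rule ideal_matrix_ideal)

lemma I_eval_one: "f \<in> I \<Longrightarrow> poly_subst id (\<lambda>_. 1) f = 0"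
  unfolding I_eq by (rule matrix_ideal_eval_zero) (auto simp: eval_binomial)

text \<open>Otherwise a homogeneous component of the binomial of the column would be a monomial in
  \<open>I\<close>, but monomials do not vanish at (1, ..., 1).\<close>

lemma dotp_column: "dotp dd (column j L) = 0"
proof (rule ccontr)
  let ?a = "column j L"
  assume "dotp dd ?a \<noteq> 0"
  then have ne: "wt d (pos_part ?a) \<noteq> wt d (pos_part (- ?a))"
    unfolding dotp_pos_part[of dd ?a] dotp_evec_wt by simp
  have "binomial_of ?a \<in> I" unfolding I_eq by (rule binomial_column_mem)
  then have "hc d (wt d (pos_part ?a)) (binomial_of ?a) \<in> I" using homog by (simp add: homog_by_def)
  then have "mon (pos_part ?a) 1 \<in> I" using ne by (simp add: binomial_of_def hc_diff hc_mon)
  then show False using I_eval_one[of "mon (pos_part ?a) 1"] by (simp only: eval_mon_one) simp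
qed

lemma lattice_Sat: "is_lattice Sat"
  by (auto simp: is_lattice_def Sat_def dotp_add dotp_uminus)

lemma lattice_Lambda: "is_lattice \<Lambda>"
  by (rule lattice_column_lattice)

lemma Lambda_subset_Sat: "\<Lambda> \<subseteq> Sat"
  by (rule column_lattice_least[OF lattice_Sat]) (simp add: Sat_def dotp_column)

text \<open>Subtracting the largest possible multiple of the grading from \<open>w\<close> leaves a nonnegative vector
  whose support is the set of vanishing coordinates of a common zero of \<open>I\<close>.\<close>

lemma perp_proportional:
  assumes w: "\<And>j. dotp w (column j L) = 0"
  shows "w i * dd k = w k * dd i"
proof -
  have dpos: "dd i > 0" for i using d_pos by simp
  let ?r = "\<lambda>i. w i / dd i"
  obtain i0 where "?r i0 = Min (Set.range ?r)" using Min_in[of "Set.range ?r"] by fastforce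
  then have i0: "?r i0 \<le> ?r i" for i by (simp add: Min_le)
  \<comment> \<open>A positive multiple of w - (w i0 / d i0) d, cleared of its denominator.\<close>
  define v where "v = (\<lambda>i. w i * dd i0 - w i0 * dd i)"
  have v_nonneg: "v i \<ge> 0" for i
    using i0[of i] dpos[of i] dpos[of i0] by (simp add: v_def field_simps)
  have dotp_v: "dotp v a = dd i0 * dotp w a - w i0 * dotp dd a" for a
    by (simp add: dotp_def v_def algebra_simps sum_subtractf sum_distrib_left)
  have "v i = 0" for i
  proof (rule ccontr)
    assume vi: "v i \<noteq> 0"
    define x :: "'k ^ 's" where "x = (\<chi> i. if v i = 0 then 1 else 0)"
    \<comment> \<open>At this 0/1 point, with \<open>0 ^ 0 = 1\<close>, a monomial is 1 if its
      exponent avoids the support of \<open>v\<close> and 0 otherwise. As \<open>v\<close> is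
      nonnegative, the first case means \<open>v\<close>-degree 0, and the two monomials of a
      generator have equal \<open>v\<close>-degree.\<close>
    have ev: "(\<Prod>i\<in>UNIV. (x $ i) ^ ex e i) = (if dotp v (evec e) = 0 then 1 else 0)" for e
    proof -
      have "dotp v (evec e) = 0 \<longleftrightarrow> (\<forall>i. v i = 0 \<or> ex e i = 0)"
        unfolding dotp_def using v_nonneg by (subst sum_nonneg_eq_0_iff) auto
      moreover have "(\<Prod>i\<in>UNIV. (x $ i) ^ ex e i) = (if \<forall>i. v i = 0 \<or> ex e i = 0 then 1 else 0)"
      proof (cases "\<forall>i. v i = 0 \<or> ex e i = 0")
        case True
        then have "(x $ i) ^ ex e i = 1" for i by (cases "v i = 0") (auto simp: x_def)
        then show ?thesis using True by simp
      next
        case False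
        then obtain k where "v k \<noteq> 0" "ex e k \<noteq> 0" by blast
        then have "(x $ k) ^ ex e k = 0" by (simp add: x_def)
        then have "(\<Prod>i\<in>UNIV. (x $ i) ^ ex e i) = 0" by (rule prod_zero[OF finite bexI[OF _ UNIV_I]])
        then show ?thesis unfolding if_not_P[OF False] .
      qed
      ultimately show ?thesis by simp
    qed
    let ?K = "{f :: ('s, 'k) mpoly. poly_subst id (\<lambda>i. x $ i) f = 0}"
    have "binomial_of (column j L) \<in> ?K" for j
    proof -
      have "dotp v (column j L) = 0" using w dotp_column by (simp add: dotp_v)
      then have "dotp v (evec (pos_part (column j L))) = dotp v (evec (pos_part (- column j L)))"
        unfolding dotp_pos_part[of v "column j L"] by simp
      then show ?thesis by (simp only: mem_Collect_eq eval_binomial ev) simp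
    qed
    then have "I \<subseteq> ?K" unfolding I_eq by (intro matrix_ideal_least eval.ideal_kernel)
    moreover have "var i \<in> ?K"
    proof -
      have "ex (Poly_Mapping.single i 1) i = (1 :: nat)" by simp
      then have "(\<Prod>j\<in>UNIV. (x $ j) ^ ex (Poly_Mapping.single i 1) j) = 0"
        using vi by (intro prod_zero bexI[of _ i]) (auto simp: x_def)
      then show ?thesis unfolding var_def mem_Collect_eq eval.poly_subst_mon by simp
    qed
    ultimately have "Idl\<^bsub>ring_of_type_algebra\<^esub> (I \<union> {var i}) \<subseteq> ?K"
      by (intro genideal_least eval.ideal_kernel) auto
    then have "x \<in> zero_set (Idl\<^bsub>ring_of_type_algebra\<^esub> (I \<union> {var i}))"
      by (auto simp: zero_set_def)
    then have "x = 0" using zeros by auto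
    moreover have "x $ i0 = 1" by (simp add: x_def v_def)
    ultimately show False by simp
  qed
  then have p: "w i * dd i0 = w i0 * dd i" for i by (simp add: v_def)
  have "(w i * dd i0) * dd k = (w k * dd i0) * dd i" unfolding p by simp
  then have "(w i * dd k) * dd i0 = (w k * dd i) * dd i0" by (simp only: mult_ac)
  then show ?thesis using dpos[of i0] by (subst (asm) mult_right_cancel) auto
qed

abbreviation A :: "rat ^ 'm ^ 's" where "A \<equiv> map_matrix rat_of_int L"

text \<open>A relation among the rows other than \<open>i0\<close>, extended by 0, is orthogonal to
  the columns; being proportional to the grading, it vanishes. The grading itself expresses row
  \<open>i0\<close> through the others.\<close>

lemma rank_A: "rank A = CARD('s) - 1"
proof -
  define i0 where "i0 = (undefined :: 's)"
  let ?r = "\<lambda>i. row i A" and ?T = "UNIV - {i0}"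
  have indep: "c i = 0" if sum0: "(\<Sum>i\<in>?T. c i *s ?r i) = 0" and i: "i \<in> ?T" for c i
  proof -
    define w where "w = (\<lambda>i. if i = i0 then 0 else c i)"
    have "dotp w (column j L) = 0" for j
    proof -
      have "dotp w (column j L) = (\<Sum>i\<in>?T. c i * of_int (L $ i $ j))"
        unfolding dotp_def w_def column_def by (intro sum.mono_neutral_cong_right) auto
      also have "\<dots> = (\<Sum>i\<in>?T. c i *s ?r i) $ j" by (simp add: row_def)
      finally show ?thesis using sum0 by simp
    qed
    from perp_proportional[OF this, of i i0] show ?thesis
      using i d_pos[of i0] by (simp add: w_def)
  qed
  have inj: "inj_on ?r ?T"
  proof (rule inj_onI, rule ccontr)
    fix i k assume ik: "i \<in> ?T" "k \<in> ?T" "?r i = ?r k" "i \<noteq> k"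
    define c :: "'s \<Rightarrow> rat" where "c = (\<lambda>l. if l = i then 1 else if l = k then - 1 else 0)"
    have "(\<Sum>l\<in>?T. c l *s ?r l) = (\<Sum>l\<in>{i, k}. c l *s ?r l)"
      using ik by (intro sum.mono_neutral_right) (auto simp: c_def)
    also have "\<dots> = 0" using ik by (auto simp: c_def vec_eq_iff)
    finally have "c i = 0" using indep ik by blast
    then show False by (simp add: c_def)
  qed
  have ind: "vec.independent (?r ` ?T)"
  proof (rule vec.independent_if_scalars_zero)
    fix f v assume "(\<Sum>v\<in>?r ` ?T. f v *s v) = 0" "v \<in> ?r ` ?T"
    then show "f v = 0" using indep[of "\<lambda>i. f (?r i)"] by (auto simp: sum.reindex[OF inj])
  qed simp
  have "?r i0 = (\<Sum>i\<in>?T. (- dd i / dd i0) *s ?r i)"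
  proof (subst vec_eq_iff, rule allI)
    fix j
    have "dd i0 * of_int (L $ i0 $ j) + (\<Sum>i\<in>?T. dd i * of_int (L $ i $ j)) = dotp dd (column j L)"
      unfolding dotp_def column_def by (subst sum.remove[of UNIV i0]) auto
    then have "of_int (L $ i0 $ j) = - (\<Sum>i\<in>?T. dd i * of_int (L $ i $ j)) / dd i0"
      using dotp_column d_pos[of i0] by (simp add: field_simps)
    also have "\<dots> = (\<Sum>i\<in>?T. (- dd i / dd i0) * of_int (L $ i $ j))"
      by (simp add: sum_divide_distrib sum_negf)
    finally show "?r i0 $ j = (\<Sum>i\<in>?T. (- dd i / dd i0) *s ?r i) $ j" by (simp add: row_def)
  qed
  also have "\<dots> \<in> vec.span (?r ` ?T)"
    by (intro vec.span_sum vec.span_scale vec.span_base) auto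
  finally have "?r i \<in> vec.span (?r ` ?T)" for i
    by (cases "i = i0") (auto intro: vec.span_base)
  then have "rows A \<subseteq> vec.span (?r ` ?T)" by (auto simp: rows_def)
  moreover have "?r ` ?T \<subseteq> rows A" by (auto simp: rows_def)
  ultimately have "vec.dim (rows A) = card (?r ` ?T)" using ind by (intro vec.dim_unique) auto
  also have "\<dots> = CARD('s) - 1" by (simp add: card_image[OF inj] card_Diff_singleton)
  finally show ?thesis by (simp add: row_rank_def_gen)
qed

text \<open>Otherwise a linear functional kills the columns but not \<open>f\<close>; by
  \<open>perp_proportional\<close> its coefficients are proportional to the grading, which kills
  \<open>f\<close>.\<close>

lemma in_column_span:
  fixes f :: "rat ^ 's"
  assumes f: "(\<Sum>i\<in>UNIV. dd i * f $ i) = 0"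
  shows "f \<in> vec.span (columns A)"
proof (rule ccontr)
  assume nf: "f \<notin> vec.span (columns A)"
  obtain B where B: "B \<subseteq> columns A" "vec.independent B" "columns A \<subseteq> vec.span B"
    by (rule vec.maximal_independent_subset)
  have fB: "f \<notin> vec.span B" using nf B(1) vec.span_mono by blast
  then have "vec.independent (insert f B)" using B(2) by (rule vec.independent_insertI)
  \<comment> \<open>The functional is realised as the coordinate \<open>undefined\<close> of an
    endomorphism, hence the all-ones vector as value at \<open>f\<close>.\<close>
  then obtain g :: "rat ^ 's \<Rightarrow> rat ^ 's" where g: "Vector_Spaces.linear (*s) (*s) g"
    "\<forall>x\<in>insert f B. g x = (if x = f then (\<chi> i. 1) else 0)"
    using vec.linear_independent_extend[of "insert f B" "\<lambda>x. if x = f then (\<chi> i. 1) else 0"] by blast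
  define w where "w = (\<lambda>i. matrix g $ undefined $ i)"
  have gx: "g x $ undefined = (\<Sum>i\<in>UNIV. w i * x $ i)" for x
    using matrix_works[OF g(1), of x, symmetric] by (simp add: w_def matrix_vector_mult_def)
  have "f \<notin> B" using fB vec.span_base by blast
  then have B0: "g x = 0" if "x \<in> B" for x using g(2) that by auto
  have S0: "g x = 0" if "x \<in> vec.span B" for x
  proof -
    interpret g: Vector_Spaces.linear "(*s)" "(*s)" g by (rule g(1))
    show ?thesis using that
    proof (induction rule: vec.span_induct)
      case base
      then show ?case by (auto simp: vec.subspace_def g.add g.scale g.zero)
    qed (use B0 in auto)
  qed
  have "dotp w (column j L) = 0" for j
  proof -
    have "column j A \<in> vec.span B" using B(3) by (auto simp: columns_def)
    then have "g (column j A) $ undefined = 0" using S0 by simp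
    then show ?thesis unfolding gx by (simp add: dotp_def column_def)
  qed
  from perp_proportional[OF this] have p: "w i * dd k = w k * dd i" for i k .
  have "dd k * (\<Sum>i\<in>UNIV. w i * f $ i) = w k * (\<Sum>i\<in>UNIV. dd i * f $ i)" for k
    unfolding sum_distrib_left
  proof (rule sum.cong[OF refl])
    fix i
    show "dd k * (w i * f $ i) = w k * (dd i * f $ i)"
      using arg_cong[OF p[of i k], of "\<lambda>z. z * f $ i"] by (simp add: algebra_simps)
  qed
  then have "g f $ undefined = 0" using f d_pos[of undefined] unfolding gx by force
  then show False using g(2) by simp
qed

text \<open>Vectors with a positive multiple in \<open>\<Lambda>\<close> form a rational subspace
  containing the columns.\<close>

lemma Sat_multiple:
  assumes a: "a \<in> Sat"
  shows "\<exists>M::nat>0. int M *s a \<in> \<Lambda>"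
proof -
  define Q where "Q = (\<lambda>x :: rat ^ 's. \<exists>M::nat>0. \<exists>b\<in>\<Lambda>. \<forall>i. of_nat M * x $ i = of_int (b $ i))"
  note lat = lattice_Lambda
  let ?x = "(\<chi> i. of_int (a $ i)) :: rat ^ 's"
  have "?x \<in> vec.span (columns A)"
    using a by (intro in_column_span) (simp add: Sat_def dotp_def)
  then have "Q ?x"
  proof (induction rule: vec.span_induct)
    case base
    show ?case
      unfolding vec.subspace_def mem_Collect_eq
    proof (intro conjI ballI allI)
      show "Q 0" unfolding Q_def using lattice_zero[OF lat] by (intro exI[of _ 1]) (auto intro!: bexI[of _ 0])
    next
      fix x y assume "x \<in> {a. Q a}" "y \<in> {a. Q a}"
      then obtain M b N c where M: "M > 0" "b \<in> \<Lambda>" "\<forall>i. of_nat M * x $ i = of_int (b $ i)"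
        and N: "N > 0" "c \<in> \<Lambda>" "\<forall>i. of_nat N * y $ i = of_int (c $ i)" unfolding Q_def by blast
      have "int N *s b + int M *s c \<in> \<Lambda>"
        using M N by (intro lattice_add[OF lat] lattice_scale[OF lat])
      moreover have "of_nat (M * N) * (x + y) $ i = of_int ((int N *s b + int M *s c) $ i)" for i
        by (simp add: M(3)[rule_format, symmetric] N(3)[rule_format, symmetric] algebra_simps)
      ultimately show "Q (x + y)" unfolding Q_def using M(1) N(1)
        by (intro exI[of _ "M * N"] conjI bexI[of _ "int N *s b + int M *s c"]) auto
    next
      fix c :: rat and x assume "x \<in> {a. Q a}"
      then obtain M b where M: "M > 0" "b \<in> \<Lambda>" "\<forall>i. of_nat M * x $ i = of_int (b $ i)"
        unfolding Q_def by blast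
      obtain p q where pq: "c = of_int p / of_int q" "q > 0"
        using quotient_of_div[of c] quotient_of_denom_pos[of c] by (cases "quotient_of c") auto
      have "of_nat (M * nat q) * (c *s x) $ i = of_int ((p *s b) $ i)" for i
        using pq by (simp add: M(3)[rule_format, symmetric] field_simps)
      then show "Q (c *s x)" unfolding Q_def
        using M pq lattice_scale[OF lat M(2), of p]
        by (intro exI[of _ "M * nat q"]) (auto intro!: bexI[of _ "p *s b"])
    qed
  next
    case (step x)
    then obtain j where "x = column j A" by (auto simp: columns_def)
    then show ?case unfolding Q_def using column_in_lattice[of j L]
      by (intro exI[of _ 1]) (auto simp: column_def intro!: bexI[of _ "column j L"])
  qed
  then obtain M b where M: "M > 0" "b \<in> \<Lambda>" "\<forall>i. of_nat M * (of_int (a $ i) :: rat) = of_int (b $ i)"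
    unfolding Q_def by auto
  have "int M *s a = b"
  proof (subst vec_eq_iff, rule allI)
    fix i
    have "(of_int (int M * a $ i) :: rat) = of_int (b $ i)" using M(3) by simp
    then have "int M * a $ i = b $ i" by (simp only: of_int_eq_iff)
    then show "(int M *s a) $ i = b $ i" by simp
  qed
  then show ?thesis using M by auto
qed

text \<open>Orthogonal to the grading by design. A positive multiple in \<open>\<Lambda>\<close>
  yields a binomial in pure powers of the two variables, and the edges at one fixed vertex generate
  \<open>Sat\<close> up to finite index.\<close>

definition edge :: "'s \<Rightarrow> 's \<Rightarrow> int ^ 's" where
  "edge i k = int (d k) *s axis i 1 - int (d i) *s axis k 1"

lemma edge_Sat: "edge i k \<in> Sat"
proof -
  have "dotp dd (axis i 1) = dd i" for i
    unfolding dotp_def axis_def by (simp add: if_distrib cong: if_cong)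
  then show ?thesis by (simp add: Sat_def edge_def dotp_diff dotp_scale)
qed

lemma Sat_exponent: "\<exists>M::nat>0. \<forall>a\<in>Sat. int M *s a \<in> \<Lambda>"
proof -
  define i0 where "i0 = (undefined :: 's)"
  have "\<forall>k. \<exists>M::nat. M > 0 \<and> int M *s edge k i0 \<in> \<Lambda>" using Sat_multiple[OF edge_Sat] by blast
  then obtain M :: "'s \<Rightarrow> nat" where M: "\<And>k. M k > 0" "\<And>k. int (M k) *s edge k i0 \<in> \<Lambda>" by metis
  define N where "N = (\<Prod>k\<in>UNIV. M k)"
  have N: "int N *s edge k i0 \<in> \<Lambda>" for k
  proof -
    have "int N *s edge k i0 = int (\<Prod>k\<in>UNIV - {k}. M k) *s (int (M k) *s edge k i0)"
      unfolding N_def by (subst prod.remove[of _ k]) (auto simp: vec_eq_iff)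
    then show ?thesis using lattice_scale[OF lattice_Lambda M(2)] by simp
  qed
  have "int (N * d i0) *s a \<in> \<Lambda>" if a: "a \<in> Sat" for a
  proof -
    have "(\<Sum>i\<in>UNIV. int (d i) * a $ i) = 0"
    proof -
      have "of_int (\<Sum>i\<in>UNIV. int (d i) * a $ i) = (0 :: rat)"
        using a by (simp add: Sat_def dotp_def)
      then show ?thesis by (simp only: of_int_eq_0_iff)
    qed
    then have s: "(\<Sum>k\<in>UNIV. a $ k * int (d k)) = 0" by (simp add: mult.commute)
    \<comment> \<open>The contributions at \<open>i0\<close> add up to the product of
      \<open>a\<close> with the grading, which is 0. So finitely many edges control a common
      exponent for all of \<open>Sat\<close>.\<close>
    have "int (d i0) *s a = (\<Sum>k\<in>UNIV. a $ k *s edge k i0)"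
    proof (subst vec_eq_iff, rule allI)
      fix i
      have "(\<Sum>k\<in>UNIV. a $ k *s edge k i0) $ i =
        (\<Sum>k\<in>UNIV. a $ k * int (d i0) * (axis k 1 :: int ^ 's) $ i) -
        (\<Sum>k\<in>UNIV. a $ k * int (d k)) * (axis i0 1 :: int ^ 's) $ i"
        by (simp add: edge_def algebra_simps sum_subtractf sum_distrib_left)
      also have "\<dots> = a $ i * int (d i0)"
        unfolding s axis_def by (simp add: if_distrib cong: if_cong)
      finally show "(int (d i0) *s a) $ i = (\<Sum>k\<in>UNIV. a $ k *s edge k i0) $ i" by simp
    qed
    then have "int (N * d i0) *s a = (\<Sum>k\<in>UNIV. a $ k *s (int N *s edge k i0))"
      by (simp add: vec_eq_iff sum_distrib_left algebra_simps)
    also have "\<dots> \<in> \<Lambda>"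
      by (intro lattice_sum[OF lattice_Lambda] lattice_scale[OF lattice_Lambda] N)
    finally show ?thesis .
  qed
  moreover have "N * d i0 > 0" using M(1) d_pos by (simp add: N_def prod_pos)
  ultimately show ?thesis by blast
qed

end

section \<open>Counting the minimal primes\<close>

text \<open>Full cosets of \<open>M\<close> with a representative in \<open>B\<close>; if
  \<open>M\<close> is contained in \<open>B\<close>, this is the underlying set of B / M.\<close>

definition cosets :: "(int ^ 's::finite) set \<Rightarrow> (int ^ 's) set \<Rightarrow> (int ^ 's) set set" where
  "cosets M B = (\<lambda>a. {b. b - a \<in> M}) ` B"

lemma coset_eq_iff:
  assumes "is_lattice M"
  shows "{b. b - a \<in> M} = {b. b - a' \<in> M} \<longleftrightarrow> a - a' \<in> M"
proof
  assume "{b. b - a \<in> M} = {b. b - a' \<in> M}"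
  moreover have "a \<in> {b. b - a \<in> M}" using lattice_zero[OF assms] by simp
  ultimately show "a - a' \<in> M" by blast
next
  assume aa: "a - a' \<in> M"
  have "b - a \<in> M \<longleftrightarrow> b - a' \<in> M" for b
    using lattice_add[OF assms, of "b - a" "a - a'"] lattice_diff[OF assms, of "b - a'" "a - a'"] aa by auto
  then show "{b. b - a \<in> M} = {b. b - a' \<in> M}" by simp
qed

lemma finite_cosets:
  fixes M B :: "(int ^ 's::finite) set"
  assumes M: "is_lattice M" and k: "k > 0"
    and div: "\<And>a a'. a \<in> B \<Longrightarrow> a' \<in> B \<Longrightarrow> (\<And>i. (a $ i) mod int k = (a' $ i) mod int k) \<Longrightarrow> a - a' \<in> M"
  shows "finite (cosets M B)"
proof -
  let ?r = "\<lambda>a :: int ^ 's. \<lambda>i. (a $ i) mod int k"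
  have "?r ` B \<subseteq> PiE UNIV (\<lambda>_. {0..<int k})" using k by auto
  then have fin: "finite (?r ` B)" by (rule finite_subset) (auto intro: finite_PiE)
  define \<Phi> where "\<Phi> = (\<lambda>f. {b. b - (SOME a. a \<in> B \<and> ?r a = f) \<in> M})"
  have "{b. b - a \<in> M} = \<Phi> (?r a)" if a: "a \<in> B" for a
  proof -
    let ?s = "SOME a'. a' \<in> B \<and> ?r a' = ?r a"
    have s: "?s \<in> B \<and> ?r ?s = ?r a" by (rule someI[of _ a]) (use a in simp)
    then have "a - ?s \<in> M" using div[of a ?s] a by (metis (no_types, lifting))
    then show ?thesis unfolding \<Phi>_def by (simp add: coset_eq_iff[OF M])
  qed
  then have "cosets M B \<subseteq> \<Phi> ` ?r ` B" unfolding cosets_def by auto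
  then show ?thesis using fin finite_subset by blast
qed

lemma finite_cosets_UNIV:
  fixes M :: "(int ^ 's::finite) set"
  assumes M: "is_lattice M" and m: "m > 0" "\<And>a. int m *s a \<in> M"
  shows "finite (cosets M UNIV)"
proof (rule finite_cosets[OF M m(1)])
  fix a a' :: "int ^ 's" assume a: "\<And>i. (a $ i) mod int m = (a' $ i) mod int m"
  have "a - a' = int m *s (\<chi> i. (a - a') $ i div int m)"
    using a by (simp add: vec_eq_iff mod_eq_dvd_iff)
  then show "a - a' \<in> M" using m(2) by metis
qed

section \<open>Homogeneous elements and Frobenius powers of binomials\<close>

definition hmg :: "('s::finite \<Rightarrow> nat) \<Rightarrow> nat \<Rightarrow> ('s, 'k::field) mpoly \<Rightarrow> bool" where
  "hmg d n f \<longleftrightarrow> hc d n f = f"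

lemma hmg_mult:
  assumes "hmg d m f" "hmg d n g" shows "hmg d (m + n) (f * g)"
proof -
  have f: "hc d k f = (if k = m then f else 0)" for k
    using hc_hc[of d k m f] assms(1) by (simp add: hmg_def)
  have g: "hc d n g = g" using assms(2) by (simp add: hmg_def)
  have "hc d (m + n) (f * g) = (\<Sum>k\<le>m + n. if k = m then f * hc d (m + n - k) g else 0)"
    unfolding hc_mult by (rule sum.cong) (auto simp: f)
  then show ?thesis by (simp add: hmg_def g)
qed

lemma hmg_one: "hmg d 0 1"
  by (simp add: hmg_def hc_one)

lemma hmg_power: "hmg d n f \<Longrightarrow> hmg d (k * n) (f ^ k)"
  by (induction k) (auto simp: hmg_one intro: hmg_mult)

lemma wt_single: "wt d (Poly_Mapping.single i n) = d i * n"
proof -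
  have "wt d (Poly_Mapping.single i n) = (\<Sum>j\<in>UNIV. if j = i then d i * n else 0)"
    unfolding wt_def by (rule sum.cong) (auto simp: lookup_single when_def)
  then show ?thesis by simp
qed

lemma hmg_var_power: "hmg d (d i * k) (var i ^ k)"
  unfolding var_power hmg_def by (simp add: hc_mon wt_single)

lemma hmg_keys: "hmg d n f \<Longrightarrow> e \<in> Poly_Mapping.keys f \<Longrightarrow> wt d e = n"
  using lookup_hc[of d n f e] by (auto simp: hmg_def in_keys_iff split: if_splits)

lemma mon_unit: "is_prime P \<Longrightarrow> mon 0 (c :: 'k::field) \<in> P \<Longrightarrow> c = 0"
proof (rule ccontr)
  assume P: "is_prime P" "mon 0 c \<in> P" "c \<noteq> 0"
  have "mon 0 (inverse c) * mon 0 c \<in> P" by (rule ideal_mult[OF prime_ideal[OF P(1)] P(2)])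
  then show False using P prime_one[OF P(1)] by (simp add: mult_single)
qed

lemma CHAR_mpoly: "CHAR(('s, 'k::field) mpoly) = CHAR('k)"
proof (rule CHAR_eqI)
  show "of_nat CHAR('k) = (0 :: ('s, 'k) mpoly)" by (simp flip: single_of_nat)
  show "CHAR('k) dvd n" if "of_nat n = (0 :: ('s, 'k) mpoly)" for n
    using that by (simp flip: single_of_nat of_nat_eq_0_iff_char_dvd) (metis lookup_single_eq lookup_zero)
qed

text \<open>Frobenius is additive; \<open>pos_part (int q *s evec e)\<close> is just the exponent
  \<open>e\<close> multiplied by q.\<close>

lemma binomial_char_power:
  assumes p: "prime p" "CHAR('k::field) = p"
  shows "(mon e 1 - mon e' 1 :: ('s::finite, 'k) mpoly) ^ (p ^ n) =
    mon (pos_part (int (p ^ n) *s evec e)) 1 - mon (pos_part (int (p ^ n) *s evec e')) 1"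
proof -
  have m: "mon e (1 :: 'k) ^ q = mon (pos_part (int q *s evec e)) 1" for e :: "'s \<Rightarrow>\<^sub>0 nat" and q
    by (simp add: mon_eq_prod prod_power_distrib nat_mult_distrib mult.commute flip: power_mult)
  let ?x = "mon e 1 :: ('s, 'k) mpoly" and ?y = "mon e' 1 :: ('s, 'k) mpoly"
  have "((?x - ?y) + ?y) ^ (p ^ n) = (?x - ?y) ^ (p ^ n) + ?y ^ (p ^ n)"
    using p by (intro freshmans_dream'[where n = n]) (simp_all add: CHAR_mpoly)
  then show ?thesis by (simp add: m algebra_simps)
qed

section \<open>Homogeneous primes over a graded matrix ideal: heights and an upper bound for their
  number\<close>

context graded_matrix_ideal
begin

definition PP :: "('s, 'k) mpoly set set" where
  "PP = {P. is_prime P \<and> I \<subseteq> P \<and> (\<forall>i. var i \<notin> P) \<and> homog_by d P}"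

abbreviation J :: "('s, 'k) mpoly set" where "J \<equiv> lattice_ideal \<Lambda>"

lemma PP_D:
  assumes "P \<in> PP"
  shows "is_prime P" "I \<subseteq> P" "\<And>i. var i \<notin> P" "homog_by d P"
  using assms by (auto simp: PP_def)

lemma J_subset_prime:
  assumes "is_prime P" "I \<subseteq> P" "\<And>i. var i \<notin> P" shows "J \<subseteq> P"
proof
  fix f assume "f \<in> J"
  then obtain k where "f * vars_prod ^ k \<in> P"
    using assms(2) unfolding lattice_ideal_eq_saturation I_eq[symmetric] saturation_iff by blast
  then show "f \<in> P"
    using prime_mult[OF assms(1)] prime_power[OF assms(1)] vars_prod_prime_iff[OF assms(1)] assms(3) by blast
qed

text \<open>The 0/1 point that vanishes exactly in the variables of \<open>N\<close> sends a
  monomial to 0 or 1 according to membership in \<open>N\<close>. The two monomials of a generator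
  lie in \<open>N\<close> together, so the point is a zero of \<open>I\<close>, and the hypothesis
  on zeros puts all variables into \<open>N\<close>.\<close>

lemma prime_with_var:
  assumes N: "is_prime N" "I \<subseteq> N" "var i \<in> N" shows "N = max_ideal"
proof -
  define x :: "'k ^ 's" where "x = (\<chi> i. if var i \<in> N then 0 else 1)"
  have ev: "(\<Prod>i\<in>UNIV. (x $ i) ^ ex e i) = (if mon e 1 \<in> N then 0 else 1)" for e
  proof (cases "mon e 1 \<in> N")
    case True
    then obtain i where "ex e i \<noteq> 0" "var i \<in> N" unfolding prime_mon_iff[OF N(1)] by blast
    then have "(x $ i) ^ ex e i = 0" by (simp add: x_def)
    then have "(\<Prod>i\<in>UNIV. (x $ i) ^ ex e i) = 0" by (rule prod_zero[OF finite bexI[OF _ UNIV_I]])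
    then show ?thesis using True by simp
  next
    case False
    have "(x $ i) ^ ex e i = 1" for i
    proof -
      have "ex e i = 0 \<or> var i \<notin> N" using False unfolding prime_mon_iff[OF N(1)] by blast
      then show ?thesis by (auto simp: x_def)
    qed
    then show ?thesis using False by simp
  qed
  let ?K = "{f :: ('s, 'k) mpoly. poly_subst id (\<lambda>i. x $ i) f = 0}"
  have "binomial_of (column j L) \<in> ?K" for j
  proof -
    have "(binomial_of (column j L) :: ('s, 'k) mpoly) \<in> N"
      using N(2) binomial_column_mem[of j L] unfolding I_eq by blast
    then have m: "mon (pos_part (column j L)) 1 - mon (pos_part (- column j L)) 1 \<in> N"
      by (simp only: binomial_of_def)
    have "mon (pos_part (column j L)) 1 \<in> N \<longleftrightarrow> mon (pos_part (- column j L)) (1 :: 'k) \<in> N"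
      using ideal_diff[OF prime_ideal[OF N(1)] _ m, of "mon (pos_part (column j L)) 1"]
        ideal_add[OF prime_ideal[OF N(1)] m, of "mon (pos_part (- column j L)) 1"] by auto
    then show ?thesis by (simp only: mem_Collect_eq eval_binomial ev) simp
  qed
  then have "I \<subseteq> ?K" unfolding I_eq by (intro matrix_ideal_least eval.ideal_kernel)
  moreover have "var i \<in> ?K"
  proof -
    have "mon (Poly_Mapping.single i 1) 1 \<in> N" using N(3) by (simp add: var_def)
    then show ?thesis unfolding var_def mem_Collect_eq eval.poly_subst_mon ev by simp
  qed
  ultimately have "Idl\<^bsub>ring_of_type_algebra\<^esub> (I \<union> {var i}) \<subseteq> ?K"
    by (intro genideal_least eval.ideal_kernel) auto
  then have "x \<in> zero_set (Idl\<^bsub>ring_of_type_algebra\<^esub> (I \<union> {var i}))" by (auto simp: zero_set_def)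
  then have "x = 0" using zeros by auto
  then have "x $ j = 0" for j by simp
  then have "var j \<in> N" for j unfolding x_def by (simp split: if_splits) (metis zero_neq_one)
  then have "max_ideal \<subseteq> N"
    unfolding max_ideal_def by (intro genideal_least prime_ideal[OF N(1)]) auto
  then show ?thesis using maximal_max_ideal[OF prime_ideal[OF N(1)]] prime_one[OF N(1)] by blast
qed

lemma var_max_ideal: "var i \<in> max_ideal"
  unfolding max_ideal_def by (rule subsetD[OF genideal_superset rangeI])

text \<open>Since all weights are positive, the component of degree 0 is the constant term, and a
  homogeneous prime contains it only if it vanishes.\<close>

lemma PP_psubset_max:
  assumes P: "P \<in> PP" shows "P \<subset> max_ideal"
proof -
  have "f \<in> max_ideal" if "f \<in> P" for f
  proof -
    have "d i = 0 \<longleftrightarrow> False" for i using d_pos[of i] by simp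
    then have wt0: "wt d e = 0 \<longleftrightarrow> e = 0" for e
      unfolding wt_def poly_mapping_eq_iff fun_eq_iff by (simp only: sum_eq_0_iff finite mult_is_0) simp
    have "hc d 0 f = mon 0 (cf f 0)"
      by (rule poly_mapping_eqI) (auto simp: lookup_hc wt0 lookup_single when_def)
    moreover have "hc d 0 f \<in> P" using PP_D(4)[OF P] that by (simp add: homog_by_def)
    ultimately show ?thesis using mon_unit[OF PP_D(1)[OF P]] by (simp add: max_ideal_eq)
  qed
  moreover have "P \<noteq> max_ideal" using PP_D(3)[OF P] var_max_ideal by auto
  ultimately show ?thesis by blast
qed

lemma star_mem_PP:
  assumes N: "is_prime N" "I \<subseteq> N" "\<And>i. var i \<notin> N" shows "star d N \<in> PP"
proof -
  have "star d N \<subseteq> N" by (rule star_subset[OF prime_ideal[OF N(1)]])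
  then show ?thesis
    unfolding PP_def
    using N prime_star[OF N(1)] star_greatest[OF homog N(2)] homog_star[OF prime_ideal[OF N(1)]] by blast
qed

text \<open>Multiples of the edge vectors lie in \<open>\<Lambda>\<close>, which supplies the
  relations between pure powers that \<open>long_prime_chain\<close> asks for.\<close>

lemma long_chain:
  assumes N: "is_prime N" "I \<subseteq> N" "\<And>i. var i \<notin> N"
  shows "\<exists>Q. prime_chain (CARD('s) - 1) Q N"
proof (rule long_prime_chain[OF N(1,3)])
  fix i i0 :: 's
  obtain M where M: "M > 0" "\<forall>a\<in>Sat. int M *s a \<in> \<Lambda>" using Sat_exponent by blast
  have "evec (Poly_Mapping.single i0 (M * d i)) - evec (Poly_Mapping.single i (M * d i0)) = int M *s edge i0 i"
    by (auto simp: vec_eq_iff edge_def axis_def lookup_single when_def algebra_simps)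
  then have "evec (Poly_Mapping.single i0 (M * d i)) - evec (Poly_Mapping.single i (M * d i0)) \<in> \<Lambda>"
    using M(2) edge_Sat by simp
  then have "mon (Poly_Mapping.single i0 (M * d i)) 1 - mon (Poly_Mapping.single i (M * d i0)) 1 \<in> N"
    using binomial_mem_lattice_ideal[OF lattice_Lambda] J_subset_prime[OF N] by blast
  moreover have "M * d i0 > 0" using M d_pos by simp
  ultimately show "\<exists>a b. b > 0 \<and> mon (Poly_Mapping.single i0 a) 1 - mon (Poly_Mapping.single i b) 1 \<in> N"
    by blast
qed

lemma card_pos: "CARD('s) > 0"
  by simp

text \<open>Otherwise a chain with s - 1 steps below \<open>P\<close>, prolonged by
  \<open>P'\<close> and \<open>max_ideal\<close>, would have s + 1 steps.\<close>

lemma PP_incomparable: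
  assumes "P \<in> PP" "P' \<in> PP" "P \<subseteq> P'" shows "P = P'"
proof (rule ccontr)
  assume "P \<noteq> P'"
  then have lt: "P \<subset> P'" using assms(3) by auto
  obtain Q where "prime_chain (CARD('s) - 1) Q P" using long_chain[OF PP_D(1-3)[OF assms(1)]] by blast
  then have "prime_chain (Suc (CARD('s) - 1)) Q P'" using PP_D(1)[OF assms(2)] lt by (rule prime_chain_top)
  then have "prime_chain (Suc (Suc (CARD('s) - 1))) Q max_ideal"
    using prime_max_ideal PP_psubset_max[OF assms(2)] by (rule prime_chain_top)
  then show False using prime_chain_le_card card_pos by fastforce
qed

text \<open>The evaluation kernel at (1, ..., 1) contains \<open>I\<close> and no variable.\<close>

lemma PP_nonempty: "PP \<noteq> {}"
proof -
  let ?K = "{f :: ('s, 'k) mpoly. poly_subst id (\<lambda>_. 1) f = 0}"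
  have "poly_subst id (\<lambda>_. 1) (var i :: ('s, 'k) mpoly) = 1" for i
    unfolding var_def by (rule eval_mon_one)
  then have "var i \<notin> ?K" for i by simp
  moreover have "I \<subseteq> ?K" using I_eval_one by blast
  ultimately have "star d ?K \<in> PP" by (intro star_mem_PP prime_eval_kernel)
  then show ?thesis by blast
qed

text \<open>A member of \<open>PP\<close> has s - 1 steps below it and at least one above it, out of
  at most s. A prime over \<open>I\<close> outside \<open>PP\<close> strictly contains a member, so
  its height is at least s.\<close>

lemma height_PP:
  assumes N: "is_prime N" "I \<subseteq> N"
  shows "prime_height ring_of_type_algebra N = enat (CARD('s) - 1) \<longleftrightarrow> N \<in> PP"
proof
  assume P: "N \<in> PP"
  obtain Q where "prime_chain (CARD('s) - 1) Q N" using long_chain[OF PP_D(1-3)[OF P]] by blast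
  then have "enat (CARD('s) - 1) \<le> prime_height ring_of_type_algebra N" by (rule prime_height_ge)
  moreover have "prime_height ring_of_type_algebra N \<le> enat (CARD('s) - 1)"
  proof (rule prime_height_le)
    fix k Q assume "prime_chain k Q N"
    then have "prime_chain (Suc k) Q max_ideal"
      using prime_max_ideal PP_psubset_max[OF P] by (rule prime_chain_top)
    then show "k \<le> CARD('s) - 1" using prime_chain_le_card by fastforce
  qed
  ultimately show "prime_height ring_of_type_algebra N = enat (CARD('s) - 1)" by simp
next
  assume h: "prime_height ring_of_type_algebra N = enat (CARD('s) - 1)"
  show "N \<in> PP"
  proof (rule ccontr)
    assume nN: "N \<notin> PP"
    have "\<exists>P\<in>PP. P \<subset> N"
    proof (cases "\<exists>i. var i \<in> N")
      case True
      then have "N = max_ideal" using prime_with_var N by blast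
      then show ?thesis using PP_psubset_max PP_nonempty by blast
    next
      case False
      then have "star d N \<in> PP" using star_mem_PP N by blast
      then show ?thesis using nN star_subset[OF prime_ideal[OF N(1)], of d] by (intro bexI[of _ "star d N"]) auto
    qed
    then obtain P where P: "P \<in> PP" "P \<subset> N" by blast
    obtain Q where "prime_chain (CARD('s) - 1) Q P" using long_chain[OF PP_D(1-3)[OF P(1)]] by blast
    then have "prime_chain (Suc (CARD('s) - 1)) Q N" using N(1) P(2) by (rule prime_chain_top)
    then have "enat (Suc (CARD('s) - 1)) \<le> enat (CARD('s) - 1)" using prime_height_ge h by metis
    then have "Suc (CARD('s) - 1) \<le> CARD('s) - 1" by (simp only: enat_ord_simps)
    then show False by linarith
  qed
qed

text \<open>For each other prime, an element of it outside \<open>P\<close> has a component outside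
  \<open>P\<close>, which remains in that prime by homogeneity. The product of these components
  separates \<open>P\<close> from all of them.\<close>

lemma separating_element:
  assumes F: "finite F" "F \<subseteq> PP" and P: "P \<in> F"
  shows "\<exists>f n. hmg d n f \<and> f \<notin> P \<and> (\<forall>P'\<in>F - {P}. f \<in> P')"
proof -
  have "\<exists>f n. hmg d n f \<and> f \<in> P' \<and> f \<notin> P" if P': "P' \<in> F - {P}" for P'
  proof -
    have "\<not> P' \<subseteq> P" using PP_incomparable[of P' P] P' F P by auto
    then obtain x where x: "x \<in> P'" "x \<notin> P" by blast
    then have "x \<notin> star d P" using star_subset[OF prime_ideal[OF PP_D(1)]] P F by blast
    then obtain n where "hc d n x \<notin> P" by (auto simp: star_def)
    moreover have "hc d n x \<in> P'" using x PP_D(4)[of P'] P' F by (auto simp: homog_by_def)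
    moreover have "hmg d n (hc d n x)" by (simp add: hmg_def hc_hc)
    ultimately show ?thesis by blast
  qed
  then obtain f n where f: "\<And>P'. P' \<in> F - {P} \<Longrightarrow> hmg d (n P') (f P') \<and> f P' \<in> P' \<and> f P' \<notin> P" by metis
  have "\<exists>n. hmg d n (prod f B)" if "finite B" "B \<subseteq> F - {P}" for B
    using that
  proof (induction B rule: finite_induct)
    case (insert x B)
    then obtain m where "hmg d m (prod f B)" by auto
    then have "hmg d (n x + m) (f x * prod f B)" using f[of x] insert by (intro hmg_mult) auto
    then show ?case using insert by auto
  qed (use hmg_one in auto)
  then obtain m where "hmg d m (prod f (F - {P}))" using F by blast
  moreover have "prod f (F - {P}) \<notin> P"
    using prime_prod_iff[OF PP_D(1), of P "F - {P}" f] F P f by auto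
  moreover have "prod f (F - {P}) \<in> P'" if "P' \<in> F - {P}" for P'
    using prime_prod_iff[OF PP_D(1), of P' "F - {P}" f] F f that by auto
  ultimately show ?thesis by blast
qed

text \<open>Homogeneous elements of one common degree, each lying in all but one of the primes, are linearly
  independent modulo any lattice ideal inside these primes, and a degree component modulo a lattice
  ideal is spanned by one monomial per class.\<close>

lemma card_primes_le_index:
  assumes M: "is_lattice M" "M \<subseteq> Sat" "finite (cosets M Sat)"
    and MP: "\<And>P. P \<in> PP \<Longrightarrow> lattice_ideal M \<subseteq> P" and F: "finite F" "F \<subseteq> PP"
  shows "card F \<le> card (cosets M Sat)"
proof -
  define i0 where "i0 = (undefined :: 's)"
  have "\<forall>P\<in>F. \<exists>z. hmg d (snd z) (fst z) \<and> fst z \<notin> P \<and> (\<forall>P'\<in>F - {P}. fst z \<in> P')"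
    using separating_element[OF F] by fastforce
  then obtain z where z: "\<forall>P\<in>F. hmg d (snd (z P)) (fst (z P)) \<and> fst (z P) \<notin> P \<and> (\<forall>P'\<in>F - {P}. fst (z P) \<in> P')"
    unfolding bchoice_iff by blast
  define f where "f = fst \<circ> z"
  define \<delta> where "\<delta> = snd \<circ> z"
  have f: "hmg d (\<delta> P) (f P) \<and> f P \<notin> P \<and> (\<forall>P'\<in>F - {P}. f P \<in> P')" if "P \<in> F" for P
    using z that by (simp add: f_def \<delta>_def)
  define D where "D = sum \<delta> F"
  have D: "\<delta> P \<le> D" if "P \<in> F" for P unfolding D_def using F that by (simp add: member_le_sum)
  \<comment> \<open>Equalises the degrees: the power \<open>d i0\<close> makes every missing degree
    divisible by the weight of the variable \<open>i0\<close>, which fills it up without entering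
    \<open>P\<close>.\<close>
  define g where "g = (\<lambda>P. f P ^ d i0 * var i0 ^ (D - \<delta> P))"
  have deg: "hmg d (d i0 * D) (g P)" if "P \<in> F" for P
  proof -
    have "hmg d (d i0 * \<delta> P + d i0 * (D - \<delta> P)) (g P)"
      unfolding g_def using f[OF that] by (intro hmg_mult hmg_power hmg_var_power) auto
    then show ?thesis using D[OF that] by (simp flip: distrib_left)
  qed
  have gP: "g P \<notin> P" if "P \<in> F" for P
  proof -
    have P: "P \<in> PP" using F that by blast
    have "f P ^ d i0 \<notin> P" "var i0 ^ (D - \<delta> P) \<notin> P"
      using prime_power[OF PP_D(1)[OF P]] f[OF that] PP_D(3)[OF P] by blast+
    then show ?thesis unfolding g_def using prime_mult[OF PP_D(1)[OF P]] by blast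
  qed
  have gP': "g P \<in> P'" if "P \<in> F" "P' \<in> F" "P' \<noteq> P" for P P'
  proof -
    have P': "P' \<in> PP" using F that by blast
    have "f P \<in> P'" using f[OF that(1)] that by blast
    then have "f P ^ d i0 \<in> P'"
      using ideal_power_le[OF prime_ideal[OF PP_D(1)[OF P']], of "f P" 1 "d i0"] d_pos[of i0] by simp
    then show ?thesis unfolding g_def by (rule ideal_mult_right[OF prime_ideal[OF PP_D(1)[OF P']]])
  qed
  let ?rep = "lrep M"
  \<comment> \<open>One representative per class of monomials in the common degree. Differences to a
    fixed one lie in \<open>Sat\<close> and separate the classes, so there are at most as many as
    cosets.\<close>
  define R where "R = ?rep ` {e. wt d e = d i0 * D}"
  define r where "r = (\<lambda>P. \<Sum>e\<in>Poly_Mapping.keys (g P). mon (?rep e) (cf (g P) e))"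
  have Rfin: "finite R \<and> card R \<le> card (cosets M Sat)"
  proof (cases "R = {}")
    case False
    then obtain e0 where e0: "e0 \<in> R" by blast
    have wtR: "wt d e = d i0 * D" if eR: "e \<in> R" for e
    proof -
      obtain e1 where e1: "wt d e1 = d i0 * D" "e = ?rep e1" using eR unfolding R_def by blast
      have "evec e - evec e1 \<in> Sat" using lrep_mem[OF M(1), of e1] M(2) e1 by (auto simp: lclass_def)
      then have "rat_of_nat (wt d e) = rat_of_nat (wt d e1)"
        by (simp add: Sat_def dotp_diff dotp_evec_wt)
      then have "wt d e = wt d e1" by (simp only: of_nat_eq_iff)
      then show ?thesis using e1 by simp
    qed
    have inj: "inj_on (\<lambda>e. {b. b - (evec e - evec e0) \<in> M}) R"
    proof (rule inj_onI)
      fix e e' assume ee: "e \<in> R" "e' \<in> R"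
        "{b. b - (evec e - evec e0) \<in> M} = {b. b - (evec e' - evec e0) \<in> M}"
      then have "e \<in> lclass M e'" unfolding coset_eq_iff[OF M(1)] by (simp add: lclass_def)
      then have "?rep e = ?rep e'" by (simp add: lrep_eq_iff[OF M(1)])
      moreover have "?rep e = e" if eR: "e \<in> R" for e
      proof -
        obtain e1 where "e = ?rep e1" using eR unfolding R_def by blast
        moreover have "?rep (?rep e1) = ?rep e1"
          unfolding lrep_eq_iff[OF M(1)] by (rule lrep_mem[OF M(1)])
        ultimately show ?thesis by simp
      qed
      ultimately show "e = e'" using ee by simp
    qed
    have sub: "(\<lambda>e. {b. b - (evec e - evec e0) \<in> M}) ` R \<subseteq> cosets M Sat"
      unfolding cosets_def using wtR e0
      by (auto intro!: imageI simp: Sat_def dotp_diff dotp_evec_wt)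
    show ?thesis
      using card_mono[OF M(3) sub] finite_imageD[OF finite_subset[OF sub M(3)] inj] by (simp add: card_image[OF inj])
  qed simp
  have "card F \<le> card ((\<lambda>e. mon e (1 :: 'k)) ` R)"
  proof (rule mp.card_le_of_independent_family[where x = r])
    show "r P \<in> mp.span ((\<lambda>e. mon e 1) ` R)" if "P \<in> F" for P
    proof (rule mpoly_in_span)
      have "Poly_Mapping.keys (r P) \<subseteq> (\<Union>e\<in>Poly_Mapping.keys (g P). Poly_Mapping.keys (mon (?rep e) (cf (g P) e)))"
        unfolding r_def by (rule keys_sum)
      also have "\<dots> \<subseteq> R" using hmg_keys[OF deg[OF that]] by (auto simp: R_def split: if_splits)
      finally show "Poly_Mapping.keys (r P) \<subseteq> R" .
    qed
    fix c P assume sum0: "(\<Sum>P\<in>F. mon 0 (c P) * r P) = 0" and P: "P \<in> F"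
    have PPP: "P \<in> PP" using P F by blast
    note iP = prime_ideal[OF PP_D(1)[OF PPP]]
    \<comment> \<open>A relation among the normal forms \<open>r\<close> thus becomes one among the
      \<open>g\<close> modulo \<open>P\<close>, where only the term of \<open>P\<close>
      survives.\<close>
    have "g Q - r Q \<in> P" for Q
      unfolding r_def using diff_lrep_mem_lattice_ideal[OF M(1), of "g Q"] MP[OF PPP] by blast
    then have "(\<Sum>Q\<in>F. mon 0 (c Q) * (g Q - r Q)) \<in> P" by (intro ideal_sum[OF iP] ideal_mult[OF iP])
    then have "(\<Sum>Q\<in>F. mon 0 (c Q) * g Q) \<in> P" using sum0 by (simp add: right_diff_distrib sum_subtractf)
    moreover have "(\<Sum>Q\<in>F. mon 0 (c Q) * g Q) = mon 0 (c P) * g P + (\<Sum>Q\<in>F - {P}. mon 0 (c Q) * g Q)"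
      using F P by (simp add: sum.remove)
    moreover have "(\<Sum>Q\<in>F - {P}. mon 0 (c Q) * g Q) \<in> P"
      using gP' P by (intro ideal_sum[OF iP] ideal_mult[OF iP]) auto
    ultimately have "mon 0 (c P) * g P \<in> P" by (simp add: ideal_add_cancel[OF iP])
    then have "mon 0 (c P) \<in> P" using prime_mult[OF PP_D(1)[OF PPP]] gP[OF P] by blast
    then show "c P = 0" by (rule mon_unit[OF PP_D(1)[OF PPP]])
  qed (use F Rfin in auto)
  also have "\<dots> \<le> card R" using Rfin by (intro card_image_le) auto
  finally show ?thesis using Rfin by simp
qed

lemma Sat_div:
  fixes a :: "int ^ 's"
  assumes "a \<in> Sat" "\<And>i. int k dvd a $ i" "k > 0"
  obtains b where "b \<in> Sat" "a = int k *s b"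
proof
  show a: "a = int k *s (\<chi> i. a $ i div int k)" using assms by (simp add: vec_eq_iff)
  have "dotp dd a = of_int (int k) * dotp dd (\<chi> i. a $ i div int k)"
    by (subst a) (rule dotp_scale)
  then show "(\<chi> i. a $ i div int k) \<in> Sat" using assms by (simp add: Sat_def)
qed

lemma finite_cosets_Sat:
  assumes M: "is_lattice M" "\<Lambda> \<subseteq> M" shows "finite (cosets M Sat)"
proof -
  obtain k where k: "k > 0" "\<forall>a\<in>Sat. int k *s a \<in> \<Lambda>" using Sat_exponent by blast
  show ?thesis
  proof (rule finite_cosets[OF M(1) k(1)])
    fix a a' :: "int ^ 's" assume a: "a \<in> Sat" "a' \<in> Sat" "\<And>i. (a $ i) mod int k = (a' $ i) mod int k"
    have "a - a' \<in> Sat" using a lattice_diff[OF lattice_Sat] by blast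
    moreover have "int k dvd (a - a') $ i" for i using a(3)[of i] by (simp add: mod_eq_dvd_iff)
    ultimately obtain b where "b \<in> Sat" "a - a' = int k *s b" using Sat_div k(1) by metis
    then show "a - a' \<in> M" using k(2) M(2) by auto
  qed
qed

text \<open>The lattice \<open>\<L>'\<close> if p is the characteristic; p = 1 is the convention for
  characteristic 0.\<close>

definition Lp :: "nat \<Rightarrow> (int ^ 's) set" where
  "Lp p = {a. \<exists>n. int (p ^ n) *s a \<in> \<Lambda>}"

lemma Lp_one: "Lp 1 = \<Lambda>"
  by (simp add: Lp_def)

lemma Lambda_subset_Lp: "\<Lambda> \<subseteq> Lp p"
proof
  fix a assume "a \<in> \<Lambda>"
  then have "int (p ^ 0) *s a \<in> \<Lambda>" by simp
  then show "a \<in> Lp p" unfolding Lp_def by blast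
qed

lemma lattice_Lp: "is_lattice (Lp p)"
  unfolding is_lattice_def
proof (intro conjI ballI)
  show "0 \<in> Lp p" using Lambda_subset_Lp lattice_zero[OF lattice_Lambda] by blast
next
  fix a b assume "a \<in> Lp p" "b \<in> Lp p"
  then obtain m n where mn: "int (p ^ m) *s a \<in> \<Lambda>" "int (p ^ n) *s b \<in> \<Lambda>" by (auto simp: Lp_def)
  have "int (p ^ n) *s (int (p ^ m) *s a) + int (p ^ m) *s (int (p ^ n) *s b) \<in> \<Lambda>"
    by (intro lattice_add[OF lattice_Lambda] lattice_scale[OF lattice_Lambda] mn)
  also have "int (p ^ n) *s (int (p ^ m) *s a) + int (p ^ m) *s (int (p ^ n) *s b) = int (p ^ (m + n)) *s (a + b)"
    by (simp add: vec_eq_iff algebra_simps power_add)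
  finally show "a + b \<in> Lp p" unfolding Lp_def by blast
next
  fix a assume "a \<in> Lp p"
  then obtain m where "int (p ^ m) *s a \<in> \<Lambda>" by (auto simp: Lp_def)
  then have "- (int (p ^ m) *s a) \<in> \<Lambda>" by (rule lattice_uminus[OF lattice_Lambda])
  also have "- (int (p ^ m) *s a) = int (p ^ m) *s (- a)" by (simp add: vec_eq_iff)
  finally show "- a \<in> Lp p" unfolding Lp_def by blast
qed

lemma Lp_subset_Sat:
  assumes "p > 0" shows "Lp p \<subseteq> Sat"
proof
  fix a assume "a \<in> Lp p"
  then obtain n where "int (p ^ n) *s a \<in> Sat" using Lambda_subset_Sat by (auto simp: Lp_def)
  then show "a \<in> Sat" using assms by (simp add: Sat_def dotp_scale)
qed

text \<open>For prime p, a p^n-th power of the binomial is the difference of two monomials whose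
  exponents differ by an element of \<open>\<Lambda>\<close>; so it lies in \<open>J\<close>, and a
  prime containing a power contains the element.\<close>

lemma lattice_ideal_Lp_subset:
  assumes p: "p = 1 \<or> prime p \<and> CHAR('k) = p" and P: "P \<in> PP"
  shows "lattice_ideal (Lp p) \<subseteq> P"
  unfolding lattice_ideal_def
proof (intro genideal_least prime_ideal PP_D(1)[OF P] subsetI)
  fix f :: "('s, 'k) mpoly" assume "f \<in> binomial_of ` Lp p"
  then obtain a n where a: "int (p ^ n) *s a \<in> \<Lambda>" "f = binomial_of a" by (auto simp: Lp_def)
  have JP: "J \<subseteq> P" using J_subset_prime PP_D[OF P] by blast
  show "f \<in> P"
  proof (cases "p = 1")
    case True
    then have "a \<in> \<Lambda>" using a by simp
    then have "f \<in> J" unfolding a(2) lattice_ideal_def by (intro subsetD[OF genideal_superset] imageI)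
    then show ?thesis using JP by blast
  next
    case False
    then have p': "prime p" "CHAR('k) = p" using p by auto
    have "f ^ (p ^ n) = mon (pos_part (int (p ^ n) *s evec (pos_part a))) 1 -
        mon (pos_part (int (p ^ n) *s evec (pos_part (- a)))) 1"
      unfolding a(2) binomial_of_def by (rule binomial_char_power[OF p'])
    also have "\<dots> \<in> J"
    proof (rule binomial_mem_lattice_ideal[OF lattice_Lambda])
      have "evec (pos_part (int (p ^ n) *s evec (pos_part a))) - evec (pos_part (int (p ^ n) *s evec (pos_part (- a))))
        = int (p ^ n) *s a"
        by (auto simp: vec_eq_iff algebra_simps)
      then show "evec (pos_part (int (p ^ n) *s evec (pos_part a))) - evec (pos_part (int (p ^ n) *s evec (pos_part (- a)))) \<in> \<Lambda>"
        using a(1) by simp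
    qed
    finally show ?thesis using JP prime_power[OF PP_D(1)[OF P]] by blast
  qed
qed

text \<open>The bound holds for all finite subsets, so finiteness comes with it. The choice p = 1 is
  allowed in every characteristic and supplies the finiteness needed for
  \<open>saturated_curve\<close>.\<close>

lemma PP_finite_le_index:
  assumes p: "p = 1 \<or> prime p \<and> CHAR('k) = p"
  shows "finite PP" and "card PP \<le> card (cosets (Lp p) Sat)"
proof -
  have p0: "p > 0" using p prime_gt_0_nat by auto
  have le: "card F \<le> card (cosets (Lp p) Sat)" if "F \<subseteq> PP" "finite F" for F
    using card_primes_le_index[OF lattice_Lp Lp_subset_Sat[OF p0] finite_cosets_Sat[OF lattice_Lp Lambda_subset_Lp]
        lattice_ideal_Lp_subset[OF p] that(2,1)] by simp
  then show "finite PP"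
    using finite_if_finite_subsets_card_bdd[of PP "card (cosets (Lp p) Sat)"] by blast
  then show "card PP \<le> card (cosets (Lp p) Sat)" using le by blast
qed

end

sublocale graded_matrix_ideal \<subseteq> curve: saturated_curve I max_ideal vars_prod PP "enat (CARD('s) - 1)"
proof (rule saturated_curve.intro)
  show "noetherian TYPE(('s, 'k) mpoly)" by (rule noetherian_mpoly)
  show "is_ideal I" by (rule ideal_I)
  show "is_prime (max_ideal :: ('s, 'k) mpoly set)" by (rule prime_max_ideal)
  show "A = max_ideal \<or> 1 \<in> A" if "is_ideal A" "max_ideal \<subseteq> A" for A :: "('s, 'k) mpoly set"
    using maximal_max_ideal that by blast
  show "(vars_prod :: ('s, 'k) mpoly) \<in> max_ideal"
    using vars_prod_prime_iff[OF prime_max_ideal] var_max_ideal by blast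
  show "finite PP" by (rule PP_finite_le_index(1)[of 1]) simp
  show "PP \<noteq> {}" by (rule PP_nonempty)
  show "prime_height ring_of_type_algebra P = enat (CARD('s) - 1) \<longleftrightarrow> P \<in> PP"
    if "is_prime P" "I \<subseteq> P" for P using height_PP that by blast
  show "P = P'" if "P \<in> PP" "P' \<in> PP" "P \<subseteq> P'" for P P' using PP_incomparable that by blast
next
  fix P assume P: "P \<in> PP"
  show "is_prime P" "I \<subseteq> P" using PP_D[OF P] by blast+
  show "vars_prod \<notin> P" using vars_prod_prime_iff[OF PP_D(1)[OF P]] PP_D(3)[OF P] by blast
  show "P \<subseteq> max_ideal" using PP_psubset_max[OF P] by blast
next
  fix N :: "('s, 'k) mpoly set" assume N: "is_prime N" "I \<subseteq> N"
  show "N = max_ideal" if "vars_prod \<in> N"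
    using that vars_prod_prime_iff[OF N(1)] prime_with_var[OF N] by blast
  show "\<exists>P\<in>PP. P \<subseteq> N" if "vars_prod \<notin> N"
    using that vars_prod_prime_iff[OF N(1)] star_mem_PP[OF N] star_subset[OF prime_ideal[OF N(1)]] by blast
next
  fix f :: "('s, 'k) mpoly" assume f: "is_prime (quot I f)" "vars_prod \<notin> quot I f"
  have "I \<subseteq> quot I f" using ideal_mult_right[OF ideal_I] by (auto simp: quot_iff)
  then show "quot I f \<in> PP"
    unfolding PP_def using f vars_prod_prime_iff[OF f(1)] homog_associated_prime[OF ideal_I homog f(1)] by blast
qed

section \<open>Characters of lattices over an algebraically closed field\<close>

text \<open>Roots are split off one at a time; simplicity passes to the cofactor and keeps it from
  vanishing at the removed root.\<close>

lemma card_roots_eq_degree: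
  fixes f :: "'k::field Polynomial.poly"
  assumes ac: "algebraically_closed_type TYPE('k)" and "f \<noteq> 0"
    and "\<And>x. Polynomial.poly f x = 0 \<Longrightarrow> Polynomial.poly (pderiv f) x \<noteq> 0"
  shows "card {x. Polynomial.poly f x = 0} = Polynomial.degree f"
  using assms(2,3)
proof (induction "Polynomial.degree f" arbitrary: f)
  case 0
  then obtain c where "f = [:c:]" by (metis degree_0_id)
  then show ?case using 0 by simp
next
  case (Suc n)
  then obtain a where a: "Polynomial.poly f a = 0"
    using ac unfolding algebraically_closed_type_def by (metis zero_less_Suc)
  then obtain q where q: "f = [:- a, 1:] * q" by (metis dvdE poly_eq_0_iff_dvd)
  have q0: "q \<noteq> 0" using Suc.prems(1) q by auto
  then have deg: "Polynomial.degree f = Suc (Polynomial.degree q)"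
    unfolding q by (subst degree_mult_eq) auto
  have der: "Polynomial.poly (pderiv f) x = Polynomial.poly q x + (x - a) * Polynomial.poly (pderiv q) x" for x
    unfolding q pderiv_mult by (simp add: pderiv_pCons algebra_simps)
  have qa: "Polynomial.poly q a \<noteq> 0" using Suc.prems(2)[OF a] by (simp add: der)
  have "card {x. Polynomial.poly q x = 0} = Polynomial.degree q"
  proof (rule Suc.hyps(1)[OF _ q0])
    show "n = Polynomial.degree q" using Suc.hyps(2) deg by simp
    fix x assume x: "Polynomial.poly q x = 0"
    then have "Polynomial.poly f x = 0" by (simp add: q)
    then show "Polynomial.poly (pderiv q) x \<noteq> 0" using Suc.prems(2)[of x] x by (auto simp: der)
  qed
  moreover have "{x. Polynomial.poly f x = 0} = insert a {x. Polynomial.poly q x = 0}"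
    unfolding q by auto
  ultimately show ?case using qa poly_roots_finite[OF q0] deg by simp
qed

text \<open>The derivative n z^(n-1) of z^n - w vanishes at most at 0, which is not a root.\<close>

lemma card_nth_roots_field:
  fixes w :: "'k::field"
  assumes ac: "algebraically_closed_type TYPE('k)" and n: "of_nat n \<noteq> (0 :: 'k)" and w: "w \<noteq> 0"
  shows "card {z. z ^ n = w} = n" "finite {z. z ^ n = w}"
proof -
  have n0: "n > 0" using n by (cases n) auto
  define f where "f = Polynomial.monom 1 n + [:- w:]"
  have deg: "Polynomial.degree f = n"
    unfolding f_def using n0 by (subst degree_add_eq_left) (auto simp: degree_monom_eq)
  have f: "{z. z ^ n = w} = {z. Polynomial.poly f z = 0}" by (auto simp: f_def poly_monom)
  have f0: "f \<noteq> 0" using deg n0 by auto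
  have "card {z. Polynomial.poly f z = 0} = Polynomial.degree f"
  proof (rule card_roots_eq_degree[OF ac f0])
    fix z assume "Polynomial.poly f z = 0"
    then have "z ^ n = w" by (simp add: f_def poly_monom)
    then have "z \<noteq> 0" using w n0 by (auto simp: zero_power)
    then show "Polynomial.poly (pderiv f) z \<noteq> 0"
      using n by (simp add: f_def pderiv_add pderiv_monom pderiv_pCons poly_monom)
  qed
  then show "card {z. z ^ n = w} = n" using f deg by simp
  show "finite {z. z ^ n = w}" unfolding f by (rule poly_roots_finite[OF f0])
qed

text \<open>Characters of the lattice \<open>B\<close> that are trivial on \<open>M\<close>, extended by \<open>0\<close> so that equality of functions
  is equality of characters.\<close>

definition character_on :: "(int ^ 's::finite) set \<Rightarrow> (int ^ 's) set \<Rightarrow> (int ^ 's \<Rightarrow> 'k::field) \<Rightarrow> bool" where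
  "character_on M B \<psi> \<longleftrightarrow> (\<forall>a\<in>B. \<forall>b\<in>B. \<psi> (a + b) = \<psi> a * \<psi> b) \<and> (\<forall>a\<in>M. \<psi> a = 1) \<and> (\<forall>a. a \<notin> B \<longrightarrow> \<psi> a = 0)"

context
  fixes M B :: "(int ^ 's::finite) set" and \<psi> :: "int ^ 's \<Rightarrow> 'k::field"
  assumes M: "is_lattice M" and B: "is_lattice B" and \<psi>: "character_on M B \<psi>"
begin

lemma char_add: "a \<in> B \<Longrightarrow> b \<in> B \<Longrightarrow> \<psi> (a + b) = \<psi> a * \<psi> b"
  and char_trivial: "a \<in> M \<Longrightarrow> \<psi> a = 1" and char_outside: "a \<notin> B \<Longrightarrow> \<psi> a = 0"
  using \<psi> by (simp_all add: character_on_def)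

lemma char_zero: "\<psi> 0 = 1"
  by (rule char_trivial[OF lattice_zero[OF M]])

lemma char_inverse: "a \<in> B \<Longrightarrow> \<psi> a * \<psi> (- a) = 1"
  using char_add[of a "- a"] lattice_uminus[OF B] char_zero by simp

lemma char_nonzero: "a \<in> B \<Longrightarrow> \<psi> a \<noteq> 0"
  using char_inverse by fastforce

lemma char_diff: "a \<in> B \<Longrightarrow> b \<in> B \<Longrightarrow> \<psi> (a - b) * \<psi> b = \<psi> a"
  using char_add[of "a - b" b] lattice_diff[OF B] by simp

lemma char_scale_nat:
  assumes a: "a \<in> B" shows "\<psi> (int n *s a) = \<psi> a ^ n"
proof (induction n)
  case (Suc n)
  have "int (Suc n) *s a = a + int n *s a" by (simp add: vec_eq_iff algebra_simps)
  then show ?case using char_add[OF a lattice_scale[OF B a]] Suc by simp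
qed (simp add: char_zero)

lemma char_scale:
  assumes a: "a \<in> B" shows "\<psi> (k *s a) = \<psi> a powi k"
proof (cases "k \<ge> 0")
  case True
  then show ?thesis using char_scale_nat[OF a, of "nat k"] by (simp add: power_int_def)
next
  case False
  then have "int (nat (- k)) *s (- a) = k *s a" by (simp add: vec_eq_iff)
  moreover have "\<psi> (- a) = inverse (\<psi> a)"
    using char_inverse[OF a] by (simp add: inverse_unique)
  ultimately show ?thesis
    using char_scale_nat[OF lattice_uminus[OF B a], of "nat (- k)"] False by (simp add: power_int_def)
qed

end

section \<open>Extending characters by one generator\<close>

definition adjoin :: "(int ^ 's::finite) set \<Rightarrow> int ^ 's \<Rightarrow> (int ^ 's) set" where
  "adjoin B g = {a. \<exists>k. a - k *s g \<in> B}"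

lemma lattice_adjoin:
  assumes B: "is_lattice B" shows "is_lattice (adjoin B g)" "B \<subseteq> adjoin B g" "g \<in> adjoin B g"
proof -
  have z: "0 \<in> B" by (rule lattice_zero[OF B])
  show sub: "B \<subseteq> adjoin B g" by (auto simp: adjoin_def intro!: exI[of _ 0])
  show "g \<in> adjoin B g" using z by (auto simp: adjoin_def intro!: exI[of _ 1])
  show "is_lattice (adjoin B g)"
    unfolding is_lattice_def
  proof (intro conjI ballI)
    show "0 \<in> adjoin B g" using z sub by blast
    fix a assume "a \<in> adjoin B g"
    then obtain k where k: "a - k *s g \<in> B" by (auto simp: adjoin_def)
    have e: "- a - (- k) *s g = - (a - k *s g)" by (simp add: vec_eq_iff)
    show "- a \<in> adjoin B g"
      unfolding adjoin_def mem_Collect_eq by (rule exI[of _ "- k"]) (simp only: e lattice_uminus[OF B k])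
    fix b assume "b \<in> adjoin B g"
    then obtain l where l: "b - l *s g \<in> B" by (auto simp: adjoin_def)
    have e: "(a + b) - (k + l) *s g = (a - k *s g) + (b - l *s g)" by (simp add: vec_eq_iff algebra_simps)
    show "a + b \<in> adjoin B g"
      unfolding adjoin_def mem_Collect_eq by (rule exI[of _ "k + l"]) (simp only: e lattice_add[OF B k l])
  qed
qed

definition order_mod :: "(int ^ 's::finite) set \<Rightarrow> int ^ 's \<Rightarrow> nat" where
  "order_mod B g = (LEAST n. n > 0 \<and> int n *s g \<in> B)"

context
  fixes B :: "(int ^ 's::finite) set" and g :: "int ^ 's" and m :: nat
  assumes B: "is_lattice B" and m: "m > 0" "int m *s g \<in> B"
begin

lemma order_mod: "order_mod B g > 0" "int (order_mod B g) *s g \<in> B"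
  using LeastI[of "\<lambda>n. n > 0 \<and> int n *s g \<in> B" m] m unfolding order_mod_def by auto

lemma order_mod_mod: "(k - k mod int (order_mod B g)) *s g \<in> B"
proof -
  let ?n = "int (order_mod B g)"
  have "(k - k mod ?n) *s g = (k div ?n) *s (?n *s g)"
    by (simp add: vec_eq_iff minus_mod_eq_div_mult)
  then show ?thesis using lattice_scale[OF B order_mod(2)] by simp
qed

lemma order_mod_dvd:
  assumes "k *s g \<in> B" shows "int (order_mod B g) dvd k"
proof -
  let ?n = "int (order_mod B g)"
  have "k *s g - (k - k mod ?n) *s g \<in> B" by (rule lattice_diff[OF B assms order_mod_mod])
  moreover have "k *s g - (k - k mod ?n) *s g = int (nat (k mod ?n)) *s g"
    using order_mod(1) by (simp add: vec_eq_iff algebra_simps)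
  ultimately have r: "int (nat (k mod ?n)) *s g \<in> B" by simp
  have "nat (k mod ?n) < order_mod B g" using order_mod(1) by (simp add: nat_less_iff)
  then have "\<not> (nat (k mod ?n) > 0 \<and> int (nat (k mod ?n)) *s g \<in> B)"
    unfolding order_mod_def by (rule not_less_Least)
  then have "k mod ?n = 0" using r order_mod(1) by (simp add: order.antisym)
  then show ?thesis by auto
qed

text \<open>A coset of \<open>B\<close> is determined by its coset modulo \<open>adjoin B g\<close>
  and by the multiple of \<open>g\<close>, reduced modulo the order, that leads to it from a chosen
  representative.\<close>

lemma card_cosets_adjoin:
  assumes fin: "finite (cosets (adjoin B g) UNIV)"
  shows "card (cosets B UNIV) \<le> order_mod B g * card (cosets (adjoin B g) UNIV)"
proof -
  let ?n = "order_mod B g" and ?B' = "adjoin B g"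
  define \<Phi> where "\<Phi> = (\<lambda>(C, r). {b. b - ((SOME s. s \<in> C) + int r *s g) \<in> B})"
  have "cosets B UNIV \<subseteq> \<Phi> ` (cosets ?B' UNIV \<times> {..<?n})"
  proof
    fix C assume "C \<in> cosets B UNIV"
    then obtain x where x: "C = {b. b - x \<in> B}" by (auto simp: cosets_def)
    let ?C' = "{b. b - x \<in> ?B'}"
    define s where "s = (SOME s. s \<in> ?C')"
    have "s \<in> ?C'" unfolding s_def
      by (rule someI[of _ x]) (simp add: lattice_zero[OF lattice_adjoin(1)[OF B]])
    then obtain k where k: "(s - x) - k *s g \<in> B" by (auto simp: adjoin_def)
    define r where "r = nat ((- k) mod int ?n)"
    have r: "int r = (- k) mod int ?n" "r < ?n"
      using order_mod(1) by (auto simp: r_def nat_less_iff)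
    have "(s - x) - k *s g - ((- k) - int r) *s g \<in> B"
      unfolding r(1) by (rule lattice_diff[OF B k order_mod_mod])
    moreover have "(s - x) - k *s g - ((- k) - int r) *s g = (s + int r *s g) - x"
      by (simp add: vec_eq_iff algebra_simps)
    ultimately have "x - (s + int r *s g) \<in> B" using lattice_diff_commute[OF B] by auto
    then have "C = \<Phi> (?C', r)" unfolding x \<Phi>_def prod.case s_def[symmetric] coset_eq_iff[OF B] .
    moreover have "?C' \<in> cosets ?B' UNIV" by (auto simp: cosets_def)
    ultimately show "C \<in> \<Phi> ` (cosets ?B' UNIV \<times> {..<?n})" using r(2) by blast
  qed
  then have "card (cosets B UNIV) \<le> card (\<Phi> ` (cosets ?B' UNIV \<times> {..<?n}))"
    using fin by (intro card_mono) auto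
  also have "\<dots> \<le> card (cosets ?B' UNIV \<times> {..<?n})" using fin by (intro card_image_le) auto
  finally show ?thesis by (simp add: card_cartesian_product mult.commute)
qed

text \<open>\<open>z\<close> is the prescribed value at \<open>g\<close>. The choice of
  \<open>k\<close> is immaterial once the power of \<open>z\<close> to the order of \<open>g\<close>
  is the value of \<psi> at that multiple of \<open>g\<close>.\<close>

definition extend_char :: "(int ^ 's \<Rightarrow> 'k::field) \<Rightarrow> 'k \<Rightarrow> int ^ 's \<Rightarrow> 'k" where
  "extend_char \<psi> z a = (if a \<in> adjoin B g
     then let k = (SOME k. a - k *s g \<in> B) in \<psi> (a - k *s g) * z powi k else 0)"

context
  fixes M :: "(int ^ 's) set" and \<psi> :: "int ^ 's \<Rightarrow> 'k::field" and z :: 'k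
  assumes M: "is_lattice M" "M \<subseteq> B" and \<psi>: "character_on M B \<psi>"
    and z: "z ^ order_mod B g = \<psi> (int (order_mod B g) *s g)"
begin

lemma ext_z_nonzero: "z \<noteq> 0"
  using z char_nonzero[OF M(1) B \<psi> order_mod(2)] order_mod(1) by (auto simp: zero_power)

lemma char_multiple_g:
  assumes "k *s g \<in> B" shows "\<psi> (k *s g) = z powi k"
proof -
  let ?n = "order_mod B g"
  obtain j where j: "k = int ?n * j" using order_mod_dvd[OF assms] by (auto elim: dvdE)
  have "k *s g = j *s (int ?n *s g)" by (simp add: j vec_eq_iff mult.commute)
  then have "\<psi> (k *s g) = (z ^ ?n) powi j" using char_scale[OF M(1) B \<psi> order_mod(2)] z by simp
  also have "\<dots> = z powi k" by (simp add: j power_int_mult)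
  finally show ?thesis .
qed

text \<open>Two admissible \<open>k\<close> differ by a number whose multiple of \<open>g\<close> is
  in \<open>B\<close>, and there \<psi> agrees with the powers of \<open>z\<close>.\<close>

lemma extend_char_eq:
  assumes k: "a - k *s g \<in> B" shows "extend_char \<psi> z a = \<psi> (a - k *s g) * z powi k"
proof -
  define l where "l = (SOME k. a - k *s g \<in> B)"
  have l: "a - l *s g \<in> B" unfolding l_def by (rule someI[where P = "\<lambda>k. a - k *s g \<in> B", OF k])
  have e: "(k - l) *s g = (a - l *s g) - (a - k *s g)" by (simp add: vec_eq_iff algebra_simps)
  have kl: "(k - l) *s g \<in> B" unfolding e by (rule lattice_diff[OF B l k])
  have e': "a - l *s g = (a - k *s g) + (k - l) *s g" by (simp add: vec_eq_iff algebra_simps)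
  have "\<psi> (a - l *s g) = \<psi> (a - k *s g) * z powi (k - l)"
    by (simp only: e' char_add[OF M(1) B \<psi> k kl] char_multiple_g[OF kl])
  then have "\<psi> (a - l *s g) * z powi l = \<psi> (a - k *s g) * (z powi (k - l) * z powi l)" by simp
  also have "z powi (k - l) * z powi l = z powi k" using ext_z_nonzero by (simp flip: power_int_add)
  finally have "\<psi> (a - l *s g) * z powi l = \<psi> (a - k *s g) * z powi k" .
  moreover have "a \<in> adjoin B g" using k by (auto simp: adjoin_def)
  ultimately show ?thesis by (simp add: extend_char_def l_def[symmetric])
qed

lemma extend_char_on: "a \<in> B \<Longrightarrow> extend_char \<psi> z a = \<psi> a"
  using extend_char_eq[of a 0] by simp

lemma extend_char_at: "extend_char \<psi> z g = z"
  using extend_char_eq[of g 1] lattice_zero[OF B] char_zero[OF M(1) B \<psi>] by simp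

lemma character_extend_char: "character_on M (adjoin B g) (extend_char \<psi> z)"
  unfolding character_on_def
proof (intro conjI ballI allI impI)
  fix a b assume "a \<in> adjoin B g" "b \<in> adjoin B g"
  then obtain k l where k: "a - k *s g \<in> B" and l: "b - l *s g \<in> B" by (auto simp: adjoin_def)
  have e: "(a + b) - (k + l) *s g = (a - k *s g) + (b - l *s g)" by (simp add: vec_eq_iff algebra_simps)
  have "extend_char \<psi> z (a + b) = \<psi> ((a + b) - (k + l) *s g) * z powi (k + l)"
    by (rule extend_char_eq) (simp only: e lattice_add[OF B k l])
  also have "\<dots> = (\<psi> (a - k *s g) * z powi k) * (\<psi> (b - l *s g) * z powi l)"
    unfolding e char_add[OF M(1) B \<psi> k l] using ext_z_nonzero by (simp add: power_int_add)
  finally show "extend_char \<psi> z (a + b) = extend_char \<psi> z a * extend_char \<psi> z b"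
    by (simp add: extend_char_eq[OF k] extend_char_eq[OF l])
next
  fix a assume "a \<in> M"
  then show "extend_char \<psi> z a = 1" using extend_char_on M(2) char_trivial[OF M(1) B \<psi>] by auto
qed (simp add: extend_char_def)

end

end

text \<open>A character has one extension for each root \<open>z\<close>. The number of roots is the
  full order of \<open>g\<close>, because this order divides \<open>m\<close> and so is nonzero in
  the field.\<close>

lemma characters_adjoin:
  fixes Y :: "(int ^ 's::finite \<Rightarrow> 'k::field) set"
  assumes ac: "algebraically_closed_type TYPE('k)" and M: "is_lattice M" "M \<subseteq> B" and B: "is_lattice B"
    and m: "m > 0" "of_nat m \<noteq> (0 :: 'k)" "\<And>a. int m *s a \<in> M"
    and Y: "finite Y" "\<And>\<psi>. \<psi> \<in> Y \<Longrightarrow> character_on M B \<psi>"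
  shows "\<exists>Y' :: (int ^ 's \<Rightarrow> 'k) set. finite Y' \<and> (\<forall>\<psi>\<in>Y'. character_on M (adjoin B g) \<psi>) \<and>
    card Y' = order_mod B g * card Y"
proof -
  let ?n = "order_mod B g"
  have mg: "int m *s g \<in> B" using m(3) M(2) by blast
  have "int ?n dvd int m" by (rule order_mod_dvd[OF B m(1) mg mg])
  then have "?n dvd m" by simp
  then have n: "of_nat ?n \<noteq> (0 :: 'k)" using m(2) by (metis dvdE mult_zero_left of_nat_mult)
  define R where "R = (\<lambda>\<psi> :: int ^ 's \<Rightarrow> 'k. {z. z ^ ?n = \<psi> (int ?n *s g)})"
  have R: "card (R \<psi>) = ?n" "finite (R \<psi>)" if "\<psi> \<in> Y" for \<psi>
    unfolding R_def
    using card_nth_roots_field[OF ac n char_nonzero[OF M(1) B Y(2)[OF that] order_mod(2)[OF B m(1) mg]]] by auto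
  define Y' where "Y' = (\<lambda>(\<psi>, z). extend_char B g \<psi> z) ` (SIGMA \<psi>:Y. R \<psi>)"
  have "inj_on (\<lambda>(\<psi>, z). extend_char B g \<psi> z) (SIGMA \<psi>:Y. R \<psi>)"
  proof (rule inj_onI, clarify)
    fix \<psi> z \<psi>' z'
    assume a: "\<psi> \<in> Y" "z \<in> R \<psi>" "\<psi>' \<in> Y" "z' \<in> R \<psi>'" "extend_char B g \<psi> z = extend_char B g \<psi>' z'"
    note e = extend_char_on[OF B m(1) mg M Y(2)] extend_char_at[OF B m(1) mg M Y(2)]
    have "\<psi> b = \<psi>' b" for b
    proof (cases "b \<in> B")
      case True
      then show ?thesis using e(1)[OF a(1) _ True, of z] e(1)[OF a(3) _ True, of z'] a by (simp add: R_def)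
    next
      case False
      then show ?thesis using char_outside[OF M(1) B Y(2)[OF a(1)]] char_outside[OF M(1) B Y(2)[OF a(3)]] by simp
    qed
    moreover have "z = z'" using e(2)[OF a(1), of z] e(2)[OF a(3), of z'] a by (simp add: R_def)
    ultimately show "\<psi> = \<psi>' \<and> z = z'" by auto
  qed
  then have "card Y' = card (SIGMA \<psi>:Y. R \<psi>)" unfolding Y'_def by (rule card_image)
  also have "\<dots> = (\<Sum>\<psi>\<in>Y. card (R \<psi>))" using Y(1) R by (intro card_SigmaI) auto
  also have "\<dots> = ?n * card Y" using R by simp
  finally have "card Y' = ?n * card Y" .
  moreover have "finite Y'" unfolding Y'_def using Y(1) R by (intro finite_imageI finite_SigmaI) auto
  moreover have "\<forall>\<psi>\<in>Y'. character_on M (adjoin B g) \<psi>"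
    unfolding Y'_def R_def using character_extend_char[OF B m(1) mg M Y(2)] by auto
  ultimately show ?thesis by blast
qed

text \<open>Unit vectors are adjoined to \<open>M\<close> one by one. Each step multiplies the
  number of characters by the order of the vector and divides the index by at most this order, so
  their product never drops below the initial index; at the end the index is 1.\<close>

lemma many_characters:
  assumes ac: "algebraically_closed_type TYPE('k::field)" and M: "is_lattice (M :: (int ^ 's::finite) set)"
    and m: "m > 0" "of_nat m \<noteq> (0 :: 'k)" "\<And>a. int m *s a \<in> M"
  shows "\<exists>Y :: (int ^ 's \<Rightarrow> 'k) set. finite Y \<and> (\<forall>\<psi>\<in>Y. character_on M UNIV \<psi>) \<and>
    card (cosets M UNIV) \<le> card Y"
proof -
  have fin: "finite (cosets B UNIV)" if "is_lattice B" "M \<subseteq> B" for B :: "(int ^ 's) set"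
    using m(3) that(2) by (intro finite_cosets_UNIV[OF that(1) m(1)]) blast
  have "\<exists>B. is_lattice B \<and> M \<subseteq> B \<and> (\<forall>i\<in>A. axis i 1 \<in> B) \<and>
    (\<exists>Y :: (int ^ 's \<Rightarrow> 'k) set. finite Y \<and> (\<forall>\<psi>\<in>Y. character_on M B \<psi>) \<and>
      card (cosets M UNIV) \<le> card Y * card (cosets B UNIV))" if "finite A" for A :: "'s set"
    using that
  proof (induction A rule: finite_induct)
    case empty
    have "character_on M M (\<lambda>a. if a \<in> M then 1 else 0 :: 'k)"
      unfolding character_on_def by (auto simp: lattice_add[OF M])
    then show ?case using M
      by (intro exI[of _ M] conjI exI[of _ "{\<lambda>a. if a \<in> M then 1 else 0 :: 'k}"]) auto
  next
    case (insert i A)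
    then obtain B Y where B: "is_lattice B" "M \<subseteq> B" "\<forall>i\<in>A. axis i 1 \<in> B"
      and Y: "finite Y" "\<forall>\<psi>\<in>Y. character_on M B (\<psi> :: int ^ 's \<Rightarrow> 'k)"
        "card (cosets M UNIV) \<le> card Y * card (cosets B UNIV)" by blast
    let ?g = "axis i 1 :: int ^ 's"
    obtain Y' :: "(int ^ 's \<Rightarrow> 'k) set" where Y': "finite Y'" "\<forall>\<psi>\<in>Y'. character_on M (adjoin B ?g) \<psi>"
      "card Y' = order_mod B ?g * card Y"
      using characters_adjoin[OF ac M B(2,1) m Y(1), of ?g] Y(2) by blast
    note B' = lattice_adjoin[OF B(1), of ?g]
    have "card (cosets M UNIV) \<le> card Y * card (cosets B UNIV)" by (rule Y(3))
    also have "\<dots> \<le> card Y * (order_mod B ?g * card (cosets (adjoin B ?g) UNIV))"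
      using card_cosets_adjoin[OF B(1) m(1) _ fin[OF B'(1)], of] m(3) B B' by (intro mult_left_mono) auto
    also have "\<dots> = card Y' * card (cosets (adjoin B ?g) UNIV)" using Y'(3) by simp
    finally show ?case using B B' Y'
      by (intro exI[of _ "adjoin B ?g"] conjI exI[of _ Y']) auto
  qed
  from this[OF finite[of UNIV]] obtain B and Y :: "(int ^ 's \<Rightarrow> 'k) set"
    where B: "is_lattice B" "M \<subseteq> B" "\<And>i. axis i 1 \<in> B"
    and Y: "finite Y" "\<forall>\<psi>\<in>Y. character_on M B \<psi>"
        "card (cosets M UNIV) \<le> card Y * card (cosets B UNIV)" by blast
  have "a \<in> B" for a
  proof -
    have "a = (\<Sum>i\<in>UNIV. a $ i *s axis i 1)"
      unfolding axis_def by (simp add: vec_eq_iff if_distrib cong: if_cong)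
    also have "\<dots> \<in> B" by (intro lattice_sum[OF B(1)] lattice_scale[OF B(1)] B(3))
    finally show ?thesis .
  qed
  then have "B = UNIV" by auto
  moreover have "cosets (UNIV :: (int ^ 's) set) UNIV = {UNIV}" by (auto simp: cosets_def)
  ultimately show ?thesis using Y by auto
qed

lemma card_image_eq_if_same_fibres:
  assumes "\<And>x y. x \<in> A \<Longrightarrow> y \<in> A \<Longrightarrow> f x = f y \<longleftrightarrow> g x = g y"
  shows "card (f ` A) = card (g ` A)"
proof -
  define \<phi> where "\<phi> = (\<lambda>z. g (inv_into A f z))"
  have \<phi>: "\<phi> (f x) = g x" if "x \<in> A" for x
    unfolding \<phi>_def using assms[of "inv_into A f (f x)" x] that
    by (simp add: f_inv_into_f inv_into_into)
  have "inj_on \<phi> (f ` A)" using assms \<phi> by (auto intro!: inj_onI)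
  moreover have "\<phi> ` f ` A = g ` A" using \<phi> by (auto simp: image_image)
  ultimately show ?thesis using card_image by metis
qed

section \<open>Lower bound for the number of primes over an algebraically closed field\<close>

context graded_matrix_ideal
begin

text \<open>\<open>v\<close> has the least positive weighted degree, so division with remainder
  brings every vector into \<open>Sat\<close>.\<close>

lemma Sat_complement: "\<exists>v. dotp dd v \<noteq> 0 \<and> (\<forall>a. \<exists>q. a - q *s v \<in> Sat)"
proof -
  define D where "D = (\<lambda>a :: int ^ 's. \<Sum>i\<in>UNIV. int (d i) * a $ i)"
  have D: "dotp dd a = of_int (D a)" for a by (simp add: D_def dotp_def)
  have D_lin: "D (a - q *s v) = D a - q * D v" for a v q
  proof -
    have "of_int (D (a - q *s v)) = (of_int (D a - q * D v) :: rat)"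
      using D[of "a - q *s v"] D[of a] D[of v] by (simp add: dotp_diff dotp_scale)
    then show ?thesis by (simp only: of_int_eq_iff)
  qed
  let ?Q = "\<lambda>n. n > 0 \<and> (\<exists>v. D v = int n)"
  have "D (axis undefined 1) = int (d undefined)"
    unfolding D_def axis_def by (simp add: if_distrib cong: if_cong)
  then have "?Q (d undefined)" using d_pos by blast
  then have Q: "?Q (LEAST n. ?Q n)" by (rule LeastI)
  define \<delta> where "\<delta> = (LEAST n. ?Q n)"
  obtain v where v: "D v = int \<delta>" "\<delta> > 0" using Q unfolding \<delta>_def by blast
  have "a - (D a div int \<delta>) *s v \<in> Sat" for a
  proof -
    let ?b = "a - (D a div int \<delta>) *s v"
    have Db: "D ?b = D a mod int \<delta>" by (simp add: D_lin v minus_div_mult_eq_mod)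
    have "nat (D ?b) < \<delta>" unfolding Db using v(2) by (simp add: nat_less_iff)
    then have "\<not> ?Q (nat (D ?b))" unfolding \<delta>_def by (rule not_less_Least)
    moreover have "D ?b \<ge> 0" unfolding Db using v(2) by simp
    ultimately have "D ?b = 0" by (cases "D ?b = 0") auto
    then show ?thesis by (simp add: Sat_def D)
  qed
  moreover have "dotp dd v \<noteq> 0" using v by (simp add: D)
  ultimately show ?thesis by blast
qed

lemma Sat_exponent_coprime:
  assumes p: "p = 1 \<and> CHAR('k) = 0 \<or> prime p \<and> CHAR('k) = p"
  shows "\<exists>m k. m > 0 \<and> coprime m p \<and> of_nat m \<noteq> (0 :: 'k) \<and> (\<forall>a\<in>Sat. int (m * p ^ k) *s a \<in> \<Lambda>)"
proof -
  obtain M where M: "M > 0" "\<forall>a\<in>Sat. int M *s a \<in> \<Lambda>" using Sat_exponent by blast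
  show ?thesis
  proof (cases "p = 1")
    case True
    then have "CHAR('k) = 0" using p by auto
    then have "of_nat M \<noteq> (0 :: 'k)" using M(1) by (simp add: of_nat_eq_0_iff_char_dvd)
    then show ?thesis using M True by (intro exI[of _ M] exI[of _ 0]) auto
  next
    case False
    then have p': "prime p" "CHAR('k) = p" using p by auto
    obtain k m where km: "\<not> p dvd m" "M = m * p ^ k"
      using prime_power_canonical[OF p'(1) M(1)] by blast
    then have "of_nat m \<noteq> (0 :: 'k)" using p' by (simp add: of_nat_eq_0_iff_char_dvd)
    moreover have "coprime m p" by (rule coprime_commute[THEN iffD1]) (rule prime_imp_coprime[OF p'(1) km(1)])
    moreover have "m > 0" using km M(1) by auto
    ultimately show ?thesis using km(2) M(2) by blast
  qed
qed

text \<open>A character trivial on \<open>M\<close> is a zero of \<open>I\<close> with nonzero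
  coordinates, and the homogeneous part of the evaluation kernel there is a member of
  \<open>PP\<close>. Requiring the value 1 at \<open>v\<close> removes the freedom that homogeneous
  primes cannot detect.\<close>

lemma index_le_card_PP:
  assumes ac: "algebraically_closed_type TYPE('k)"
    and p: "p = 1 \<and> CHAR('k) = 0 \<or> prime p \<and> CHAR('k) = p"
  shows "card (cosets (Lp p) Sat) \<le> card PP"
proof -
  have p0: "p > 0" using p prime_gt_0_nat by auto
  note lat = lattice_Lp[of p]
  obtain v where v: "dotp dd v \<noteq> 0" "\<And>a. \<exists>q. a - q *s v \<in> Sat" using Sat_complement by blast
  obtain m k where m: "m > 0" "of_nat m \<noteq> (0 :: 'k)" "\<forall>a\<in>Sat. int (m * p ^ k) *s a \<in> \<Lambda>"
    using Sat_exponent_coprime[OF p] by blast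
  \<comment> \<open>\<open>Lp p\<close> has infinite index among all integer vectors. With
    \<open>v\<close> added, \<open>m\<close> times any vector is in \<open>M\<close>, so
    \<open>many_characters\<close> applies, while intersecting cosets with \<open>Sat\<close>
    recovers those of \<open>Lp p\<close>.\<close>
  define M where "M = adjoin (Lp p) v"
  have latM: "is_lattice M" "Lp p \<subseteq> M" "v \<in> M" unfolding M_def by (rule lattice_adjoin[OF lat])+
  have mM: "int m *s a \<in> M" for a
  proof -
    obtain q where q: "a - q *s v \<in> Sat" using v(2) by blast
    have e: "int (p ^ k) *s (int m *s (a - q *s v)) = int (m * p ^ k) *s (a - q *s v)"
      by (simp add: vec_eq_iff algebra_simps)
    have "int m *s (a - q *s v) \<in> Lp p"
      unfolding Lp_def mem_Collect_eq by (rule exI[of _ k]) (simp only: e m(3)[rule_format, OF q])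
    then have "int m *s (a - q *s v) + (int m * q) *s v \<in> M"
      by (intro lattice_add[OF latM(1) subsetD[OF latM(2)] lattice_scale[OF latM(1,3)]])
    also have "int m *s (a - q *s v) + (int m * q) *s v = int m *s a"
      by (simp add: vec_eq_iff algebra_simps)
    finally show ?thesis .
  qed
  obtain Y :: "(int ^ 's \<Rightarrow> 'k) set" where Y: "finite Y" "\<And>\<psi>. \<psi> \<in> Y \<Longrightarrow> character_on M UNIV \<psi>"
    "card (cosets M UNIV) \<le> card Y" using many_characters[OF ac latM(1) m(1,2) mM] by blast
  have UNIV: "is_lattice (UNIV :: (int ^ 's) set)" by (simp add: is_lattice_def)
  have finM: "finite (cosets M UNIV)" by (rule finite_cosets_UNIV[OF latM(1) m(1) mM])
  have "cosets (Lp p) Sat \<subseteq> (\<lambda>C. C \<inter> Sat) ` cosets M UNIV"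
  proof
    fix C assume "C \<in> cosets (Lp p) Sat"
    then obtain a where a: "a \<in> Sat" "C = {b. b - a \<in> Lp p}" by (auto simp: cosets_def)
    have "b - a \<in> Lp p \<longleftrightarrow> b - a \<in> M \<and> b \<in> Sat" for b
    proof
      assume b: "b - a \<in> Lp p"
      then have "(b - a) + a \<in> Sat" using Lp_subset_Sat[OF p0] a lattice_add[OF lattice_Sat] by blast
      then show "b - a \<in> M \<and> b \<in> Sat" using b latM(2) by auto
    next
      assume b: "b - a \<in> M \<and> b \<in> Sat"
      then obtain q where q: "(b - a) - q *s v \<in> Lp p" unfolding M_def adjoin_def by blast
      then have "dotp dd ((b - a) - q *s v) = 0" using Lp_subset_Sat[OF p0] by (auto simp: Sat_def)
      then have "of_int q * dotp dd v = 0" using a b by (simp add: dotp_diff dotp_scale Sat_def)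
      then have "q = 0" using v(1) by simp
      then show "b - a \<in> Lp p" using q by simp
    qed
    then have "C = {b. b - a \<in> M} \<inter> Sat" unfolding a by blast
    then show "C \<in> (\<lambda>C. C \<inter> Sat) ` cosets M UNIV" unfolding cosets_def by blast
  qed
  then have "card (cosets (Lp p) Sat) \<le> card ((\<lambda>C. C \<inter> Sat) ` cosets M UNIV)"
    using finM by (intro card_mono) auto
  also have "\<dots> \<le> card (cosets M UNIV)" by (rule card_image_le[OF finM])
  also note Y(3)
  also have "card Y \<le> card PP"
  proof (rule card_inj_on_le)
    let ?c = "\<lambda>\<psi> :: int ^ 's \<Rightarrow> 'k. \<lambda>i. \<psi> (axis i 1)"
    let ?P = "\<lambda>\<psi>. star d {f :: ('s, 'k) mpoly. poly_subst id (?c \<psi>) f = 0}"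
    have ev: "(\<Prod>i\<in>UNIV. ?c \<psi> i ^ ex e i) = \<psi> (evec e)" if \<psi>: "\<psi> \<in> Y" for \<psi> e
    proof -
      note ch = latM(1) UNIV Y(2)[OF \<psi>]
      have "\<psi> (\<Sum>i\<in>A. int (ex e i) *s axis i 1) = (\<Prod>i\<in>A. ?c \<psi> i ^ ex e i)" if "finite A" for A
        using that
        by (induction A rule: finite_induct)
           (auto simp: char_zero[OF ch] char_add[OF ch] char_scale_nat[OF ch])
      moreover have "(\<Sum>i\<in>UNIV. int (ex e i) *s axis i 1) = evec e"
        unfolding axis_def by (simp add: vec_eq_iff if_distrib cong: if_cong)
      ultimately show ?thesis by (metis finite)
    qed
    show "?P ` Y \<subseteq> PP"
    proof
      fix P assume "P \<in> ?P ` Y"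
      then obtain \<psi> where \<psi>: "\<psi> \<in> Y" "P = ?P \<psi>" by blast
      note ch = latM(1) UNIV Y(2)[OF \<psi>(1)]
      let ?K = "{f :: ('s, 'k) mpoly. poly_subst id (?c \<psi>) f = 0}"
      have "I \<subseteq> ?K"
        unfolding I_eq
      proof (intro matrix_ideal_least eval.ideal_kernel)
        fix j
        let ?a = "column j L"
        have "?a \<in> M" using column_in_lattice[of j L] Lambda_subset_Lp latM(2) by blast
        then have "\<psi> (evec (pos_part ?a) - evec (pos_part (- ?a))) = 1"
          unfolding evec_pos_part by (rule char_trivial[OF ch])
        then have "\<psi> (evec (pos_part ?a)) = \<psi> (evec (pos_part (- ?a)))"
          using char_diff[OF ch, of "evec (pos_part ?a)" "evec (pos_part (- ?a))"] by simp
        then show "binomial_of ?a \<in> ?K" by (simp only: mem_Collect_eq eval_binomial ev[OF \<psi>(1)]) simp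
      qed
      moreover have "var i \<notin> ?K" for i
      proof -
        have "poly_subst id (?c \<psi>) (var i :: ('s, 'k) mpoly) = \<psi> (evec (Poly_Mapping.single i 1))"
          unfolding var_def eval.poly_subst_mon ev[OF \<psi>(1)] by simp
        then show ?thesis using char_nonzero[OF ch] by simp
      qed
      ultimately show "P \<in> PP" unfolding \<psi>(2) by (intro star_mem_PP prime_eval_kernel)
    qed
    show "inj_on ?P Y"
    proof (rule inj_onI)
      fix \<psi> \<psi>' assume a: "\<psi> \<in> Y" "\<psi>' \<in> Y" "?P \<psi> = ?P \<psi>'"
      note ch = latM(1) UNIV Y(2)[OF a(1)] and ch' = latM(1) UNIV Y(2)[OF a(2)]
      have Sat_eq: "\<psi> b = \<psi>' b" if b: "b \<in> Sat" for b
      proof -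
        \<comment> \<open>A binomial twisted by the value of \<psi> at \<open>b\<close>. It is
          homogeneous because \<open>b\<close> is in \<open>Sat\<close>, so it lies in the common
          prime and forces \<psi>' to take the same value.\<close>
        define f :: "('s, 'k) mpoly" where "f = mon (pos_part b) 1 - mon (pos_part (- b)) (\<psi> b)"
        have evf: "poly_subst id (?c \<phi>) f = \<phi> (evec (pos_part b)) - \<psi> b * \<phi> (evec (pos_part (- b)))"
          if "\<phi> \<in> Y" for \<phi>
          unfolding f_def eval.poly_subst_diff eval.poly_subst_mon ev[OF that] by simp
        have b': "evec (pos_part b) - evec (pos_part (- b)) = b" by (rule evec_pos_part)
        have "rat_of_nat (wt d (pos_part b)) = rat_of_nat (wt d (pos_part (- b)))"
          using b by (simp add: Sat_def dotp_pos_part[of dd b] dotp_evec_wt)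
        then have w: "wt d (pos_part b) = wt d (pos_part (- b))" by (simp only: of_nat_eq_iff)
        have "poly_subst id (?c \<psi>) f = 0"
          using char_diff[OF ch, of "evec (pos_part b)" "evec (pos_part (- b))"] unfolding evf[OF a(1)] b' by simp
        then have "f \<in> ?P \<psi>"
          using w by (auto simp: star_def f_def hc_diff hc_mon eval.poly_subst_zero)
        then have "f \<in> ?P \<psi>'" using a(3) by simp
        then have "poly_subst id (?c \<psi>') f = 0" using star_subset[OF eval.ideal_kernel] by blast
        then have "\<psi>' (evec (pos_part b)) = \<psi> b * \<psi>' (evec (pos_part (- b)))" unfolding evf[OF a(2)] by simp
        moreover have "\<psi>' b * \<psi>' (evec (pos_part (- b))) = \<psi>' (evec (pos_part b))"
          using char_diff[OF ch', of "evec (pos_part b)" "evec (pos_part (- b))"] unfolding b' by simp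
        moreover have "\<psi>' (evec (pos_part (- b))) \<noteq> 0" by (rule char_nonzero[OF ch']) simp
        ultimately show ?thesis by simp
      qed
      show "\<psi> = \<psi>'"
      proof
        fix b
        obtain q where q: "b - q *s v \<in> Sat" using v(2) by blast
        have qv: "q *s v \<in> M" by (rule lattice_scale[OF latM(1,3)])
        have "\<psi> b = \<psi> (b - q *s v)"
          using char_diff[OF ch, of b "q *s v"] char_trivial[OF ch qv] by simp
        also have "\<dots> = \<psi>' (b - q *s v)" by (rule Sat_eq[OF q])
        also have "\<dots> = \<psi>' b" using char_diff[OF ch', of b "q *s v"] char_trivial[OF ch' qv] by simp
        finally show "\<psi> b = \<psi>' b" .
      qed
    qed
    show "finite PP" by (rule PP_finite_le_index(1)[of 1]) simp
  qed
  finally show ?thesis .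
qed

end

section \<open>The torsion of the quotient group\<close>

context graded_matrix_ideal
begin

abbreviation QG :: "(int ^ 's) set monoid" where "QG \<equiv> int_vec_group Mod \<Lambda>"

abbreviation cs :: "int ^ 's \<Rightarrow> (int ^ 's) set" where "cs a \<equiv> {b. b - a \<in> \<Lambda>}"

lemma r_coset_eq: "\<Lambda> #>\<^bsub>int_vec_group\<^esub> a = cs a"
proof -
  have "b \<in> (\<Union>h\<in>\<Lambda>. {h + a}) \<longleftrightarrow> b - a \<in> \<Lambda>" for b
    by (auto intro!: bexI[of _ "b - a"])
  then show ?thesis unfolding r_coset_def by auto
qed

lemma normal_Lambda: "\<Lambda> \<lhd> int_vec_group"
proof -
  interpret comm_group "int_vec_group :: (int ^ 's) monoid" by (rule comm_group_int_vec_group)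
  show ?thesis
    by (rule subgroup_imp_normal) (simp add: column_lattice_def generate_is_subgroup)
qed

lemma comm_group_QG: "comm_group QG"
  using comm_group.abelian_FactGroup[OF comm_group_int_vec_group normal_imp_subgroup[OF normal_Lambda]] .

lemma group_QG: "group QG"
  using comm_group_QG by (simp add: comm_group_def)

lemma carrier_QG: "carrier QG = Set.range cs"
  unfolding carrier_FactGroup r_coset_eq by simp

lemma cs_carrier: "cs a \<in> carrier QG"
  unfolding carrier_QG by blast

lemma cs_eq_iff: "cs a = cs b \<longleftrightarrow> a - b \<in> \<Lambda>"
  by (rule coset_eq_iff[OF lattice_Lambda])

lemma cs_zero: "cs 0 = \<one>\<^bsub>QG\<^esub>"
  by simp

lemma cs_one_iff: "cs a = \<one>\<^bsub>QG\<^esub> \<longleftrightarrow> a \<in> \<Lambda>"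
  using cs_eq_iff[of a 0] cs_zero by simp

lemma mult_QG: "cs a \<otimes>\<^bsub>QG\<^esub> cs b = cs (a + b)"
  using normal.rcos_sum[OF normal_Lambda, of a b] unfolding r_coset_eq by simp

lemma inv_QG: "inv\<^bsub>QG\<^esub> cs a = cs (- a)"
proof (rule group.inv_equality[OF group_QG])
  show "cs (- a) \<otimes>\<^bsub>QG\<^esub> cs a = \<one>\<^bsub>QG\<^esub>" unfolding mult_QG using cs_zero by simp
qed (rule cs_carrier)+

lemma pow_QG: "cs a [^]\<^bsub>QG\<^esub> (n :: nat) = cs (int n *s a)"
proof (induction n)
  case 0
  then show ?case using cs_zero by (simp add: nat_pow_def)
next
  case (Suc n)
  interpret Q: group QG by (rule group_QG)
  have "int (Suc n) *s a = int n *s a + a" by (simp add: vec_eq_iff algebra_simps)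
  then show ?case using Suc mult_QG[of "int n *s a" a] by (simp only: Q.nat_pow_Suc)
qed

lemma torsion_QG: "torsion_subgroup QG = cosets \<Lambda> Sat"
proof -
  have "(\<exists>n::nat. n > 0 \<and> cs a [^]\<^bsub>QG\<^esub> n = \<one>\<^bsub>QG\<^esub>) \<longleftrightarrow> a \<in> Sat" for a
    unfolding pow_QG cs_one_iff
  proof
    assume "\<exists>n::nat. n > 0 \<and> int n *s a \<in> \<Lambda>"
    then obtain n :: nat where "n > 0" "int n *s a \<in> Sat" using Lambda_subset_Sat by blast
    then show "a \<in> Sat" by (simp add: Sat_def dotp_scale)
  qed (use Sat_exponent in blast)
  then show ?thesis unfolding torsion_subgroup_def carrier_QG cosets_def by auto
qed

lemma card_torsion: "card (torsion_subgroup QG) = card (cosets (Lp 1) Sat)"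
  by (simp only: torsion_QG Lp_one)

lemma pow_card_subgroup:
  assumes "subgroup H G" "finite H" "x \<in> H" "group G"
  shows "x [^]\<^bsub>G\<^esub> card H = \<one>\<^bsub>G\<^esub>"
proof -
  interpret G: group G by fact
  have "x [^]\<^bsub>G\<lparr>carrier := H\<rparr>\<^esub> Coset.order (G\<lparr>carrier := H\<rparr>) = \<one>\<^bsub>G\<lparr>carrier := H\<rparr>\<^esub>"
    using assms by (intro group.pow_order_eq_1 subgroup.subgroup_is_group) auto
  then show ?thesis by (simp add: Coset.order_def G.nat_pow_consistent[symmetric])
qed

text \<open>With \<open>m\<close> the prime-to-p factor of an exponent of the torsion group, its
  \<open>m\<close>-torsion is the part of order prime to p.\<close>

definition prime_part :: "nat \<Rightarrow> (int ^ 's) set set" where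
  "prime_part m = cs ` {a \<in> Sat. int m *s a \<in> \<Lambda>}"

text \<open>For the cardinality, multiplication by p^k maps \<open>Sat\<close> onto this subgroup,
  with the cosets of \<open>Lp p\<close> as fibres.\<close>

lemma prime_part_largest:
  assumes p: "prime p" and m: "m > 0" "coprime m p" "\<forall>a\<in>Sat. int (m * p ^ k) *s a \<in> \<Lambda>"
  shows "largest_torsion_subgroup_coprime_to p QG (prime_part m)"
    and "card (prime_part m) = card (cosets (Lp p) Sat)"
proof -
  interpret Q: group QG by (rule group_QG)
  let ?S = "{a \<in> Sat. int m *s a \<in> \<Lambda>}" and ?G = "prime_part m"
  have sub: "subgroup ?G QG"
  proof (rule Q.subgroupI)
    show "?G \<subseteq> carrier QG" unfolding prime_part_def using cs_carrier by blast
    have "0 \<in> ?S" using lattice_zero[OF lattice_Sat] lattice_zero[OF lattice_Lambda] by simp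
    then show "?G \<noteq> {}" unfolding prime_part_def by blast
  next
    fix x assume "x \<in> ?G"
    then obtain a where a: "a \<in> ?S" "x = cs a" unfolding prime_part_def by blast
    have "int m *s (- a) = - (int m *s a)" by (simp add: vec_eq_iff)
    then have "- a \<in> ?S" using a lattice_uminus[OF lattice_Sat] lattice_uminus[OF lattice_Lambda] by auto
    then show "inv\<^bsub>QG\<^esub> x \<in> ?G" unfolding a inv_QG prime_part_def by blast
    fix y assume "y \<in> ?G"
    then obtain b where b: "b \<in> ?S" "y = cs b" unfolding prime_part_def by blast
    have "int m *s (a + b) = int m *s a + int m *s b" by (simp add: vec_eq_iff algebra_simps)
    then have "a + b \<in> ?S" using a b lattice_add[OF lattice_Sat] lattice_add[OF lattice_Lambda] by auto
    then show "x \<otimes>\<^bsub>QG\<^esub> y \<in> ?G" unfolding a b mult_QG prime_part_def by blast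
  qed
  have tors: "?G \<subseteq> torsion_subgroup QG" unfolding torsion_QG cosets_def prime_part_def by blast
  have fin: "finite ?G"
    using finite_subset[OF tors] finite_cosets_Sat[OF lattice_Lambda subset_refl] by (simp add: torsion_QG)
  have pow_m: "x [^]\<^bsub>QG\<^esub> m = \<one>\<^bsub>QG\<^esub>" if xG: "x \<in> ?G" for x
  proof -
    obtain a where a: "int m *s a \<in> \<Lambda>" "x = cs a" using xG unfolding prime_part_def by blast
    show ?thesis unfolding a(2) pow_QG cs_one_iff by (rule a(1))
  qed
  \<comment> \<open>If p divided the order, a subgroup of order p would have a nontrivial element,
    whose order divides both p and \<open>m\<close>.\<close>
  have cop: "coprime (card ?G) p"
  proof (rule ccontr)
    assume "\<not> ?thesis"
    then have "p dvd card ?G" using p prime_imp_coprime coprime_commute by blast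
    then obtain j where j: "card ?G = p ^ 1 * j" by (auto elim: dvdE)
    let ?GG = "QG\<lparr>carrier := ?G\<rparr>"
    have gG: "group ?GG" by (rule subgroup.subgroup_is_group[OF sub group_QG])
    obtain H where H: "subgroup H ?GG" "card H = p ^ 1"
      using sylow_thm[OF p gG, of 1 j] j fin by (auto simp: Coset.order_def)
    have HG: "H \<subseteq> ?G" using subgroup.subset[OF H(1)] by simp
    have finH: "finite H" using finite_subset[OF HG fin] .
    have "card H > 1" using H(2) prime_gt_1_nat[OF p] by simp
    then have "\<not> H \<subseteq> {\<one>\<^bsub>QG\<^esub>}" using card_mono[of "{\<one>\<^bsub>QG\<^esub>}" H] by auto
    then obtain x where x: "x \<in> H" "x \<noteq> \<one>\<^bsub>QG\<^esub>" by blast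
    have xc: "x \<in> carrier QG" using x HG subgroup.subset[OF sub] by blast
    have "x [^]\<^bsub>?GG\<^esub> card H = \<one>\<^bsub>?GG\<^esub>" by (rule pow_card_subgroup[OF H(1) finH x(1) gG])
    then have "x [^]\<^bsub>QG\<^esub> p = \<one>\<^bsub>QG\<^esub>" using H(2) by (simp add: Q.nat_pow_consistent[symmetric])
    then have "Q.ord x dvd p" by (simp only: Q.pow_eq_id[OF xc])
    moreover have "Q.ord x dvd m" using pow_m[of x] x HG by (simp only: Q.pow_eq_id[OF xc] subsetD)
    ultimately have "Q.ord x = 1" using m(2) by (metis coprime_common_divisor_nat)
    then show False using x(2) Q.ord_eq_1[OF xc] by simp
  qed
  have largest: "H \<subseteq> ?G" if H: "subgroup H QG" "H \<subseteq> torsion_subgroup QG" "finite H" "coprime (card H) p" for H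
  proof
    fix x assume x: "x \<in> H"
    then obtain a where a: "a \<in> Sat" "x = cs a" using H(2) unfolding torsion_QG cosets_def by blast
    have xc: "x \<in> carrier QG" unfolding a by (rule cs_carrier)
    have "Q.ord x dvd card H" using pow_card_subgroup[OF H(1,3) x group_QG] by (simp only: Q.pow_eq_id[OF xc])
    then have "coprime (Q.ord x) (p ^ k)" using H(4) by (meson coprime_divisors coprime_power_right_iff dvd_refl)
    moreover have "x [^]\<^bsub>QG\<^esub> (m * p ^ k) = \<one>\<^bsub>QG\<^esub>"
      unfolding a(2) pow_QG cs_one_iff using m(3) a(1) by blast
    then have "Q.ord x dvd m * p ^ k" by (simp only: Q.pow_eq_id[OF xc])
    ultimately have "Q.ord x dvd m" by (simp add: coprime_dvd_mult_left_iff)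
    then have "x [^]\<^bsub>QG\<^esub> m = \<one>\<^bsub>QG\<^esub>" by (simp only: Q.pow_eq_id[OF xc])
    then have "int m *s a \<in> \<Lambda>" unfolding a(2) pow_QG cs_one_iff .
    then show "x \<in> ?G" unfolding prime_part_def a(2) using a(1) by blast
  qed
  show "largest_torsion_subgroup_coprime_to p QG ?G"
    unfolding largest_torsion_subgroup_coprime_to_def Let_def using sub tors fin cop largest by blast
  define f where "f = (\<lambda>a. cs (int (p ^ k) *s a))"
  have "f a = f b \<longleftrightarrow> {c. c - a \<in> Lp p} = {c. c - b \<in> Lp p}" if ab: "a \<in> Sat" "b \<in> Sat" for a b
  proof -
    have e: "int q *s a - int q *s b = int q *s (a - b)" for q by (simp add: vec_eq_iff algebra_simps)
    have "int (p ^ k) *s (a - b) \<in> \<Lambda>" if Lp: "a - b \<in> Lp p"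
    proof -
      obtain j where j: "int (p ^ j) *s (a - b) \<in> \<Lambda>" using Lp unfolding Lp_def by blast
      have "a - b \<in> Sat" by (rule lattice_diff[OF lattice_Sat ab])
      then have mk: "int (m * p ^ k) *s (a - b) \<in> \<Lambda>" using m(3) by blast
      have "coprime (int m) (int (p ^ j))" using m(2) by simp
      \<comment> \<open>Both \<open>m\<close> and p^j carry p^k (a - b) into \<Lambda>, hence so
        does their combination 1.\<close>
      then obtain u w where uw: "u * int m + w * int (p ^ j) = 1"
        using bezout_int[of "int m" "int (p ^ j)"] by (metis coprime_iff_gcd_eq_1)
      have "u *s (int (m * p ^ k) *s (a - b)) + (w * int (p ^ k)) *s (int (p ^ j) *s (a - b)) \<in> \<Lambda>"
        by (intro lattice_add[OF lattice_Lambda] lattice_scale[OF lattice_Lambda] mk j)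
      also have "u *s (int (m * p ^ k) *s (a - b)) + (w * int (p ^ k)) *s (int (p ^ j) *s (a - b)) =
        (u * int m + w * int (p ^ j)) *s (int (p ^ k) *s (a - b))"
        by (simp add: vec_eq_iff algebra_simps)
      finally show ?thesis using uw by simp
    qed
    then have "int (p ^ k) *s (a - b) \<in> \<Lambda> \<longleftrightarrow> a - b \<in> Lp p" unfolding Lp_def by blast
    then show ?thesis unfolding f_def cs_eq_iff coset_eq_iff[OF lattice_Lp] e .
  qed
  then have "card (f ` Sat) = card (cosets (Lp p) Sat)"
    unfolding cosets_def by (rule card_image_eq_if_same_fibres)
  moreover have "f ` Sat = ?G"
  proof
    show "f ` Sat \<subseteq> ?G"
    proof
      fix x assume "x \<in> f ` Sat"
      then obtain a where a: "a \<in> Sat" "x = f a" by blast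
      have "int m *s (int (p ^ k) *s a) = int (m * p ^ k) *s a" by (simp add: vec_eq_iff)
      then have "int (p ^ k) *s a \<in> ?S" using m(3) a(1) lattice_scale[OF lattice_Sat a(1)] by auto
      then show "x \<in> ?G" unfolding a f_def prime_part_def by blast
    qed
    show "?G \<subseteq> f ` Sat"
    proof
      fix x assume "x \<in> ?G"
      then obtain a where a: "a \<in> Sat" "int m *s a \<in> \<Lambda>" "x = cs a" unfolding prime_part_def by blast
      have "coprime (int m) (int (p ^ k))" using m(2) by simp
      \<comment> \<open>On vectors that \<open>m\<close> carries into \<Lambda>, multiplication by w
        p^k is the identity modulo \<Lambda>, so \<open>w *s a\<close> is a preimage.\<close>
      then obtain u w where uw: "u * int m + w * int (p ^ k) = 1"
        using bezout_int[of "int m" "int (p ^ k)"] by (metis coprime_iff_gcd_eq_1)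
      have "a - int (p ^ k) *s (w *s a) = (1 - w * int (p ^ k)) *s a"
        by (simp add: vec_eq_iff algebra_simps)
      also have "1 - w * int (p ^ k) = u * int m" using uw by simp
      also have "(u * int m) *s a = u *s (int m *s a)" by (simp add: vec_eq_iff mult.assoc)
      also have "\<dots> \<in> \<Lambda>" by (rule lattice_scale[OF lattice_Lambda a(2)])
      finally have "x = f (w *s a)" unfolding a f_def cs_eq_iff .
      then show "x \<in> f ` Sat" using lattice_scale[OF lattice_Sat a(1)] by blast
    qed
  qed
  ultimately show "card ?G = card (cosets (Lp p) Sat)" by simp
qed

end

section \<open>Herzog ideals and the main result\<close>

lemma poly_subst_herzog_mon:
  "poly_subst (\<lambda>c. [:c:]) (\<lambda>i. [:0, 1:] ^ d i) (mon e c) = Polynomial.monom (c :: 'k::field) (wt d e)"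
proof -
  interpret const: coeff_hom "\<lambda>c :: 'k. [:c:]" by unfold_locales auto
  have "(\<Prod>i\<in>UNIV. ([:0, 1:] ^ d i) ^ ex e i) = [:0, 1 :: 'k:] ^ wt d e"
    by (simp add: wt_def power_sum flip: power_mult)
  then show ?thesis unfolding const.poly_subst_mon by (simp add: monom_altdef)
qed

text \<open>The coefficient of x^n in the image collects the terms of weighted degree n.\<close>

lemma herzog_ideal_iff: "f \<in> herzog_ideal d \<longleftrightarrow> (\<forall>n. csum {e. wt d e = n} f = 0)"
proof -
  interpret const: coeff_hom "\<lambda>c :: 'b. [:c:]" by unfold_locales auto
  have "Polynomial.coeff (poly_subst (\<lambda>c. [:c:]) (\<lambda>i. [:0, 1:] ^ d i) f) n = csum {e. wt d e = n} f" for n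
    by (induction f rule: mpoly_induct)
       (auto simp: poly_subst_herzog_mon csum_mon const.poly_subst_add csum_add)
  then show ?thesis unfolding herzog_ideal_def by (simp add: poly_eq_iff)
qed

lemma ideal_herzog_ideal: "is_ideal (herzog_ideal d :: ('s::finite, 'k::field) mpoly set)"
proof -
  interpret const: coeff_hom "\<lambda>c :: 'k. [:c:]" by unfold_locales auto
  show ?thesis unfolding herzog_ideal_def by (rule const.ideal_kernel)
qed

context graded_matrix_ideal
begin

lemma subset_herzog_iff: "I \<subseteq> herzog_ideal d' \<longleftrightarrow> (\<forall>j. dotp (\<lambda>i. of_nat (d' i)) (column j L) = 0)"
proof -
  have "binomial_of a \<in> (herzog_ideal d' :: ('s, 'k) mpoly set) \<longleftrightarrow> dotp (\<lambda>i. of_nat (d' i)) a = 0" for a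
  proof -
    have "dotp (\<lambda>i. of_nat (d' i)) a = of_nat (wt d' (pos_part a)) - of_nat (wt d' (pos_part (- a)))"
      unfolding dotp_pos_part[of _ a] dotp_evec_wt ..
    then have "dotp (\<lambda>i. of_nat (d' i)) a = 0 \<longleftrightarrow> wt d' (pos_part a) = wt d' (pos_part (- a))" by simp
    moreover have "binomial_of a \<in> (herzog_ideal d' :: ('s, 'k) mpoly set) \<longleftrightarrow>
        wt d' (pos_part a) = wt d' (pos_part (- a))"
      by (auto simp: herzog_ideal_iff binomial_of_def csum_diff csum_mon)
    ultimately show ?thesis by simp
  qed
  moreover have "I \<subseteq> herzog_ideal d' \<longleftrightarrow> (\<forall>j. (binomial_of (column j L) :: ('s, 'k) mpoly) \<in> herzog_ideal d')"
    unfolding I_eq using matrix_ideal_least[OF ideal_herzog_ideal, of L d'] binomial_column_mem by blast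
  ultimately show ?thesis by simp
qed

text \<open>The ideal is unique, not the vector: any other admissible vector is proportional to
  \<open>d\<close>, so it groups exponents into the same classes of equal degree.\<close>

lemma herzog_ideal_unique:
  "\<exists>!P :: ('s, 'k) mpoly set. (\<exists>d. (\<forall>i. d i > 0) \<and> P = herzog_ideal d) \<and> I \<subseteq> P"
proof
  show "(\<exists>d'. (\<forall>i. d' i > 0) \<and> (herzog_ideal d :: ('s, 'k) mpoly set) = herzog_ideal d') \<and>
    I \<subseteq> herzog_ideal d"
    using d_pos subset_herzog_iff dotp_column by blast
  fix P :: "('s, 'k) mpoly set"
  assume "(\<exists>d. (\<forall>i. d i > 0) \<and> P = herzog_ideal d) \<and> I \<subseteq> P"
  then obtain d' where d': "\<And>i. d' i > 0" "P = herzog_ideal d'" "I \<subseteq> herzog_ideal d'" by blast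
  have "rat_of_nat (d' i) * dd k = rat_of_nat (d' k) * dd i" for i k
    using d'(3) by (intro perp_proportional) (simp add: subset_herzog_iff)
  then have prp: "d' i * d k = d' k * d i" for i k by (metis of_nat_eq_iff of_nat_mult)
  define i0 where "i0 = (undefined :: 's)"
  have w: "wt d' e * d i0 = d' i0 * wt d e" for e
    unfolding wt_def sum_distrib_left sum_distrib_right
    by (rule sum.cong) (use prp[of _ i0] in \<open>simp_all add: algebra_simps\<close>)
  have same: "wt d' e = wt d' e' \<longleftrightarrow> wt d e = wt d e'" for e e'
  proof -
    have "wt d' e = wt d' e' \<longleftrightarrow> wt d' e * d i0 = wt d' e' * d i0" using d_pos[of i0] by simp
    also have "\<dots> \<longleftrightarrow> wt d e = wt d e'" unfolding w using d'(1)[of i0] by simp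
    finally show ?thesis .
  qed
  \<comment> \<open>Proportional gradings attain different degrees, so each degree is named by an
    exponent that attains it; then \<open>same\<close> applies.\<close>
  have "(\<forall>n. csum {e. wt a e = n} f = 0) \<longleftrightarrow> (\<forall>e'. csum {e. wt a e = wt a e'} f = 0)"
    for a and f :: "('s, 'k) mpoly"
  proof
    assume h: "\<forall>e'. csum {e. wt a e = wt a e'} f = 0"
    show "\<forall>n. csum {e. wt a e = n} f = 0"
    proof
      fix n
      show "csum {e. wt a e = n} f = 0"
      proof (cases "\<exists>e'. wt a e' = n")
        case False
        then have "{e. wt a e = n} = {}" by blast
        then show ?thesis by simp
      qed (use h in blast)
    qed
  qed blast
  then show "P = herzog_ideal d" unfolding d'(2) by (auto simp: herzog_ideal_iff same)
qed

lemma curve_decomposition_iff: "curve_decomposition I \<Q> \<E> \<longleftrightarrow> curve.decomposes \<Q> \<E>"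
  by (simp only: curve_decomposition_def curve.decomposes_def)

lemma lattice_ideal_eq_curve_J: "J = curve.J"
proof -
  have "J = saturation ring_of_type_algebra I vars_prod"
    by (simp only: lattice_ideal_eq_saturation I_eq)
  then show ?thesis unfolding curve.J_def .
qed

lemma card_components:
  assumes "curve_decomposition I \<Q> \<E>" shows "card \<Q> = card PP"
  using curve.decomposes_unique[of \<Q> \<E>] assms card_image[OF curve.inj_on_loc]
  by (simp add: curve_decomposition_iff)

lemma decomposition_part_b:
  assumes D: "curve_decomposition I \<Q> \<E>" and g: "g \<in> max_ideal - (\<Union>\<qq>\<in>\<Q>. rad \<qq>)"
  shows "J = saturation ring_of_type_algebra I vars_prod" "saturation ring_of_type_algebra I vars_prod = saturation ring_of_type_algebra I g"
    "saturation ring_of_type_algebra I g = \<Inter>\<Q>" "\<Inter>\<Q> = Hull ring_of_type_algebra I"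
proof -
  have Q: "\<Q> = curve.loc ` PP" using curve.decomposes_unique D by (simp add: curve_decomposition_iff)
  have "g \<notin> P" if "P \<in> PP" for P using g curve.rad_loc[OF that] that unfolding Q by blast
  then have "saturation ring_of_type_algebra I g = curve.J" using g by (intro curve.saturation_eq_J) auto
  then show "J = saturation ring_of_type_algebra I vars_prod" "saturation ring_of_type_algebra I vars_prod = saturation ring_of_type_algebra I g"
    "saturation ring_of_type_algebra I g = \<Inter>\<Q>" "\<Inter>\<Q> = Hull ring_of_type_algebra I"
    unfolding Q curve.J_eq_Inter[symmetric] curve.Hull_eq_J lattice_ideal_eq_curve_J curve.J_def by simp_all
qed

text \<open>The embedded component is not unique: the given \<E> is discarded and I + (h^a) takes
  its place, while \<Q> stays.\<close>

lemma decomposition_part_d: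
  assumes D: "curve_decomposition I \<Q> \<E>" and um: "\<not> unmixed ring_of_type_algebra I"
  shows "\<exists>a>0. \<exists>\<qq>. \<qq> = Idl\<^bsub>ring_of_type_algebra\<^esub> (I \<union> {vars_prod ^ a}) \<and>
    J = quot I (vars_prod ^ a) \<and> curve_decomposition I \<Q> {\<qq>} \<and> I = J \<inter> \<qq>"
proof -
  have Q: "\<Q> = curve.loc ` PP" using curve.decomposes_unique D by (simp add: curve_decomposition_iff)
  have IJ: "I \<noteq> curve.J" using um curve.unmixed_iff by blast
  obtain a where a: "a > 0" "curve.J = quot I (vars_prod ^ a)"
    unfolding curve.J_def by (rule saturation_eq_quot[OF noetherian_mpoly ideal_I])
  then show ?thesis
    using curve.decomposes_mixed[OF IJ a] unfolding curve_decomposition_iff lattice_ideal_eq_curve_J Q by blast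
qed

end

theorem proposition5p7:
  fixes L :: "int ^ 'm ^ 's"
    and I :: "('s::finite, 'k::field) mpoly set"
    and \<Lambda> :: "(int ^ 's) set"
  assumes "I = matrix_ideal L"
    and "\<Lambda> = column_lattice L"
    and "graded I"
    and "\<forall>i. zero_set (Idl\<^bsub>poly_ring\<^esub> (I \<union> {var i})) = {0}"
  shows
    "\<comment> \<open>(a)\<close>
     (\<exists>\<Q> \<E>. \<Q> \<noteq> {} \<and> curve_decomposition I \<Q> \<E>) \<and>
     \<comment> \<open>(b)\<close>
     (\<forall>\<Q> \<E>. curve_decomposition I \<Q> \<E> \<longrightarrow>
        (\<forall>g \<in> max_ideal - (\<Union>\<qq>\<in>\<Q>. radical poly_ring \<qq>).
           lattice_ideal \<Lambda> = saturation poly_ring I vars_prod \<and>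
           saturation poly_ring I vars_prod = saturation poly_ring I g \<and>
           saturation poly_ring I g = \<Inter>\<Q> \<and>
           \<Inter>\<Q> = Hull poly_ring I)) \<and>
     \<comment> \<open>(c)\<close>
     rank (map_matrix rat_of_int L) = CARD('s) - 1 \<and>
     (\<exists>!P :: ('s, 'k) mpoly set. (\<exists>d. (\<forall>i. d i > 0) \<and> P = herzog_ideal d) \<and> I \<subseteq> P) \<and>
     \<comment> \<open>(d)\<close>
     (\<forall>\<Q> \<E>. curve_decomposition I \<Q> \<E> \<longrightarrow> \<not> unmixed poly_ring I \<longrightarrow>
        (\<exists>a>0. \<exists>\<qq>. \<qq> = Idl\<^bsub>poly_ring\<^esub> (I \<union> {vars_prod ^ a}) \<and>
           lattice_ideal \<Lambda> = ideal_quotient poly_ring I (vars_prod ^ a) \<and>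
           curve_decomposition I \<Q> {\<qq>} \<and>
           I = lattice_ideal \<Lambda> \<inter> \<qq>)) \<and>
     \<comment> \<open>(e)\<close>
     (\<forall>\<Q> \<E>. curve_decomposition I \<Q> \<E> \<longrightarrow>
        (CHAR('k) = 0 \<longrightarrow>
           card \<Q> \<le> card (torsion_subgroup (int_vec_group Mod \<Lambda>)) \<and>
           (algebraically_closed_type TYPE('k) \<longrightarrow>
              card \<Q> = card (torsion_subgroup (int_vec_group Mod \<Lambda>)))) \<and>
        (\<forall>p. prime p \<and> CHAR('k) = p \<longrightarrow>
           (\<exists>!G. largest_torsion_subgroup_coprime_to p (int_vec_group Mod \<Lambda>) G) \<and>
           (\<forall>G. largest_torsion_subgroup_coprime_to p (int_vec_group Mod \<Lambda>) G \<longrightarrow>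
              card \<Q> \<le> card G \<and>
              (algebraically_closed_type TYPE('k) \<longrightarrow> card \<Q> = card G))))"
proof -
  obtain d where d: "\<And>i. d i > 0" "homog_by d I"
    using assms(3) unfolding graded_def homog_by_def by blast
  interpret graded_matrix_ideal L I d
    using assms(1,4) d by unfold_locales auto
  note \<Lambda> = assms(2)
  have a: "\<exists>\<Q> \<E>. \<Q> \<noteq> {} \<and> curve_decomposition I \<Q> \<E>"
  proof -
    obtain \<E> where "curve.decomposes (curve.loc ` PP) \<E>" using curve.decomposes_exists ..
    moreover have "curve.loc ` PP \<noteq> {}" using PP_nonempty by simp
    ultimately show ?thesis unfolding curve_decomposition_iff
      by (intro exI[of _ "curve.loc ` PP"] exI[of _ \<E>] conjI)
  qed
  have e0: "card \<Q> \<le> card (torsion_subgroup (int_vec_group Mod \<Lambda>)) \<and>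
      (algebraically_closed_type TYPE('k) \<longrightarrow> card \<Q> = card (torsion_subgroup (int_vec_group Mod \<Lambda>)))"
    if D: "curve_decomposition I \<Q> \<E>" and c: "CHAR('k) = 0" for \<Q> \<E>
  proof -
    \<comment> \<open>In characteristic 0 nothing is removed from the torsion group, hence p =
      1.\<close>
    have "card PP \<le> card (cosets (Lp 1) Sat)" by (rule PP_finite_le_index(2)) simp
    moreover have "card (cosets (Lp 1) Sat) \<le> card PP" if "algebraically_closed_type TYPE('k)"
      by (rule index_le_card_PP[OF that]) (simp add: c)
    ultimately show ?thesis unfolding \<Lambda> card_torsion card_components[OF D] by (auto intro: le_antisym)
  qed
  have ep: "(\<exists>!G. largest_torsion_subgroup_coprime_to p (int_vec_group Mod \<Lambda>) G) \<and>
      (\<forall>G. largest_torsion_subgroup_coprime_to p (int_vec_group Mod \<Lambda>) G \<longrightarrow>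
        card \<Q> \<le> card G \<and> (algebraically_closed_type TYPE('k) \<longrightarrow> card \<Q> = card G))"
    if D: "curve_decomposition I \<Q> \<E>" and p: "prime p \<and> CHAR('k) = p" for \<Q> \<E> p
  proof -
    obtain m k where m: "m > 0" "coprime m p" "\<forall>a\<in>Sat. int (m * p ^ k) *s a \<in> column_lattice L"
      using Sat_exponent_coprime[of p] p by blast
    note G = prime_part_largest[OF conjunct1[OF p] m, folded \<Lambda>]
    have uniq: "G = prime_part m" if "largest_torsion_subgroup_coprime_to p (int_vec_group Mod \<Lambda>) G" for G
      using that G(1) unfolding largest_torsion_subgroup_coprime_to_def Let_def by blast
    have "card \<Q> \<le> card (prime_part m)"
      unfolding card_components[OF D] G(2) using PP_finite_le_index(2)[of p] p by blast
    moreover have "card (prime_part m) \<le> card \<Q>" if "algebraically_closed_type TYPE('k)"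
      unfolding card_components[OF D] G(2) by (rule index_le_card_PP[OF that]) (use p in blast)
    ultimately have "card \<Q> \<le> card (prime_part m) \<and>
        (algebraically_closed_type TYPE('k) \<longrightarrow> card \<Q> = card (prime_part m))"
      by (auto intro: le_antisym)
    then show ?thesis using uniq G(1) by blast
  qed
  show ?thesis
  proof (intro conjI)
    show "\<forall>\<Q> \<E>. curve_decomposition I \<Q> \<E> \<longrightarrow>
        (\<forall>g \<in> max_ideal - (\<Union>\<qq>\<in>\<Q>. radical poly_ring \<qq>).
           lattice_ideal \<Lambda> = saturation poly_ring I vars_prod \<and>
           saturation poly_ring I vars_prod = saturation poly_ring I g \<and>
           saturation poly_ring I g = \<Inter>\<Q> \<and>
           \<Inter>\<Q> = Hull poly_ring I)"
      unfolding \<Lambda> by (intro allI impI ballI conjI) (rule decomposition_part_b; assumption)+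
    show "\<forall>\<Q> \<E>. curve_decomposition I \<Q> \<E> \<longrightarrow> \<not> unmixed poly_ring I \<longrightarrow>
        (\<exists>a>0. \<exists>\<qq>. \<qq> = Idl\<^bsub>poly_ring\<^esub> (I \<union> {vars_prod ^ a}) \<and>
           lattice_ideal \<Lambda> = ideal_quotient poly_ring I (vars_prod ^ a) \<and>
           curve_decomposition I \<Q> {\<qq>} \<and>
           I = lattice_ideal \<Lambda> \<inter> \<qq>)"
      unfolding \<Lambda> by (intro allI impI) (rule decomposition_part_d)
    show "\<forall>\<Q> \<E>. curve_decomposition I \<Q> \<E> \<longrightarrow>
        (CHAR('k) = 0 \<longrightarrow>
           card \<Q> \<le> card (torsion_subgroup (int_vec_group Mod \<Lambda>)) \<and>
           (algebraically_closed_type TYPE('k) \<longrightarrow>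
              card \<Q> = card (torsion_subgroup (int_vec_group Mod \<Lambda>)))) \<and>
        (\<forall>p. prime p \<and> CHAR('k) = p \<longrightarrow>
           (\<exists>!G. largest_torsion_subgroup_coprime_to p (int_vec_group Mod \<Lambda>) G) \<and>
           (\<forall>G. largest_torsion_subgroup_coprime_to p (int_vec_group Mod \<Lambda>) G \<longrightarrow>
              card \<Q> \<le> card G \<and>
              (algebraically_closed_type TYPE('k) \<longrightarrow> card \<Q> = card G)))"
    proof (intro allI impI)
      fix \<Q> \<E> assume D: "curve_decomposition I \<Q> \<E>"
      show "(CHAR('k) = 0 \<longrightarrow>
           card \<Q> \<le> card (torsion_subgroup (int_vec_group Mod \<Lambda>)) \<and>
           (algebraically_closed_type TYPE('k) \<longrightarrow>
              card \<Q> = card (torsion_subgroup (int_vec_group Mod \<Lambda>)))) \<and>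
        (\<forall>p. prime p \<and> CHAR('k) = p \<longrightarrow>
           (\<exists>!G. largest_torsion_subgroup_coprime_to p (int_vec_group Mod \<Lambda>) G) \<and>
           (\<forall>G. largest_torsion_subgroup_coprime_to p (int_vec_group Mod \<Lambda>) G \<longrightarrow>
              card \<Q> \<le> card G \<and>
              (algebraically_closed_type TYPE('k) \<longrightarrow> card \<Q> = card G)))"
        using e0[OF D] ep[OF D] by (intro conjI impI allI) simp_all
    qed
  qed (rule a rank_A herzog_ideal_unique)+
qed

end
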